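(* Let $D_4$ be the dihedral group of order $8$ and $Q_8$ the quaternion group of order $8$. There are isomorphisms of graded rings $$R^*_{\mathbb C}(D_4)\cong\frac{\mathbb Z[x,y,b]}{(2x,\ 2y,\ 4b,\ xy,\ xb-yb)},\qquad |x|=|y|=1,\ |b|=2,$$ and $$R^*_{\mathbb C}(Q_8)\cong\frac{\mathbb Z[x,y,u]}{(2x,\ 2y,\ 8u,\ x^2,\ y^2,\ xy-4u)},\qquad |x|=|y|=1,\ |u|=2.$$
   Context: Let $G$ be a finite group. $R_{\mathbb C}(G)$ is the ring of virtual complex characters of $G$ (the free abelian group on the irreducible complex characters, with product induced by tensor product), with augmentation $\epsilon:R_{\mathbb C}(G)\to\mathbb Z$ the degree map and $I=\ker\epsilon$. Exterior powers of representations give maps $\lambda^n$ on characters, extended to $R_{\mathbb C}(G)$ by requiring $\lambda^0=1$ and $\lambda^n(x+y)=\sum_{i+j=n}\lambda^i(x)\lambda^j(y)$. Put $\gamma^n(x)=\lambda^n(x+n-1)$. Let $\Gamma^n\subseteq R_{\mathbb C}(G)$ be the additive subgroup generated by all products $\gamma^{i_1}(x_1)\cdots\gamma^{i_r}(x_r)$ with $x_j\in I$ and $\sum_j i_j\ge n$; then $\Gamma^0=R_{\mathbb C}(G)$, $\Gamma^1=I$, $\Gamma^m\Gamma^n\subseteq\Gamma^{m+n}$. The graded character ring is $R^*_{\mathbb C}(G)=\bigoplus_{n\ge0}\Gamma^n/\Gamma^{n+1}$. $|x|$ denotes the degree of a homogeneous element $x$. *)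

theory Defs
  imports
    "HOL-Algebra.Generated_Groups"
    "HOL-Algebra.QuotRing"
    "HOL-Library.Poly_Mapping"
    "Jordan_Normal_Form.VS_Connect"
    "Jordan_Normal_Form.Determinant"
begin

section \<open>The groups\<close>

text \<open>The pair \<open>(i, e)\<close> stands for \<open>r\<^sup>i s\<^sup>e\<close>, where \<open>r\<close> is the rotation of order \<open>n\<close> and \<open>s\<close> a
  reflection, so that \<open>s r s = r\<inverse>\<close>.\<close>

definition dihedral_group :: "nat \<Rightarrow> (int \<times> bool) monoid" where
  "dihedral_group n =
    \<lparr>carrier = {0..<int n} \<times> UNIV,
     mult = (\<lambda>(i, e) (j, f). ((if e then i - j else i + j) mod int n, e \<noteq> f)),
     one = (0, False)\<rparr>"

definition D4 :: "(int \<times> bool) monoid" where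
  "D4 = dihedral_group 4"

text \<open>\<open>(a, b, c, d)\<close> stands for the quaternion \<open>a + b i + c j + d k\<close>; the multiplication is Hamilton's.\<close>

definition Q8 :: "(int \<times> int \<times> int \<times> int) monoid" where
  "Q8 =
    \<lparr>carrier = {(1, 0, 0, 0), (-1, 0, 0, 0), (0, 1, 0, 0), (0, -1, 0, 0),
                (0, 0, 1, 0), (0, 0, -1, 0), (0, 0, 0, 1), (0, 0, 0, -1)},
     mult = (\<lambda>(a, b, c, d) (a', b', c', d').
       (a * a' - b * b' - c * c' - d * d',
        a * b' + b * a' + c * d' - d * c',
        a * c' - b * d' + c * a' + d * b',
        a * d' + b * c' - c * b' + d * a')),
     one = (1, 0, 0, 0)\<rparr>"


section \<open>Complex representations and characters\<close>

definition is_rep :: "('g, 'm) monoid_scheme \<Rightarrow> nat \<Rightarrow> ('g \<Rightarrow> complex mat) \<Rightarrow> bool" where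
  "is_rep G d \<rho> \<longleftrightarrow> \<rho> \<in> hom G (units_of (ring_mat TYPE(complex) d ()))"

definition is_irrep :: "('g, 'm) monoid_scheme \<Rightarrow> nat \<Rightarrow> ('g \<Rightarrow> complex mat) \<Rightarrow> bool" where
  "is_irrep G d \<rho> \<longleftrightarrow> is_rep G d \<rho> \<and> 0 < d \<and>
     (\<forall>W. subspace class_ring W (module_vec TYPE(complex) d) \<and>
          (\<forall>g\<in>carrier G. \<forall>w\<in>W. \<rho> g *\<^sub>v w \<in> W)
        \<longrightarrow> W = {0\<^sub>v d} \<or> W = carrier_vec d)"

text \<open>Functions on the group are extended by \<open>0\<close> outside the carrier.\<close>

definition character :: "('g, 'm) monoid_scheme \<Rightarrow> ('g \<Rightarrow> complex mat) \<Rightarrow> 'g \<Rightarrow> complex" where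
  "character G \<rho> = (\<lambda>g. if g \<in> carrier G then \<Sum>i<dim_row (\<rho> g). \<rho> g $$ (i, i) else 0)"

definition fun_ring :: "('g, 'm) monoid_scheme \<Rightarrow> ('g \<Rightarrow> complex) ring" where
  "fun_ring G =
    \<lparr>carrier = {f. \<forall>g. g \<notin> carrier G \<longrightarrow> f g = 0},
     mult = (\<lambda>f f' g. f g * f' g),
     one = (\<lambda>g. if g \<in> carrier G then 1 else 0),
     zero = (\<lambda>g. 0),
     add = (\<lambda>f f' g. f g + f' g)\<rparr>"

text \<open>The virtual characters are the integer combinations of irreducible characters. As the latter
  are linearly independent functions, this is the free abelian group on them; pointwise
  multiplication is the product induced by the tensor product.\<close>

definition char_ring :: "('g, 'm) monoid_scheme \<Rightarrow> ('g \<Rightarrow> complex) ring" where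
  "char_ring G = (fun_ring G)
     \<lparr>carrier := generate (add_monoid (fun_ring G)) {character G \<rho> | d \<rho>. is_irrep G d \<rho>}\<rparr>"

text \<open>The degree of a character is its value at the identity.\<close>

definition augmentation :: "('g, 'm) monoid_scheme \<Rightarrow> ('g \<Rightarrow> complex) \<Rightarrow> complex" where
  "augmentation G x = x \<one>\<^bsub>G\<^esub>"

definition augmentation_ideal :: "('g, 'm) monoid_scheme \<Rightarrow> ('g \<Rightarrow> complex) set" where
  "augmentation_ideal G = {x \<in> carrier (char_ring G). augmentation G x = 0}"


section \<open>Exterior powers and the gamma filtration\<close>

text \<open>\<open>strict_tuples d k\<close> lists the strictly increasing \<open>k\<close>-tuples in \<open>{0..<d}\<close>. They index the
  standard basis \<open>e\<^bsub>i\<^sub>1\<^esub> \<and> \<dots> \<and> e\<^bsub>i\<^sub>k\<^esub>\<close> of the \<open>k\<close>-th exterior power of \<open>\<complex>\<^sup>d\<close>, and with respect to it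
  the matrix of the \<open>k\<close>-th exterior power of \<open>A\<close> consists of the \<open>k \<times> k\<close> minors of \<open>A\<close>.\<close>

definition strict_tuples :: "nat \<Rightarrow> nat \<Rightarrow> nat list list" where
  "strict_tuples d k = filter (\<lambda>I. length I = k) (subseqs [0..<d])"

definition exterior_power_mat :: "nat \<Rightarrow> complex mat \<Rightarrow> complex mat" where
  "exterior_power_mat k A =
    (let T = strict_tuples (dim_row A) k in
     mat (length T) (length T)
       (\<lambda>(a, b). det (mat k k (\<lambda>(i, j). A $$ (T ! a ! i, T ! b ! j)))))"

definition is_lambda_structure ::
  "('g, 'm) monoid_scheme \<Rightarrow> (nat \<Rightarrow> ('g \<Rightarrow> complex) \<Rightarrow> ('g \<Rightarrow> complex)) \<Rightarrow> bool" where
  "is_lambda_structure G L \<longleftrightarrow>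
    (\<forall>n. L n \<in> carrier (char_ring G) \<rightarrow> carrier (char_ring G)) \<and>
    (\<forall>n d \<rho>. is_rep G d \<rho> \<longrightarrow> L n (character G \<rho>) = character G (\<lambda>g. exterior_power_mat n (\<rho> g))) \<and>
    (\<forall>x\<in>carrier (char_ring G). L 0 x = \<one>\<^bsub>char_ring G\<^esub>) \<and>
    (\<forall>n. \<forall>x\<in>carrier (char_ring G). \<forall>y\<in>carrier (char_ring G).
      L n (x \<oplus>\<^bsub>char_ring G\<^esub> y) =
        (\<Oplus>\<^bsub>char_ring G\<^esub>i\<in>{..n}. L i x \<otimes>\<^bsub>char_ring G\<^esub> L (n - i) y))"

text \<open>For finite \<open>G\<close> these conditions have a solution, which is unique on the carrier of
  \<^term>\<open>char_ring G\<close>; its values elsewhere are never used.\<close>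

definition lambda_op :: "('g, 'm) monoid_scheme \<Rightarrow> nat \<Rightarrow> ('g \<Rightarrow> complex) \<Rightarrow> ('g \<Rightarrow> complex)" where
  "lambda_op G = (SOME L. is_lambda_structure G L)"

definition gamma_op :: "('g, 'm) monoid_scheme \<Rightarrow> nat \<Rightarrow> ('g \<Rightarrow> complex) \<Rightarrow> ('g \<Rightarrow> complex)" where
  "gamma_op G n x =
    lambda_op G n (x \<oplus>\<^bsub>char_ring G\<^esub> ([(int n - 1)] \<cdot>\<^bsub>char_ring G\<^esub> \<one>\<^bsub>char_ring G\<^esub>))"

definition gamma_filtration :: "('g, 'm) monoid_scheme \<Rightarrow> nat \<Rightarrow> ('g \<Rightarrow> complex) set" where
  "gamma_filtration G n = generate (add_monoid (char_ring G))
    {(\<Otimes>\<^bsub>char_ring G\<^esub>j\<in>{..<r}. gamma_op G (i j) (x j)) | (r::nat) i x.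
      (\<forall>j<r. x j \<in> augmentation_ideal G) \<and> n \<le> (\<Sum>j<r. i j)}"


section \<open>Graded rings\<close>

text \<open>The ring \<open>\<Oplus>\<^sub>n F n / F (n + 1)\<close> of a multiplicative descending filtration \<open>F\<close> of \<open>R\<close> by additive
  subgroups. An element is a finitely supported family of cosets; the zero of \<open>F n / F (n + 1)\<close>
  is the coset \<open>F (n + 1)\<close> itself, and \<open>A_Mod\<close> writes this quotient group multiplicatively.\<close>

definition assoc_graded ::
  "('a, 'm) ring_scheme \<Rightarrow> (nat \<Rightarrow> 'a set) \<Rightarrow> (nat \<Rightarrow> 'a set) ring" where
  "assoc_graded R F =
    (let Q = (\<lambda>n. R\<lparr>carrier := F n\<rparr> A_Mod F (Suc n)) in
     \<lparr>carrier = {f. (\<forall>n. f n \<in> carrier (Q n)) \<and> finite {n. f n \<noteq> \<one>\<^bsub>Q n\<^esub>}},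
      mult = (\<lambda>f g n. \<Otimes>\<^bsub>Q n\<^esub>i\<in>{..n}. rcoset_mult R (F (Suc n)) (f i) (g (n - i))),
      one = (\<lambda>n. if n = 0 then F 1 +>\<^bsub>R\<^esub> \<one>\<^bsub>R\<^esub> else \<one>\<^bsub>Q n\<^esub>),
      zero = (\<lambda>n. \<one>\<^bsub>Q n\<^esub>),
      add = (\<lambda>f g n. f n \<otimes>\<^bsub>Q n\<^esub> g n)\<rparr>)"

definition assoc_graded_component ::
  "('a, 'm) ring_scheme \<Rightarrow> (nat \<Rightarrow> 'a set) \<Rightarrow> nat \<Rightarrow> (nat \<Rightarrow> 'a set) set" where
  "assoc_graded_component R F n =
    {f \<in> carrier (assoc_graded R F). \<forall>m. m \<noteq> n \<longrightarrow> f m = F (Suc m)}"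

definition graded_char_ring :: "('g, 'm) monoid_scheme \<Rightarrow> (nat \<Rightarrow> ('g \<Rightarrow> complex) set) ring" where
  "graded_char_ring G = assoc_graded (char_ring G) (gamma_filtration G)"

definition graded_char_component ::
  "('g, 'm) monoid_scheme \<Rightarrow> nat \<Rightarrow> (nat \<Rightarrow> ('g \<Rightarrow> complex) set) set" where
  "graded_char_component G = assoc_graded_component (char_ring G) (gamma_filtration G)"

definition graded_ring_isomorphic ::
  "('a, 'm) ring_scheme \<Rightarrow> (nat \<Rightarrow> 'a set) \<Rightarrow> ('b, 'n) ring_scheme \<Rightarrow> (nat \<Rightarrow> 'b set) \<Rightarrow> bool" where
  "graded_ring_isomorphic R A S B \<longleftrightarrow> (\<exists>h\<in>ring_iso R S. \<forall>n. h ` A n = B n)"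


section \<open>Graded quotients of a polynomial ring in three variables\<close>

text \<open>Polynomials are integer-valued finitely supported functions on monomials, and monomials are
  finitely supported exponent functions. The first two variables have degree 1, the third
  has degree 2.\<close>

datatype indet = V1 | V2 | V3

type_synonym poly3 = "(indet \<Rightarrow>\<^sub>0 nat) \<Rightarrow>\<^sub>0 int"

fun indet_degree :: "indet \<Rightarrow> nat" where
  "indet_degree V1 = 1"
| "indet_degree V2 = 1"
| "indet_degree V3 = 2"

definition var :: "indet \<Rightarrow> poly3" where
  "var v = Poly_Mapping.single (Poly_Mapping.single v 1) 1"

definition poly3_ring :: "poly3 ring" where
  "poly3_ring = \<lparr>carrier = UNIV, mult = (*), one = 1, zero = 0, add = (+)\<rparr>"

definition monomial_degree :: "(indet \<Rightarrow>\<^sub>0 nat) \<Rightarrow> nat" where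
  "monomial_degree m = (\<Sum>v\<in>Poly_Mapping.keys m. Poly_Mapping.lookup m v * indet_degree v)"

definition presented_ring :: "poly3 set \<Rightarrow> poly3 set ring" where
  "presented_ring S = poly3_ring Quot (genideal poly3_ring S)"

definition presented_component :: "poly3 set \<Rightarrow> nat \<Rightarrow> poly3 set set" where
  "presented_component S n =
    {genideal poly3_ring S +>\<^bsub>poly3_ring\<^esub> p | p.
      \<forall>m\<in>Poly_Mapping.keys p. monomial_degree m = n}"

end

theory Submission
  imports
    Defs
    "Jordan_Normal_Form.Schur_Decomposition"
    "HOL-Computational_Algebra.Polynomial_FPS"
begin

text \<open>Newton's identities express \<open>\<lambda>\<^sup>n\<close> of a character \<open>\<chi>\<close> through the functions \<open>g \<mapsto> \<chi>(g\<^sup>k)\<close>. The resulting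
  formula makes sense for all class functions, turns sums into convolutions, and hence is the
  \<open>\<lambda>\<close>-structure. A class function on either group is a vector of five values, and a virtual
  character is such a vector in an explicit lattice of integer vectors.

  As \<open>\<gamma>\<^sub>t\<close> is multiplicative, \<open>\<Gamma>\<^sup>n\<close> is controlled by \<open>\<gamma>\<^sup>1(\<chi> - 1) = \<chi> - 1\<close> for the linear characters
  \<open>\<chi>\<close> and by \<open>\<gamma>\<^sup>1\<close> and \<open>\<gamma>\<^sup>2\<close> of \<open>D - 2\<close>, where \<open>D\<close> is the irreducible representation of degree 2. This
  yields congruences, modulo powers of 2, that define \<open>\<Gamma>\<^sup>n\<close> inside the lattice; every vector
  satisfying them is the value of a polynomial with terms of degree at least \<open>n\<close> in two elements
  \<open>\<chi> - 1\<close> and \<open>\<gamma>\<^sup>2(D - 2)\<close>. Modulo the relations a homogeneous polynomial reduces to a combination of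
  at most three monomials, whose coefficients can be read off from the five values modulo
  precisely the orders which the relations prescribe.\<close>

section \<open>Exterior powers and determinants\<close>

text \<open>Both groups have the same character table. The sign \<tau> is visible only in
  \<open>det D\<close>, hence in gamma^2(D - 2) = 1 - D + det D, whose value on \<open>s\<close> and
  \<open>r s\<close> is 1 - \<tau>. For D4 this element vanishes on the reflections, so the values
  there come from powers of \<chi> - 1 alone and are divisible by 2^n in degree n. For Q8 it equals
  2 on all three classes of elements of order 4, and in odd degrees the congruences keep a condition
  that couples the values at all classes; this raises the order of the degree 2 generator from 4 to
  8.

  As \<open>lambda_op\<close> is a choice among the solutions of \<open>is_lambda_structure\<close>,
  it cannot be computed by unfolding. Newton's formula shows that a solution exists, and the
  difficulty there is integrality, which its denominators hide. The gamma operations on generators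
  of the augmentation ideal are then derived from the defining conditions alone.\<close>

definition principal_minor :: "complex mat \<Rightarrow> nat set \<Rightarrow> complex" where
  "principal_minor A S = (\<Sum>p | p permutes S. signof p * (\<Prod>i\<in>S. A $$ (i, p i)))"

text \<open>Enumerating the index set by I carries permutations of positions to permutations of the
  set, and relabelling preserves signs. So the minor depends on the set only, not on the order of
  the tuple.\<close>

lemma principal_minor_eq_det:
  assumes "distinct I" and "length I = k"
  shows "det (mat k k (\<lambda>(i, j). A $$ (I ! i, I ! j))) = principal_minor A (set I)"
proof -
  have bij: "bij_betw (\<lambda>i. I ! i) {0..<k} (set I)"
    using assms bij_betw_nth[of I "{0..<k}" "set I"] by (simp add: atLeast0LessThan)
  note inj = bij_betw_imp_inj_on[OF bij]
  let ?m = "map_permutation {0..<k} (\<lambda>i. I ! i)"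
  have bijp: "bij_betw ?m {p. p permutes {0..<k}} {p. p permutes set I}"
  proof (rule bij_betw_byWitness)
    have bij': "bij_betw (inv_into {0..<k} (\<lambda>i. I ! i)) (set I) {0..<k}"
      by (rule bij_betw_inv_into[OF bij])
    show "\<forall>p\<in>{p. p permutes {0..<k}}.
      map_permutation (set I) (inv_into {0..<k} (\<lambda>i. I ! i)) (?m p) = p"
      using map_permutation_compose_inv[OF bij] inj by simp
    show "\<forall>p\<in>{p. p permutes set I}.
      ?m (map_permutation (set I) (inv_into {0..<k} (\<lambda>i. I ! i)) p) = p"
      using map_permutation_compose_inv[OF bij'] bij by (simp add: bij_betw_inv_into_right)
    show "?m ` {p. p permutes {0..<k}} \<subseteq> {p. p permutes set I}"
      using map_permutation_permutes[OF bij] by blast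
    show "map_permutation (set I) (inv_into {0..<k} (\<lambda>i. I ! i)) ` {p. p permutes set I}
      \<subseteq> {p. p permutes {0..<k}}"
      using map_permutation_permutes[OF bij'] by blast
  qed
  have "principal_minor A (set I)
      = (\<Sum>p | p permutes {0..<k}. signof (?m p) * (\<Prod>i\<in>set I. A $$ (i, ?m p i)))"
    unfolding principal_minor_def by (rule sum.reindex_bij_betw[OF bijp, symmetric])
  also have "\<dots> = (\<Sum>p | p permutes {0..<k}. signof p * (\<Prod>i=0..<k. A $$ (I ! i, I ! (p i))))"
  proof (rule sum.cong[OF refl])
    fix p assume "p \<in> {p. p permutes {0..<k}}"
    then have p: "p permutes {0..<k}" by simp
    have s: "sign (?m p) = sign p"
      by (rule sign_map_permutation[OF inj p]) simp
    have "(\<Prod>i\<in>set I. A $$ (i, ?m p i)) = (\<Prod>i=0..<k. A $$ (I ! i, ?m p (I ! i)))"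
      by (rule prod.reindex_bij_betw[OF bij, symmetric])
    also have "\<dots> = (\<Prod>i=0..<k. A $$ (I ! i, I ! (p i)))"
      by (rule prod.cong[OF refl]) (simp add: map_permutation_apply[OF inj])
    finally show "signof (?m p) * (\<Prod>i\<in>set I. A $$ (i, ?m p i))
        = signof p * (\<Prod>i=0..<k. A $$ (I ! i, I ! (p i)))"
      using s by simp
  qed
  also have "\<dots> = det (mat k k (\<lambda>(i, j). A $$ (I ! i, I ! j)))"
    by (subst det_def'[of _ k]) (auto intro!: sum.cong prod.cong dest: permutes_in_image)
  finally show ?thesis by simp
qed

text \<open>In the Leibniz formula expand each product over the set S of rows in which the summand
  from t A is taken. The remaining factors are entries of the identity matrix, so only permutations
  fixing everything outside S survive, and these are the permutations of S.\<close>

lemma det_one_plus_smult: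
  fixes A :: "complex mat"
  assumes "A \<in> carrier_mat d d"
  shows "det (1\<^sub>m d + t \<cdot>\<^sub>m A) = (\<Sum>S\<in>Pow {0..<d}. t ^ card S * principal_minor A S)"
proof -
  let ?U = "{0..<d}"
  have fin: "finite {p. p permutes ?U}" by (simp add: finite_permutations)
  have "det (1\<^sub>m d + t \<cdot>\<^sub>m A)
      = (\<Sum>p | p permutes ?U. signof p * (\<Prod>i\<in>?U. t * A $$ (i, p i) + (if i = p i then 1 else 0)))"
    using assms by (subst det_def'[of _ d])
      (auto intro!: sum.cong prod.cong dest: permutes_in_image simp: add.commute)
  also have "\<dots> = (\<Sum>p | p permutes ?U. \<Sum>S\<in>Pow ?U. signof p * ((\<Prod>i\<in>S. t * A $$ (i, p i)) *
      (\<Prod>i\<in>?U - S. if i = p i then 1 else 0)))"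
    by (simp add: prod_add sum_distrib_left)
  also have "\<dots> = (\<Sum>S\<in>Pow ?U. \<Sum>p | p permutes ?U. signof p * ((\<Prod>i\<in>S. t * A $$ (i, p i)) *
      (\<Prod>i\<in>?U - S. if i = p i then 1 else 0)))"
    by (rule sum.swap)
  also have "\<dots> = (\<Sum>S\<in>Pow ?U. t ^ card S * principal_minor A S)"
  proof (rule sum.cong[OF refl])
    fix S assume "S \<in> Pow ?U"
    then have S: "S \<subseteq> ?U" and finS: "finite S" using finite_subset[of S ?U] by auto
    have "(\<Sum>p | p permutes ?U. signof p * ((\<Prod>i\<in>S. t * A $$ (i, p i)) *
        (\<Prod>i\<in>?U - S. if i = p i then 1 else 0)))
      = (\<Sum>p | p permutes S. signof p * (\<Prod>i\<in>S. t * A $$ (i, p i)))"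
    proof (rule sum.mono_neutral_cong_right[OF fin])
      show "{p. p permutes S} \<subseteq> {p. p permutes ?U}"
        using permutes_subset[OF _ S] by blast
      show "\<forall>p\<in>{p. p permutes ?U} - {p. p permutes S}. signof p * ((\<Prod>i\<in>S. t * A $$ (i, p i)) *
        (\<Prod>i\<in>?U - S. if i = p i then 1 else 0)) = 0"
      proof
        fix p assume "p \<in> {p. p permutes ?U} - {p. p permutes S}"
        then have p: "p permutes ?U" "\<not> p permutes S" by auto
        then obtain i where "i \<notin> S" "p i \<noteq> i"
          using permutes_superset[OF p(1), of S] by blast
        then have "i \<in> ?U - S" "i \<noteq> p i" using permutes_not_in[OF p(1)] by auto
        then have "(\<Prod>i\<in>?U - S. if i = p i then 1 else (0::complex)) = 0"
          by (intro prod_zero) auto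
        then show "signof p * ((\<Prod>i\<in>S. t * A $$ (i, p i)) *
          (\<Prod>i\<in>?U - S. if i = p i then 1 else 0)) = 0" by simp
      qed
      fix p assume "p \<in> {p. p permutes S}"
      then have "(\<Prod>i\<in>?U - S. if i = p i then 1 else (0::complex)) = 1"
        by (intro prod.neutral) (auto dest: permutes_not_in)
      then show "signof p * ((\<Prod>i\<in>S. t * A $$ (i, p i)) * (\<Prod>i\<in>?U - S. if i = p i then 1 else 0))
        = signof p * (\<Prod>i\<in>S. t * A $$ (i, p i))" by simp
    qed
    also have "\<dots> = t ^ card S * principal_minor A S"
      by (simp add: principal_minor_def prod.distrib sum_distrib_left mult.left_commute)
    finally show "(\<Sum>p | p permutes ?U. signof p * ((\<Prod>i\<in>S. t * A $$ (i, p i)) *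
        (\<Prod>i\<in>?U - S. if i = p i then 1 else 0))) = t ^ card S * principal_minor A S" .
  qed
  finally show ?thesis .
qed

definition mat_trace :: "complex mat \<Rightarrow> complex" where
  "mat_trace A = (\<Sum>i<dim_row A. A $$ (i, i))"

text \<open>Distinct increasing tuples have distinct sets of entries. This turns a sum over
  positions in the list of tuples into a sum over subsets.\<close>

lemma bij_betw_strict_tuples:
  "bij_betw (\<lambda>a. set (strict_tuples d k ! a)) {..<length (strict_tuples d k)}
     {S. S \<subseteq> {0..<d} \<and> card S = k}"
proof -
  let ?T = "strict_tuples d k"
  have dist: "distinct (map set (subseqs [0..<d]))"
    by (rule distinct_set_subseqs) simp
  have card: "card (set I) = length I" if "I \<in> set (subseqs [0..<d])" for I
    using subseqs_distinctD[OF that] by (simp add: distinct_card)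
  have "distinct (map set ?T)"
    using dist unfolding strict_tuples_def by (rule distinct_map_filter)
  then have "bij_betw (\<lambda>a. map set ?T ! a) {..<length (map set ?T)} (set (map set ?T))"
    by (intro bij_betw_nth) auto
  moreover have "set (map set ?T) = {S. S \<subseteq> {0..<d} \<and> card S = k}"
  proof (intro equalityI subsetI)
    fix S assume "S \<in> set (map set ?T)"
    then obtain I where "S = set I" "I \<in> set (subseqs [0..<d])" "length I = k"
      unfolding strict_tuples_def by auto
    then show "S \<in> {S. S \<subseteq> {0..<d} \<and> card S = k}"
      using subseqs_powset[of "[0..<d]"] card by auto
  next
    fix S assume S: "S \<in> {S. S \<subseteq> {0..<d} \<and> card S = k}"
    then have "S \<in> set ` set (subseqs [0..<d])" by (simp add: subseqs_powset)
    then show "S \<in> set (map set ?T)"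
      using S card unfolding strict_tuples_def by auto
  qed
  ultimately show ?thesis
    using bij_betw_cong[of "{..<length ?T}" "\<lambda>a. map set ?T ! a" "\<lambda>a. set (?T ! a)"] by simp
qed

lemma mat_trace_exterior_power:
  assumes "A \<in> carrier_mat d d"
  shows "mat_trace (exterior_power_mat k A) = (\<Sum>S | S \<subseteq> {0..<d} \<and> card S = k. principal_minor A S)"
proof -
  let ?T = "strict_tuples d k"
  have "mat_trace (exterior_power_mat k A)
      = (\<Sum>a<length ?T. det (mat k k (\<lambda>(i, j). A $$ (?T ! a ! i, ?T ! a ! j))))"
    using assms by (simp add: mat_trace_def exterior_power_mat_def Let_def)
  also have "\<dots> = (\<Sum>a<length ?T. principal_minor A (set (?T ! a)))"
  proof (rule sum.cong[OF refl])
    fix a assume "a \<in> {..<length ?T}"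
    then have "?T ! a \<in> set ?T" by simp
    then have "distinct (?T ! a)" "length (?T ! a) = k"
      unfolding strict_tuples_def using subseqs_distinctD[of _ "[0..<d]"] by auto
    then show "det (mat k k (\<lambda>(i, j). A $$ (?T ! a ! i, ?T ! a ! j))) = principal_minor A (set (?T ! a))"
      by (rule principal_minor_eq_det)
  qed
  also have "\<dots> = (\<Sum>S | S \<subseteq> {0..<d} \<and> card S = k. principal_minor A S)"
    by (rule sum.reindex_bij_betw[OF bij_betw_strict_tuples])
  finally show ?thesis .
qed

lemma mat_trace_exterior_power_gt:
  assumes "A \<in> carrier_mat d d" and "d < k"
  shows "mat_trace (exterior_power_mat k A) = 0"
proof -
  have "{S. S \<subseteq> {0..<d} \<and> card S = k} = {}"
    using assms(2) by (auto dest: card_mono[rotated])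
  then show ?thesis unfolding mat_trace_exterior_power[OF assms(1)] by (simp only: sum.empty)
qed

text \<open>Principal minors grouped by size give the traces of the exterior powers. As the
  determinant is a similarity invariant, these traces can be computed from a triangular
  form.\<close>

lemma det_one_plus_smult_exterior:
  assumes A: "A \<in> carrier_mat d d"
  shows "det (1\<^sub>m d + t \<cdot>\<^sub>m A) = (\<Sum>k\<le>d. mat_trace (exterior_power_mat k A) * t ^ k)"
proof -
  have "(\<Sum>S\<in>Pow {0..<d}. t ^ card S * principal_minor A S)
      = (\<Sum>k\<le>d. \<Sum>S | S \<in> Pow {0..<d} \<and> card S = k. t ^ card S * principal_minor A S)"
    by (rule sum.group[symmetric]) (auto dest: card_mono[rotated])
  then show ?thesis
    unfolding det_one_plus_smult[OF A] mat_trace_exterior_power[OF A]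
    by (simp add: sum_distrib_left mult.commute)
qed

text \<open>A power series and not a polynomial, because it has to be compared with the solution of
  a differential equation and later composed with t / (1 - t).\<close>

definition exterior_fps :: "complex mat \<Rightarrow> complex fps" where
  "exterior_fps A = Abs_fps (\<lambda>k. mat_trace (exterior_power_mat k A))"

text \<open>Equality of polynomial functions on the infinite field of complex numbers gives equality
  of coefficients; beyond the size d of the matrix they vanish.\<close>

lemma exterior_fps_eqI:
  assumes A: "A \<in> carrier_mat d d" and "\<And>t. det (1\<^sub>m d + t \<cdot>\<^sub>m A) = poly p t"
  shows "exterior_fps A = fps_of_poly p"
proof -
  let ?q = "\<Sum>k\<le>d. monom (mat_trace (exterior_power_mat k A)) k"
  have "poly p = poly ?q"
    using assms(2) det_one_plus_smult_exterior[OF A] by (auto simp: poly_sum poly_monom)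
  then have "p = ?q" by (rule poly_eq_poly_eq_iff[THEN iffD1])
  then have "coeff p n = mat_trace (exterior_power_mat n A)" for n
    using mat_trace_exterior_power_gt[OF A, of n]
    by (auto simp: coeff_sum coeff_monom sum.delta not_le)
  then show ?thesis by (simp add: exterior_fps_def fps_eq_iff fps_of_poly_nth)
qed

section \<open>Newton's identities\<close>

lemma mat_trace_mult_commute:
  assumes "A \<in> carrier_mat n m" and "B \<in> carrier_mat m n"
  shows "mat_trace (A * B) = mat_trace (B * A)"
proof -
  have "mat_trace (A * B) = (\<Sum>i<n. \<Sum>k<m. A $$ (i, k) * B $$ (k, i))"
    using assms by (simp add: mat_trace_def scalar_prod_def atLeast0LessThan)
  also have "\<dots> = (\<Sum>k<m. \<Sum>i<n. A $$ (i, k) * B $$ (k, i))" by (rule sum.swap)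
  also have "\<dots> = mat_trace (B * A)"
    using assms by (simp add: mat_trace_def scalar_prod_def atLeast0LessThan mult.commute)
  finally show ?thesis .
qed

lemma mat_trace_similar:
  assumes "similar_mat A B"
  shows "mat_trace A = mat_trace B"
proof -
  obtain n P Q where *: "A \<in> carrier_mat n n" "B \<in> carrier_mat n n" "P \<in> carrier_mat n n"
    "Q \<in> carrier_mat n n" and QP: "Q * P = 1\<^sub>m n" and A: "A = P * B * Q"
    using similar_matD[OF assms] by blast
  have "mat_trace A = mat_trace (Q * (P * B))"
    unfolding A by (rule mat_trace_mult_commute) (use * in auto)
  also have "Q * (P * B) = B"
    using * QP by (simp add: assoc_mult_mat[of Q n n P n B n, symmetric])
  finally show ?thesis .
qed

lemma upper_triangular_mult:
  fixes A B :: "'a::semiring_0 mat"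
  assumes A: "A \<in> carrier_mat n n" "upper_triangular A"
    and B: "B \<in> carrier_mat n n" "upper_triangular B"
  shows "upper_triangular (A * B)"
    and "i < n \<Longrightarrow> (A * B) $$ (i, i) = A $$ (i, i) * B $$ (i, i)"
proof -
  have ent: "(A * B) $$ (i, j) = (\<Sum>k<n. A $$ (i, k) * B $$ (k, j))" if "i < n" "j < n" for i j
    using A B that by (simp add: scalar_prod_def atLeast0LessThan)
  have zero: "A $$ (i, k) * B $$ (k, j) = 0" if "i < n" "k < n" "k < i \<or> j < k" for i j k
    using A B that by (auto dest: upper_triangularD)
  show "upper_triangular (A * B)"
  proof (rule upper_triangularI)
    fix i j assume "j < i" "i < dim_row (A * B)"
    then show "(A * B) $$ (i, j) = 0"
      using A(1) by (subst ent) (auto intro!: sum.neutral zero)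
  qed
  assume i: "i < n"
  have "(\<Sum>k<n. A $$ (i, k) * B $$ (k, i)) = (\<Sum>k\<in>{i}. A $$ (i, k) * B $$ (k, i))"
    by (rule sum.mono_neutral_right) (use i in \<open>auto intro!: zero simp: neq_iff\<close>)
  then show "(A * B) $$ (i, i) = A $$ (i, i) * B $$ (i, i)"
    using ent[OF i i] by simp
qed

lemma upper_triangular_pow:
  fixes A :: "'a::semiring_1 mat"
  assumes A: "A \<in> carrier_mat n n" "upper_triangular A"
  shows "upper_triangular (A ^\<^sub>m k)" and "i < n \<Longrightarrow> (A ^\<^sub>m k) $$ (i, i) = A $$ (i, i) ^ k"
proof -
  have "upper_triangular (A ^\<^sub>m k) \<and> (\<forall>i<n. (A ^\<^sub>m k) $$ (i, i) = A $$ (i, i) ^ k)"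
  proof (induction k)
    case 0
    show ?case using A by auto
  next
    case (Suc k)
    then show ?case
      using A upper_triangular_mult[of "A ^\<^sub>m k" n A] by (simp add: power_commutes)
  qed
  then show "upper_triangular (A ^\<^sub>m k)" "i < n \<Longrightarrow> (A ^\<^sub>m k) $$ (i, i) = A $$ (i, i) ^ k"
    by auto
qed

text \<open>One Schur triangular form of A serves both conclusions, because for a triangular matrix
  the traces of powers and det (1 + t A) depend on the diagonal only. The list is that diagonal, the
  eigenvalues with multiplicity.\<close>

lemma exterior_fps_mat_trace_pow_eigenvalues:
  assumes A: "A \<in> carrier_mat d d"
  obtains as where "\<And>k. mat_trace (A ^\<^sub>m k) = (\<Sum>a\<leftarrow>as. a ^ k)"
    and "exterior_fps A = (\<Prod>a\<leftarrow>as. 1 + fps_const a * fps_X)"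
proof -
  obtain es where "char_poly A = (\<Prod>a\<leftarrow>es. [:- a, 1:])"
    using char_poly_factorized[OF A] by blast
  from schur_decomposition_exists[OF A this]
  obtain B where B: "B \<in> carrier_mat d d" "upper_triangular B" and sim: "similar_mat A B"
    by blast
  then obtain P Q where PQ: "similar_mat_wit A B P Q" unfolding similar_mat_def by blast
  let ?as = "diag_mat B"
  have len: "length ?as = d" using B by (simp add: diag_mat_def)
  have sum_diag: "(\<Sum>a\<leftarrow>?as. f a) = (\<Sum>i<d. f (B $$ (i, i)))" for f :: "complex \<Rightarrow> complex"
    using B by (simp add: diag_mat_def interv_sum_list_conv_sum_set_nat o_def atLeast0LessThan)
  have "mat_trace (A ^\<^sub>m k) = (\<Sum>a\<leftarrow>?as. a ^ k)" for k
  proof -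
    have "similar_mat (A ^\<^sub>m k) (B ^\<^sub>m k)"
      using similar_mat_wit_pow[OF PQ] unfolding similar_mat_def by blast
    then have "mat_trace (A ^\<^sub>m k) = mat_trace (B ^\<^sub>m k)" by (rule mat_trace_similar)
    also have "\<dots> = (\<Sum>a\<leftarrow>?as. a ^ k)"
      using B upper_triangular_pow(2)[OF B] unfolding sum_diag by (simp add: mat_trace_def)
    finally show ?thesis .
  qed
  moreover have "exterior_fps A = fps_of_poly (\<Prod>a\<leftarrow>?as. [:1, a:])"
  proof (rule exterior_fps_eqI[OF A])
    fix t :: complex
    have "P * Q = 1\<^sub>m d" "Q * P = 1\<^sub>m d" "A = P * B * Q" "P \<in> carrier_mat d d" "Q \<in> carrier_mat d d"
      using similar_mat_witD2[OF A PQ] by auto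
    note PQ' = this
    \<comment> \<open>The conjugation that triangularises A also triangularises 1 + t A.\<close>
    have "P * (1\<^sub>m d + t \<cdot>\<^sub>m B) = P + t \<cdot>\<^sub>m (P * B)"
      using PQ' B mult_add_distrib_mat[of P d d "1\<^sub>m d" d "t \<cdot>\<^sub>m B"] mult_smult_distrib[of P d d B d t]
      by simp
    then have "P * (1\<^sub>m d + t \<cdot>\<^sub>m B) * Q = (P + t \<cdot>\<^sub>m (P * B)) * Q" by simp
    also have "\<dots> = 1\<^sub>m d + t \<cdot>\<^sub>m A"
      using PQ' B add_mult_distrib_mat[of P d d "t \<cdot>\<^sub>m (P * B)" Q d]
        mult_smult_assoc_mat[of "P * B" d d Q d t]
      by simp
    finally have "1\<^sub>m d + t \<cdot>\<^sub>m A = P * (1\<^sub>m d + t \<cdot>\<^sub>m B) * Q" by (rule sym)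
    then have "similar_mat_wit (1\<^sub>m d + t \<cdot>\<^sub>m A) (1\<^sub>m d + t \<cdot>\<^sub>m B) P Q"
      by (rule similar_mat_witI[OF PQ'(1,2) _ _ _ PQ'(4,5)]) (use A B in simp_all)
    then have "det (1\<^sub>m d + t \<cdot>\<^sub>m A) = det (1\<^sub>m d + t \<cdot>\<^sub>m B)"
      by (intro det_similar) (auto simp: similar_mat_def)
    also have "\<dots> = prod_list (diag_mat (1\<^sub>m d + t \<cdot>\<^sub>m B))"
      using B by (intro det_upper_triangular[of _ d] upper_triangularI) (auto dest: upper_triangularD)
    also have "diag_mat (1\<^sub>m d + t \<cdot>\<^sub>m B) = map (\<lambda>a. 1 + t * a) ?as"
      using B by (auto simp: diag_mat_def)
    also have "prod_list \<dots> = poly (\<Prod>a\<leftarrow>?as. [:1, a:]) t"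
      by (simp add: poly_prod_list o_def)
    finally show "det (1\<^sub>m d + t \<cdot>\<^sub>m A) = poly (\<Prod>a\<leftarrow>?as. [:1, a:]) t" .
  qed
  moreover have "fps_of_poly (\<Prod>a\<leftarrow>as. [:1, a:]) = (\<Prod>a\<leftarrow>as. 1 + fps_const a * fps_X)" for as :: "complex list"
    by (induction as)
      (simp_all only: list.map prod_list.Nil prod_list.Cons fps_of_poly_1 fps_of_poly_mult
         fps_of_poly_linear')
  ultimately show ?thesis using that by metis
qed

text \<open>Because of the division it is not evident that virtual characters are sent to virtual
  characters; \<open>newton_lambda_closed\<close> proves this separately. Power sums are counted
  from 1, whence the argument \<open>Suc i\<close>.\<close>

fun newton_coeff :: "(nat \<Rightarrow> complex) \<Rightarrow> nat \<Rightarrow> complex" where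
  "newton_coeff s 0 = 1"
| "newton_coeff s (Suc n) = (\<Sum>i\<le>n. (-1) ^ i * s (Suc i) * newton_coeff s (n - i)) / of_nat (Suc n)"

text \<open>The elementary symmetric functions as determined by the power sums \<open>s\<close>: the generating function
  is \<open>exp (s\<^sub>1 t - s\<^sub>2 t\<^sup>2 / 2 + s\<^sub>3 t\<^sup>3 / 3 - \<dots>)\<close>, and Newton's identities are its differential equation.\<close>

definition newton_fps :: "(nat \<Rightarrow> complex) \<Rightarrow> complex fps" where
  "newton_fps s = Abs_fps (newton_coeff s)"

text \<open>The logarithmic derivative of \<open>newton_fps s\<close>.\<close>

definition power_sum_fps :: "(nat \<Rightarrow> complex) \<Rightarrow> complex fps" where
  "power_sum_fps s = Abs_fps (\<lambda>i. (-1) ^ i * s (Suc i))"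

lemma newton_fps_nth_0 [simp]: "fps_nth (newton_fps s) 0 = 1"
  by (simp add: newton_fps_def)

lemma newton_fps_deriv: "fps_deriv (newton_fps s) = power_sum_fps s * newton_fps s"
proof (rule fps_ext)
  fix n
  have "of_nat (Suc n) \<noteq> (0::complex)" by (simp only: of_nat_eq_0_iff)
  then show "fps_nth (fps_deriv (newton_fps s)) n = fps_nth (power_sum_fps s * newton_fps s) n"
    by (simp add: newton_fps_def power_sum_fps_def fps_mult_nth atLeast0AtMost del: of_nat_Suc)
qed

text \<open>Coefficient m of the equation expresses (m + 1) times coefficient m + 1 of f through
  earlier ones, so the constant term 1 determines f. The rules for \<open>newton_fps\<close> below
  thereby become verifications of this equation.\<close>

lemma newton_fps_unique:
  assumes "fps_nth f 0 = 1" and "fps_deriv f = power_sum_fps s * f"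
  shows "f = newton_fps s"
proof (rule fps_ext)
  fix n show "fps_nth f n = fps_nth (newton_fps s) n"
  proof (induction n rule: less_induct)
    case (less n)
    show ?case
    proof (cases n)
      case 0
      then show ?thesis using assms(1) by simp
    next
      case (Suc m)
      have "of_nat (Suc m) * fps_nth f (Suc m) = fps_nth (power_sum_fps s * f) m"
        using arg_cong[OF assms(2), of "\<lambda>g. fps_nth g m"] by simp
      also have "\<dots> = fps_nth (power_sum_fps s * newton_fps s) m"
        unfolding fps_mult_nth by (rule sum.cong) (use less Suc in auto)
      also have "\<dots> = of_nat (Suc m) * fps_nth (newton_fps s) (Suc m)"
        using arg_cong[OF newton_fps_deriv[of s], of "\<lambda>g. fps_nth g m"] by simp
      finally show ?thesis
        using Suc by (simp del: of_nat_Suc)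
    qed
  qed
qed

text \<open>Logarithmic derivatives add under multiplication.\<close>

lemma newton_fps_add: "newton_fps (\<lambda>k. s k + s' k) = newton_fps s * newton_fps s'"
proof -
  have "power_sum_fps (\<lambda>k. s k + s' k) = power_sum_fps s + power_sum_fps s'"
    by (simp add: power_sum_fps_def fps_eq_iff algebra_simps)
  then show ?thesis
    by (intro newton_fps_unique[symmetric]) (simp_all add: newton_fps_deriv algebra_simps)
qed

lemma newton_fps_zero: "newton_fps (\<lambda>k. 0) = 1"
  by (rule newton_fps_unique[symmetric]) (simp_all add: power_sum_fps_def fps_eq_iff fps_mult_nth)

lemma newton_fps_power: "newton_fps (\<lambda>k. a ^ k) = 1 + fps_const a * fps_X"
proof (rule newton_fps_unique[symmetric])
  show "fps_deriv (1 + fps_const a * fps_X) = power_sum_fps ((^) a) * (1 + fps_const a * fps_X)"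
  proof (rule fps_ext)
    fix n
    have "fps_nth (power_sum_fps ((^) a) * (1 + fps_const a * fps_X)) n
      = fps_nth (power_sum_fps ((^) a)) n + a * fps_nth (fps_X * power_sum_fps ((^) a)) n"
      by (simp add: algebra_simps)
    then show "fps_nth (fps_deriv (1 + fps_const a * fps_X)) n
      = fps_nth (power_sum_fps ((^) a) * (1 + fps_const a * fps_X)) n"
      by (cases n) (simp_all add: power_sum_fps_def)
  qed
qed simp

lemma newton_fps_sum_list: "newton_fps (\<lambda>k. \<Sum>a\<leftarrow>as. a ^ k) = (\<Prod>a\<leftarrow>as. 1 + fps_const a * fps_X)"
  by (induction as) (simp_all add: newton_fps_zero newton_fps_add newton_fps_power)

text \<open>Both sides are the product of 1 + a t over the eigenvalues a of A.\<close>

lemma newton_fps_mat_trace: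
  assumes "A \<in> carrier_mat d d"
  shows "newton_fps (\<lambda>k. mat_trace (A ^\<^sub>m k)) = exterior_fps A"
proof (rule exterior_fps_mat_trace_pow_eigenvalues[OF assms])
  fix as
  assume tr: "\<And>k. mat_trace (A ^\<^sub>m k) = (\<Sum>a\<leftarrow>as. a ^ k)"
    and ext: "exterior_fps A = (\<Prod>a\<leftarrow>as. 1 + fps_const a * fps_X)"
  show ?thesis unfolding tr ext by (rule newton_fps_sum_list)
qed

section \<open>Associated graded rings\<close>

lemma cring_poly3_ring: "cring poly3_ring"
proof (intro cringI abelian_groupI comm_monoidI)
  fix x :: poly3 assume "x \<in> carrier poly3_ring"
  show "\<exists>y\<in>carrier poly3_ring. y \<oplus>\<^bsub>poly3_ring\<^esub> x = \<zero>\<^bsub>poly3_ring\<^esub>"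
    by (rule bexI[of _ "- x"]) (simp_all add: poly3_ring_def)
qed (simp_all add: poly3_ring_def algebra_simps)

lemma poly3_ring_simps [simp]:
  "carrier poly3_ring = UNIV" "x \<oplus>\<^bsub>poly3_ring\<^esub> y = x + y" "x \<otimes>\<^bsub>poly3_ring\<^esub> y = x * y"
  "\<zero>\<^bsub>poly3_ring\<^esub> = 0" "\<one>\<^bsub>poly3_ring\<^esub> = 1"
  by (simp_all add: poly3_ring_def)

section \<open>Grading of the polynomial ring by weighted degree\<close>

lemma UNIV_indet: "UNIV = {V1, V2, V3}"
  by (auto intro: indet.exhaust)

lemma monomial_degree_eq:
  "monomial_degree m = Poly_Mapping.lookup m V1 + Poly_Mapping.lookup m V2 + 2 * Poly_Mapping.lookup m V3"
proof -
  have sub: "Poly_Mapping.keys m \<subseteq> {V1, V2, V3}" using UNIV_indet by blast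
  have "monomial_degree m = (\<Sum>v\<in>{V1, V2, V3}. Poly_Mapping.lookup m v * indet_degree v)"
    unfolding monomial_degree_def
    by (rule sum.mono_neutral_left[OF _ sub]) (auto simp: in_keys_iff)
  then show ?thesis by simp
qed

lemma monomial_degree_add: "monomial_degree (m + n) = monomial_degree m + monomial_degree n"
  by (simp add: monomial_degree_eq lookup_add)

definition homogeneous :: "nat \<Rightarrow> poly3 \<Rightarrow> bool" where
  "homogeneous n p \<longleftrightarrow> (\<forall>m\<in>Poly_Mapping.keys p. monomial_degree m = n)"

definition homogeneous_part :: "nat \<Rightarrow> poly3 \<Rightarrow> poly3" where
  "homogeneous_part n p = Poly_Mapping.mapp (\<lambda>m c. c when monomial_degree m = n) p"

lemma lookup_homogeneous_part:
  "Poly_Mapping.lookup (homogeneous_part n p) m = (Poly_Mapping.lookup p m when monomial_degree m = n)"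
  by (simp add: homogeneous_part_def lookup_mapp when_def in_keys_iff)

lemma homogeneous_part_homogeneous: "homogeneous n (homogeneous_part n p)"
  by (auto simp: homogeneous_def in_keys_iff lookup_homogeneous_part when_def split: if_splits)

lemma homogeneous_part_same:
  assumes "homogeneous n p"
  shows "homogeneous_part k p = (if k = n then p else 0)"
  using assms
  by (intro poly_mapping_eqI) (auto simp: homogeneous_def lookup_homogeneous_part when_def in_keys_iff)

lemma homogeneous_part_add: "homogeneous_part n (p + q) = homogeneous_part n p + homogeneous_part n q"
  by (intro poly_mapping_eqI) (simp add: lookup_homogeneous_part lookup_add when_def)

lemma homogeneous_part_0 [simp]: "homogeneous_part n 0 = 0"
  by (intro poly_mapping_eqI) (simp add: lookup_homogeneous_part)

lemma homogeneous_part_sum: "homogeneous_part n (sum f A) = (\<Sum>a\<in>A. homogeneous_part n (f a))"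
  by (induction A rule: infinite_finite_induct) (simp_all add: homogeneous_part_add)

lemma homogeneous_0 [simp]: "homogeneous n 0"
  by (simp add: homogeneous_def)

lemma homogeneous_1: "homogeneous 0 1"
  by (simp add: homogeneous_def monomial_degree_eq)

lemma homogeneous_add: "homogeneous n p \<Longrightarrow> homogeneous n q \<Longrightarrow> homogeneous n (p + q)"
  using keys_add[of p q] by (auto simp: homogeneous_def)

lemma homogeneous_uminus: "homogeneous n p \<Longrightarrow> homogeneous n (- p)"
  by (simp add: homogeneous_def)

lemma homogeneous_diff: "homogeneous n p \<Longrightarrow> homogeneous n q \<Longrightarrow> homogeneous n (p - q)"
  using homogeneous_add[of n p "- q"] homogeneous_uminus by simp

lemma homogeneous_mult: "homogeneous k p \<Longrightarrow> homogeneous l q \<Longrightarrow> homogeneous (k + l) (p * q)"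
  using keys_mult[of p q] by (fastforce simp: homogeneous_def monomial_degree_add)

lemma homogeneous_of_int: "homogeneous 0 (of_int c)"
  by (simp add: homogeneous_def monomial_degree_eq single_of_int[symmetric] del: single_of_int)

lemma homogeneous_power: "homogeneous k p \<Longrightarrow> homogeneous (k * n) (p ^ n)"
  by (induction n) (auto simp: homogeneous_1 dest: homogeneous_mult)

lemma homogeneous_var: "homogeneous (indet_degree v) (var v)"
  by (cases v) (simp_all add: homogeneous_def var_def monomial_degree_eq lookup_single)

lemma homogeneous_part_bound:
  obtains N where "\<And>n. N \<le> n \<Longrightarrow> homogeneous_part n p = 0"
proof
  let ?N = "Suc (Max (insert 0 (monomial_degree ` Poly_Mapping.keys p)))"
  fix n assume n: "?N \<le> n"
  show "homogeneous_part n p = 0"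
  proof (rule poly_mapping_eqI)
    fix m
    have "monomial_degree m < n" if "m \<in> Poly_Mapping.keys p"
      using n that by (intro less_le_trans[OF _ n] le_imp_less_Suc Max_ge) auto
    then show "Poly_Mapping.lookup (homogeneous_part n p) m = Poly_Mapping.lookup 0 m"
      by (auto simp: lookup_homogeneous_part when_def in_keys_iff)
  qed
qed

lemma sum_homogeneous_part:
  assumes "\<And>n. N \<le> n \<Longrightarrow> homogeneous_part n p = 0"
  shows "(\<Sum>n<N. homogeneous_part n p) = p"
proof (rule poly_mapping_eqI)
  fix m
  have "Poly_Mapping.lookup p m = 0" if "N \<le> monomial_degree m"
    using arg_cong[OF assms[OF that], of "\<lambda>q. Poly_Mapping.lookup q m"]
    by (simp add: lookup_homogeneous_part)
  then show "Poly_Mapping.lookup (\<Sum>n<N. homogeneous_part n p) m = Poly_Mapping.lookup p m"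
    by (auto simp: lookup_sum lookup_homogeneous_part when_def sum.delta)
qed

lemma homogeneous_part_mult:
  "homogeneous_part n (p * q) = (\<Sum>i\<le>n. homogeneous_part i p * homogeneous_part (n - i) q)"
proof -
  obtain N M where N: "\<And>n. N \<le> n \<Longrightarrow> homogeneous_part n p = 0"
    and M: "\<And>n. M \<le> n \<Longrightarrow> homogeneous_part n q = 0"
    using homogeneous_part_bound[of p] homogeneous_part_bound[of q] by metis
  \<comment> \<open>Both factors are truncated at a common bound above their degrees; the summand
    \<open>Suc n\<close> keeps every complementary index n - i below it.\<close>
  define K where "K = N + M + Suc n"
  have p: "p = (\<Sum>i<K. homogeneous_part i p)" and q: "q = (\<Sum>j<K. homogeneous_part j q)"
    by (rule sum_homogeneous_part[symmetric]; use N M K_def in simp)+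
  have "homogeneous_part n (p * q)
      = homogeneous_part n ((\<Sum>i<K. homogeneous_part i p) * (\<Sum>j<K. homogeneous_part j q))"
    using p q by simp
  also have "\<dots> = (\<Sum>i<K. \<Sum>j<K. homogeneous_part n (homogeneous_part i p * homogeneous_part j q))"
    by (simp add: sum_product homogeneous_part_sum)
  also have "\<dots> = (\<Sum>i<K. \<Sum>j<K. if n = i + j then homogeneous_part i p * homogeneous_part j q else 0)"
    by (intro sum.cong refl homogeneous_part_same homogeneous_mult homogeneous_part_homogeneous)
  also have "\<dots> = (\<Sum>i<K. if i \<le> n then homogeneous_part i p * homogeneous_part (n - i) q else 0)"
  proof (rule sum.cong[OF refl])
    fix i
    have "(\<Sum>j<K. if n = i + j then homogeneous_part i p * homogeneous_part j q else 0)
        = (\<Sum>j<K. if j = n - i \<and> i \<le> n then homogeneous_part i p * homogeneous_part j q else 0)"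
      by (rule sum.cong[OF refl]) auto
    also have "\<dots> = (if i \<le> n then homogeneous_part i p * homogeneous_part (n - i) q else 0)"
    proof -
      have "n - i < K" by (simp add: K_def)
      then show ?thesis by (cases "i \<le> n") (simp_all add: sum.delta)
    qed
    finally show "(\<Sum>j<K. if n = i + j then homogeneous_part i p * homogeneous_part j q else 0)
        = (if i \<le> n then homogeneous_part i p * homogeneous_part (n - i) q else 0)" .
  qed
  also have "\<dots> = (\<Sum>i\<le>n. homogeneous_part i p * homogeneous_part (n - i) q)"
    by (rule sum.mono_neutral_cong_right) (auto simp: K_def)
  finally show ?thesis .
qed

section \<open>Filtered rings and presentations of their graded rings\<close>

locale filtered_ring = cring R for R (structure) +
  fixes F :: "nat \<Rightarrow> 'a set"
  assumes F_subgroup: "additive_subgroup (F n) R"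
    and F_mult: "a \<in> F m \<Longrightarrow> b \<in> F n \<Longrightarrow> a \<otimes> b \<in> F (m + n)"
    and F_Suc: "F (Suc n) \<subseteq> F n"
    and one_in_F: "\<one> \<in> F 0"
begin

lemma F_carrier: "a \<in> F n \<Longrightarrow> a \<in> carrier R"
  using additive_subgroup.a_subset[OF F_subgroup] by blast

lemma F_abelian_subgroup: "abelian_subgroup (F n) R"
  by (rule abelian_subgroupI3[OF F_subgroup]) (rule is_abelian_group)

lemmas F_add = additive_subgroup.a_closed[OF F_subgroup]
lemmas F_zero = additive_subgroup.zero_closed[OF F_subgroup]
lemmas F_neg = additive_subgroup.a_inv_closed[OF F_subgroup]

lemma coset_eq_iff:
  assumes "a \<in> carrier R" "b \<in> carrier R"
  shows "F n +> a = F n +> b \<longleftrightarrow> a \<ominus> b \<in> F n"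
proof
  interpret abelian_subgroup "F n" R by (rule F_abelian_subgroup)
  assume "F n +> a = F n +> b"
  then have "a \<in> F n +> b" using a_rcos_self[OF assms(1)] by simp
  then show "a \<ominus> b \<in> F n" using a_rcos_module[OF assms(2,1)] by (simp add: a_minus_def)
next
  interpret abelian_subgroup "F n" R by (rule F_abelian_subgroup)
  assume "a \<ominus> b \<in> F n"
  then have "a \<in> F n +> b" using a_rcos_module[OF assms(2,1)] by (simp add: a_minus_def)
  then show "F n +> a = F n +> b" using a_repr_independence'[OF _ assms(2)] by simp
qed

lemma coset_eq_F_iff: "a \<in> carrier R \<Longrightarrow> F n +> a = F n \<longleftrightarrow> a \<in> F n"
  using coset_eq_iff[of a \<zero> n] a_coset_add_zero[OF additive_subgroup.a_subset[OF F_subgroup], of n]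
  by (simp add: a_minus_def)

definition gr :: "nat \<Rightarrow> 'a set monoid" where
  "gr n = R\<lparr>carrier := F n\<rparr> A_Mod F (Suc n)"

lemma gr_carrier: "carrier (gr n) = {F (Suc n) +> a | a. a \<in> F n}"
  by (auto simp: gr_def A_FactGroup_def FactGroup_def RCOSETS_def a_r_coset_def r_coset_def)

lemma gr_one: "\<one>\<^bsub>gr n\<^esub> = F (Suc n)"
  by (simp add: gr_def A_FactGroup_def FactGroup_def)

lemma gr_mult:
  assumes "a \<in> F n" "b \<in> F n"
  shows "(F (Suc n) +> a) \<otimes>\<^bsub>gr n\<^esub> (F (Suc n) +> b) = F (Suc n) +> (a \<oplus> b)"
proof -
  interpret abelian_subgroup "F (Suc n)" R by (rule F_abelian_subgroup)
  have "(F (Suc n) +> a) \<otimes>\<^bsub>gr n\<^esub> (F (Suc n) +> b) = (F (Suc n) +> a) <+> (F (Suc n) +> b)"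
    by (simp add: gr_def A_FactGroup_def FactGroup_def set_add_def set_mult_def)
  then show ?thesis using a_rcos_sum F_carrier assms by simp
qed

lemma gr_comm_monoid: "comm_monoid (gr n)"
proof (rule comm_monoidI)
  have one: "\<one>\<^bsub>gr n\<^esub> = F (Suc n) +> \<zero>"
    using coset_eq_F_iff[of \<zero> "Suc n"] F_zero by (simp add: gr_one)
  show "\<one>\<^bsub>gr n\<^esub> \<in> carrier (gr n)"
    unfolding one gr_carrier using F_zero by blast
  fix x assume "x \<in> carrier (gr n)"
  then obtain a where a: "x = F (Suc n) +> a" "a \<in> F n" unfolding gr_carrier by blast
  show "\<one>\<^bsub>gr n\<^esub> \<otimes>\<^bsub>gr n\<^esub> x = x"
    unfolding one a(1) using a(2) F_zero F_carrier by (simp add: gr_mult)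
  fix y assume "y \<in> carrier (gr n)"
  then obtain b where b: "y = F (Suc n) +> b" "b \<in> F n" unfolding gr_carrier by blast
  show "x \<otimes>\<^bsub>gr n\<^esub> y \<in> carrier (gr n)"
    unfolding a(1) b(1) gr_mult[OF a(2) b(2)] gr_carrier using a b F_add by blast
  show "x \<otimes>\<^bsub>gr n\<^esub> y = y \<otimes>\<^bsub>gr n\<^esub> x"
    unfolding a(1) b(1) using a b F_carrier by (simp add: gr_mult a_comm)
  fix z assume "z \<in> carrier (gr n)"
  then obtain c where c: "z = F (Suc n) +> c" "c \<in> F n" unfolding gr_carrier by blast
  show "x \<otimes>\<^bsub>gr n\<^esub> y \<otimes>\<^bsub>gr n\<^esub> z = x \<otimes>\<^bsub>gr n\<^esub> (y \<otimes>\<^bsub>gr n\<^esub> z)"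
    unfolding a(1) b(1) c(1) using a b c F_carrier F_add by (simp add: gr_mult a_assoc)
qed

lemma finsum_in_F: "finite A \<Longrightarrow> (\<And>i. i \<in> A \<Longrightarrow> c i \<in> F n) \<Longrightarrow> (\<Oplus>i\<in>A. c i) \<in> F n"
proof (induction A rule: finite_induct)
  case (insert x A)
  then have "(\<Oplus>i\<in>insert x A. c i) = c x \<oplus> (\<Oplus>i\<in>A. c i)"
    using F_carrier by (intro finsum_insert) auto
  then show ?case using insert F_add by simp
qed (simp add: F_zero)

lemma gr_finprod:
  assumes "finite A" "\<And>i. i \<in> A \<Longrightarrow> c i \<in> F n"
  shows "(\<Otimes>\<^bsub>gr n\<^esub>i\<in>A. F (Suc n) +> c i) = F (Suc n) +> (\<Oplus>i\<in>A. c i)"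
  using assms
proof (induction A rule: finite_induct)
  case empty
  then show ?case
    using coset_eq_F_iff[of \<zero> "Suc n"] F_zero
    by (simp add: comm_monoid.finprod_empty[OF gr_comm_monoid] gr_one)
next
  case (insert x A)
  have "(\<Otimes>\<^bsub>gr n\<^esub>i\<in>insert x A. F (Suc n) +> c i)
      = (F (Suc n) +> c x) \<otimes>\<^bsub>gr n\<^esub> (\<Otimes>\<^bsub>gr n\<^esub>i\<in>A. F (Suc n) +> c i)"
    using insert by (intro comm_monoid.finprod_insert[OF gr_comm_monoid]) (auto simp: gr_carrier)
  also have "\<dots> = (F (Suc n) +> c x) \<otimes>\<^bsub>gr n\<^esub> (F (Suc n) +> (\<Oplus>i\<in>A. c i))"
    using insert by simp
  also have "\<dots> = F (Suc n) +> (c x \<oplus> (\<Oplus>i\<in>A. c i))"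
    using insert by (intro gr_mult finsum_in_F) auto
  also have "c x \<oplus> (\<Oplus>i\<in>A. c i) = (\<Oplus>i\<in>insert x A. c i)"
    using insert F_carrier by (intro finsum_insert[symmetric]) auto
  finally show ?case .
qed

text \<open>For x = h + a and y = k + b, the difference x y - a b = h (k + b) + a k lies one
  filtration step further down, so all products of representatives give the same coset. As
  \<open>rcoset_mult\<close> is a union over pairs of representatives, the existence of a pair
  matters too.\<close>

lemma rcoset_mult_coset:
  assumes "a \<in> F i" "b \<in> F j"
  shows "rcoset_mult R (F (Suc (i + j))) (F (Suc i) +> a) (F (Suc j) +> b) = F (Suc (i + j)) +> (a \<otimes> b)"
proof -
  have "F (Suc (i + j)) +> (x \<otimes> y) = F (Suc (i + j)) +> (a \<otimes> b)"
    if xy: "x \<in> F (Suc i) +> a" "y \<in> F (Suc j) +> b" for x y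
  proof -
    obtain h k where h: "h \<in> F (Suc i)" "x = h \<oplus> a" and k: "k \<in> F (Suc j)" "y = k \<oplus> b"
      using xy by (auto simp: a_r_coset_def')
    note c = F_carrier[OF h(1)] F_carrier[OF k(1)] F_carrier[OF assms(1)] F_carrier[OF assms(2)]
    have "x \<otimes> y \<ominus> a \<otimes> b = h \<otimes> (k \<oplus> b) \<oplus> a \<otimes> k"
      unfolding h k using c by algebra
    moreover have "h \<otimes> (k \<oplus> b) \<in> F (Suc i + j)"
      using h k assms F_Suc by (intro F_mult F_add) auto
    moreover have "a \<otimes> k \<in> F (i + Suc j)"
      using k assms by (intro F_mult)
    ultimately have "x \<otimes> y \<ominus> a \<otimes> b \<in> F (Suc (i + j))" using F_add by simp
    then show ?thesis
      using c h k by (subst coset_eq_iff) auto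
  qed
  moreover have "a \<in> F (Suc i) +> a" "b \<in> F (Suc j) +> b"
    using abelian_subgroup.a_rcos_self[OF F_abelian_subgroup] assms F_carrier by auto
  ultimately show ?thesis unfolding rcoset_mult_def by blast
qed

text \<open>A choice of representatives turns the coset arithmetic of \<open>assoc_graded\<close>
  into arithmetic of sequences in R.\<close>

definition coset_family :: "(nat \<Rightarrow> 'a) \<Rightarrow> nat \<Rightarrow> 'a set" where
  "coset_family a n = F (Suc n) +> a n"

lemma assoc_graded_simps:
  "carrier (assoc_graded R F) = {f. (\<forall>n. f n \<in> carrier (gr n)) \<and> finite {n. f n \<noteq> F (Suc n)}}"
  "\<zero>\<^bsub>assoc_graded R F\<^esub> = (\<lambda>n. F (Suc n))"
  "\<one>\<^bsub>assoc_graded R F\<^esub> = (\<lambda>n. if n = 0 then F (Suc 0) +> \<one> else F (Suc n))"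
  "f \<oplus>\<^bsub>assoc_graded R F\<^esub> g = (\<lambda>n. f n \<otimes>\<^bsub>gr n\<^esub> g n)"
  "f \<otimes>\<^bsub>assoc_graded R F\<^esub> g
     = (\<lambda>n. \<Otimes>\<^bsub>gr n\<^esub>i\<in>{..n}. rcoset_mult R (F (Suc n)) (f i) (g (n - i)))"
  by (simp_all add: assoc_graded_def Let_def gr_one gr_def[symmetric] fun_eq_iff)

lemma coset_family_carrier:
  assumes "\<And>n. a n \<in> F n" "finite {n. a n \<noteq> \<zero>}"
  shows "coset_family a \<in> carrier (assoc_graded R F)"
proof -
  have "{n. coset_family a n \<noteq> F (Suc n)} \<subseteq> {n. a n \<noteq> \<zero>}"
    using coset_eq_F_iff[of \<zero>] F_zero by (auto simp: coset_family_def)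
  then have "finite {n. coset_family a n \<noteq> F (Suc n)}" by (rule finite_subset[OF _ assms(2)])
  then show ?thesis using assms(1) by (auto simp: assoc_graded_simps gr_carrier coset_family_def)
qed

lemma coset_family_add:
  assumes "\<And>n. a n \<in> F n" "\<And>n. b n \<in> F n"
  shows "coset_family a \<oplus>\<^bsub>assoc_graded R F\<^esub> coset_family b = coset_family (\<lambda>n. a n \<oplus> b n)"
  by (simp add: assoc_graded_simps coset_family_def gr_mult assms fun_eq_iff)

lemma coset_family_mult:
  assumes "\<And>n. a n \<in> F n" "\<And>n. b n \<in> F n"
  shows "coset_family a \<otimes>\<^bsub>assoc_graded R F\<^esub> coset_family b
    = coset_family (\<lambda>n. \<Oplus>i\<in>{..n}. a i \<otimes> b (n - i))"
proof
  fix n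
  have ab: "a i \<otimes> b (n - i) \<in> F n" if "i \<le> n" for i
    using F_mult[OF assms(1) assms(2), of i "n - i"] that by simp
  have "(coset_family a \<otimes>\<^bsub>assoc_graded R F\<^esub> coset_family b) n
      = (\<Otimes>\<^bsub>gr n\<^esub>i\<in>{..n}. rcoset_mult R (F (Suc n)) (coset_family a i) (coset_family b (n - i)))"
    by (simp add: assoc_graded_simps)
  also have "\<dots> = (\<Otimes>\<^bsub>gr n\<^esub>i\<in>{..n}. F (Suc n) +> (a i \<otimes> b (n - i)))"
  proof (rule comm_monoid.finprod_cong'[OF gr_comm_monoid refl])
    show "(\<lambda>i. F (Suc n) +> a i \<otimes> b (n - i)) \<in> {..n} \<rightarrow> carrier (gr n)"
      using ab by (auto simp: gr_carrier)
    fix i assume "i \<in> {..n}"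
    then show "rcoset_mult R (F (Suc n)) (coset_family a i) (coset_family b (n - i))
        = F (Suc n) +> a i \<otimes> b (n - i)"
      using rcoset_mult_coset[OF assms(1)[of i] assms(2)[of "n - i"]] by (simp add: coset_family_def)
  qed
  also have "\<dots> = F (Suc n) +> (\<Oplus>i\<in>{..n}. a i \<otimes> b (n - i))"
    using ab by (intro gr_finprod) auto
  finally show "(coset_family a \<otimes>\<^bsub>assoc_graded R F\<^esub> coset_family b) n
    = coset_family (\<lambda>n. \<Oplus>i\<in>{..n}. a i \<otimes> b (n - i)) n"
    by (simp add: coset_family_def)
qed

text \<open>Sending p to the classes of \<open>ev\<close> of its homogeneous parts is onto by
  \<open>surj\<close>, and S lies in the kernel by \<open>rel\<close>. For the reverse inclusion,
  \<open>ker\<close> allows one to look at a convenient representative q modulo the ideal, degree by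
  degree: it must lie in the ideal as soon as its value drops into the next filtration step.\<close>

theorem graded_presentation:
  fixes ev :: "poly3 \<Rightarrow> 'a"
  assumes ev: "ev \<in> Ring.ring_hom poly3_ring R"
    and ev_F: "\<And>n p. homogeneous n p \<Longrightarrow> ev p \<in> F n"
    and surj: "\<And>n a. a \<in> F n \<Longrightarrow> \<exists>p. homogeneous n p \<and> ev p \<ominus> a \<in> F (Suc n)"
    and rel: "\<And>s. s \<in> S \<Longrightarrow> \<exists>n. homogeneous n s \<and> ev s \<in> F (Suc n)"
    and ker: "\<And>n p. homogeneous n p \<Longrightarrow> \<exists>q. homogeneous n q \<and> p - q \<in> genideal poly3_ring S \<and>
      (ev q \<in> F (Suc n) \<longrightarrow> q \<in> genideal poly3_ring S)"
  shows "graded_ring_isomorphic (assoc_graded R F) (assoc_graded_component R F)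
    (presented_ring S) (presented_component S)"
proof -
  interpret P: cring poly3_ring by (rule cring_poly3_ring)
  let ?A = "assoc_graded R F"
  interpret ev: ring_hom_ring poly3_ring R ev
    by (rule ring_hom_ringI2[OF P.ring_axioms ring_axioms ev])
  have ev_0: "ev 0 = \<zero>" using ev.hom_zero by simp
  have ev_1: "ev 1 = \<one>" using ev.hom_one by simp
  have ev_add: "ev (p + q) = ev p \<oplus> ev q" for p q using ev.hom_add[of p q] by simp
  have ev_mult: "ev (p * q) = ev p \<otimes> ev q" for p q using ev.hom_mult[of p q] by simp
  have ev_carrier: "ev p \<in> carrier R" for p using ev.hom_closed[of p] by simp
  have ev_sum: "ev (\<Sum>i\<in>A. f i) = (\<Oplus>i\<in>A. ev (f i))" if "finite A" for A and f :: "nat \<Rightarrow> poly3"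
    using that by (induction A) (simp_all add: ev_0 ev_add ev_carrier Pi_def)
  define \<phi> where "\<phi> = (\<lambda>p. coset_family (\<lambda>n. ev (homogeneous_part n p)))"
  have part_F: "ev (homogeneous_part n p) \<in> F n" for n p
    by (rule ev_F[OF homogeneous_part_homogeneous])
  have part_fin: "finite {n. ev (homogeneous_part n p) \<noteq> \<zero>}" for p
  proof -
    obtain N where "\<And>n. N \<le> n \<Longrightarrow> homogeneous_part n p = 0"
      using homogeneous_part_bound by metis
    then have "{n. ev (homogeneous_part n p) \<noteq> \<zero>} \<subseteq> {..<N}"
      using ev_0 by (auto simp: not_le[symmetric])
    then show ?thesis by (rule finite_subset) simp
  qed
  have \<phi>_carrier: "\<phi> p \<in> carrier ?A" for p
    unfolding \<phi>_def by (rule coset_family_carrier[OF part_F part_fin])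
  have \<phi>_homogeneous: "\<phi> p m = (if m = n then F (Suc n) +> ev p else F (Suc m))" if "homogeneous n p" for n p m
    using that coset_eq_F_iff[of \<zero>] F_zero ev_0
    by (simp add: \<phi>_def coset_family_def homogeneous_part_same)
  have \<phi>_0: "\<phi> 0 = \<zero>\<^bsub>?A\<^esub>"
    using \<phi>_homogeneous[of 0 0] coset_eq_F_iff[of \<zero>] F_zero ev_0
    by (simp add: assoc_graded_simps fun_eq_iff)
  have \<phi>_1: "\<phi> 1 = \<one>\<^bsub>?A\<^esub>"
    using \<phi>_homogeneous[OF homogeneous_1] by (simp add: assoc_graded_simps ev_1 fun_eq_iff)
  have \<phi>_add: "\<phi> (p + q) = \<phi> p \<oplus>\<^bsub>?A\<^esub> \<phi> q" for p q
    unfolding \<phi>_def by (simp add: coset_family_add part_F homogeneous_part_add ev_add)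
  have \<phi>_mult: "\<phi> (p * q) = \<phi> p \<otimes>\<^bsub>?A\<^esub> \<phi> q" for p q
    unfolding \<phi>_def by (simp add: coset_family_mult part_F homogeneous_part_mult ev_sum ev_mult)
  have \<phi>_hom: "\<phi> \<in> Ring.ring_hom poly3_ring ?A"
    by (rule ring_hom_memI) (simp_all add: \<phi>_carrier \<phi>_add \<phi>_mult \<phi>_1)
  have \<phi>_sum: "\<phi> (\<Sum>i\<in>A. q i) n = F (Suc n) +> ev (q n)"
    if A: "finite A" "n \<in> A" and q: "\<And>i. homogeneous i (q i)" for A q n
  proof -
    have "homogeneous_part n (\<Sum>i\<in>A. q i) = (\<Sum>i\<in>A. if n = i then q i else 0)"
      unfolding homogeneous_part_sum by (rule sum.cong[OF refl homogeneous_part_same[OF q]])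
    then show ?thesis using A by (simp add: \<phi>_def coset_family_def sum.delta)
  qed
  have \<phi>_sum_notin: "\<phi> (\<Sum>i\<in>A. q i) n = F (Suc n)"
    if A: "finite A" "n \<notin> A" and q: "\<And>i. homogeneous i (q i)" for A q n
  proof -
    have "homogeneous_part n (\<Sum>i\<in>A. q i) = (\<Sum>i\<in>A. if n = i then q i else 0)"
      unfolding homogeneous_part_sum by (rule sum.cong[OF refl homogeneous_part_same[OF q]])
    then show ?thesis using A ev_0 coset_eq_F_iff[of \<zero>] F_zero by (simp add: \<phi>_def coset_family_def sum.delta)
  qed
  have lift: "\<exists>p. homogeneous n p \<and> f n = F (Suc n) +> ev p" if f: "f \<in> carrier ?A" for f n
  proof -
    obtain a where a: "a \<in> F n" "f n = F (Suc n) +> a"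
      using f by (fastforce simp: assoc_graded_simps gr_carrier)
    obtain p where "homogeneous n p" "ev p \<ominus> a \<in> F (Suc n)" using surj[OF a(1)] by blast
    moreover from this have "F (Suc n) +> ev p = F (Suc n) +> a"
      using coset_eq_iff[OF ev_carrier F_carrier[OF a(1)]] by simp
    ultimately show ?thesis using a(2) by metis
  qed
  have \<phi>_surj: "\<phi> ` carrier poly3_ring = carrier ?A"
  proof (intro equalityI subsetI)
    fix f assume f: "f \<in> carrier ?A"
    obtain q where q: "\<And>n. homogeneous n (q n)" "\<And>n. f n = F (Suc n) +> ev (q n)"
      using lift[OF f] by metis
    let ?N = "{n. f n \<noteq> F (Suc n)}"
    have fin: "finite ?N" using f by (simp add: assoc_graded_simps)
    have "\<phi> (\<Sum>n\<in>?N. q n) n = f n" for n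
    proof (cases "n \<in> ?N")
      case True
      show ?thesis by (rule trans[OF \<phi>_sum[OF fin True q(1)] q(2)[symmetric]])
    next
      case False
      have "F (Suc n) = f n" using False by simp
      then show ?thesis by (rule trans[OF \<phi>_sum_notin[OF fin False q(1)]])
    qed
    then have "\<phi> (\<Sum>n\<in>?N. q n) = f" by (rule ext)
    then show "f \<in> \<phi> ` carrier poly3_ring" using image_eqI[of f \<phi>] by (metis UNIV_I poly3_ring_simps(1))
  qed (use \<phi>_carrier in auto)
  \<comment> \<open>The ring axioms of the graded ring are inherited: it is the image of a ring
    under a map respecting sums, products and one.\<close>
  have "ring (?A\<lparr>carrier := \<phi> ` carrier poly3_ring, zero := \<phi> \<zero>\<^bsub>poly3_ring\<^esub>\<rparr>)"
    by (rule P.ring_hom_imp_img_ring[OF \<phi>_hom])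
  then have A_ring: "ring ?A" by (simp only: \<phi>_surj) (simp add: \<phi>_0)
  interpret \<phi>: ring_hom_ring poly3_ring ?A \<phi>
    by (rule ring_hom_ringI2[OF P.ring_axioms A_ring \<phi>_hom])
  let ?J = "genideal poly3_ring S"
  have J: "ideal ?J poly3_ring" by (rule P.genideal_ideal) simp
  have J_sum: "(\<Sum>i\<in>A. q i) \<in> ?J" if "finite A" "\<And>i. i \<in> A \<Longrightarrow> q i \<in> ?J" for A and q :: "nat \<Rightarrow> poly3"
    using that
    by (induction A)
      (use additive_subgroup.zero_closed[OF ideal.axioms(1)[OF J]]
           additive_subgroup.a_closed[OF ideal.axioms(1)[OF J]] in auto)
  have kernel_iff: "p \<in> a_kernel poly3_ring ?A \<phi> \<longleftrightarrow> \<phi> p = \<zero>\<^bsub>?A\<^esub>" for p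
    by (simp only: a_kernel_def' poly3_ring_simps mem_Collect_eq UNIV_I simp_thms)
  have J_kernel: "?J \<subseteq> a_kernel poly3_ring ?A \<phi>"
  proof (rule P.genideal_minimal[OF \<phi>.kernel_is_ideal], rule subsetI)
    fix s assume "s \<in> S"
    then obtain n where n: "homogeneous n s" "ev s \<in> F (Suc n)" using rel by blast
    then have "\<phi> s m = F (Suc m)" for m
      using \<phi>_homogeneous[OF n(1)] coset_eq_F_iff[OF ev_carrier] by auto
    then have "\<phi> s = \<zero>\<^bsub>?A\<^esub>" by (auto simp: assoc_graded_simps)
    then show "s \<in> a_kernel poly3_ring ?A \<phi>" by (simp only: kernel_iff)
  qed
  \<comment> \<open>As p - q is in the kernel, its value lies in the next step. Hence so does
    \<open>ev q\<close>, and \<open>ker\<close> puts q, and with it p, into the ideal.\<close>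
  have ker': "p \<in> ?J" if p: "homogeneous n p" "ev p \<in> F (Suc n)" for n p
  proof -
    obtain q where q: "homogeneous n q" "p - q \<in> ?J" "ev q \<in> F (Suc n) \<Longrightarrow> q \<in> ?J"
      using ker[OF p(1)] by blast
    have "\<phi> (p - q) = \<zero>\<^bsub>?A\<^esub>" using q(2) J_kernel kernel_iff by blast
    then have "F (Suc n) +> ev (p - q) = F (Suc n)"
      using \<phi>_homogeneous[OF homogeneous_diff[OF p(1) q(1)], of n] by (simp add: assoc_graded_simps)
    then have d: "ev (p - q) \<in> F (Suc n)" using coset_eq_F_iff[OF ev_carrier] by simp
    have "ev p = ev (p - q) \<oplus> ev q" using ev_add[of "p - q" q] by simp
    then have "ev q = ev p \<oplus> \<ominus> ev (p - q)"
      using ev_carrier[of q] ev_carrier[of "p - q"] by (simp add: a_ac r_neg r_neg1 minus_equality)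
    then have "ev q \<in> F (Suc n)" using F_add[OF p(2) F_neg[OF d]] by simp
    then show ?thesis
      using additive_subgroup.a_closed[OF ideal.axioms(1)[OF J] q(2) q(3)] by simp
  qed
  have kernel: "a_kernel poly3_ring ?A \<phi> = ?J"
  proof (rule equalityI[OF _ J_kernel])
    show "a_kernel poly3_ring ?A \<phi> \<subseteq> ?J"
    proof
      fix p assume "p \<in> a_kernel poly3_ring ?A \<phi>"
      then have "\<phi> p = \<zero>\<^bsub>?A\<^esub>" by (simp only: kernel_iff)
      then have "F (Suc n) +> ev (homogeneous_part n p) = F (Suc n)" for n
        by (simp add: \<phi>_def coset_family_def assoc_graded_simps fun_eq_iff)
      then have "homogeneous_part n p \<in> ?J" for n
        using coset_eq_F_iff[OF ev_carrier] ker'[OF homogeneous_part_homogeneous] by simp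
      moreover obtain N where "\<And>n. N \<le> n \<Longrightarrow> homogeneous_part n p = 0"
        using homogeneous_part_bound by metis
      ultimately show "p \<in> ?J"
        using J_sum[of "{..<N}" "\<lambda>n. homogeneous_part n p"] sum_homogeneous_part[of N p] by simp
    qed
  qed
  let ?g = "\<lambda>X. the_elem (\<phi> ` X)"
  let ?P = "presented_ring S"
  have g_iso: "?g \<in> ring_iso ?P ?A"
    using \<phi>.FactRing_iso_set[OF \<phi>_surj] unfolding kernel presented_ring_def .
  have g_coset: "?g (?J +>\<^bsub>poly3_ring\<^esub> p) = \<phi> p" for p
    using \<phi>.the_elem_simp[of p] unfolding kernel by simp
  have g_component: "?g ` presented_component S n = assoc_graded_component R F n" for n
  proof (intro equalityI subsetI)
    fix f assume "f \<in> ?g ` presented_component S n"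
    then obtain p where "homogeneous n p" "f = \<phi> p"
      by (auto simp: presented_component_def homogeneous_def g_coset)
    then show "f \<in> assoc_graded_component R F n"
      using \<phi>_carrier \<phi>_homogeneous by (simp add: assoc_graded_component_def)
  next
    fix f assume "f \<in> assoc_graded_component R F n"
    then have f: "f \<in> carrier ?A" "\<And>m. m \<noteq> n \<Longrightarrow> f m = F (Suc m)"
      by (auto simp: assoc_graded_component_def)
    obtain p where p: "homogeneous n p" "f n = F (Suc n) +> ev p" using lift[OF f(1)] by blast
    have "\<phi> p m = f m" for m using \<phi>_homogeneous[OF p(1)] p(2) f(2) by simp
    then have "f = ?g (?J +>\<^bsub>poly3_ring\<^esub> p)" by (auto simp: g_coset)
    then show "f \<in> ?g ` presented_component S n"
      using p(1) unfolding presented_component_def homogeneous_def by blast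
  qed
  have P_ring: "ring ?P"
    unfolding presented_ring_def by (rule ideal.quotient_is_ring[OF J])
  let ?h = "inv_into (carrier ?P) ?g"
  \<comment> \<open>The isomorphism theorem yields a map out of the presented ring, whereas the
    claim asks for one into it.\<close>
  have "?h \<in> ring_iso ?A ?P" by (rule ring_iso_set_sym[OF P_ring g_iso])
  moreover have "?h ` assoc_graded_component R F n = presented_component S n" for n
  proof -
    have "presented_component S n \<subseteq> carrier ?P"
      by (auto simp: presented_component_def presented_ring_def FactRing_def A_RCOSETS_def')
    moreover have "inj_on ?g (carrier ?P)"
      using g_iso by (simp add: ring_iso_def bij_betw_def)
    ultimately show ?thesis
      unfolding g_component[symmetric] by (rule inv_into_image_cancel[rotated])
  qed
  ultimately show ?thesis unfolding graded_ring_isomorphic_def by blast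
qed

end

section \<open>Representations of groups of order 8\<close>

text \<open>Invertibility of the matrices is automatic, the inverse of \<open>\<rho> g\<close> being
  \<open>\<rho> (inv g)\<close>.\<close>

lemma (in group) is_repI:
  assumes closed: "\<And>g. g \<in> carrier G \<Longrightarrow> \<rho> g \<in> carrier_mat d d"
    and mult: "\<And>g h. g \<in> carrier G \<Longrightarrow> h \<in> carrier G \<Longrightarrow> \<rho> (g \<otimes> h) = \<rho> g * \<rho> h"
    and one: "\<rho> \<one> = 1\<^sub>m d"
  shows "is_rep G d \<rho>"
  unfolding is_rep_def
proof (rule homI)
  fix g assume g: "g \<in> carrier G"
  then have "\<rho> g * \<rho> (inv g) = 1\<^sub>m d" "\<rho> (inv g) * \<rho> g = 1\<^sub>m d"
    using mult[of g "inv g"] mult[of "inv g" g] one by simp_all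
  then show "\<rho> g \<in> carrier (units_of (ring_mat TYPE(complex) d ()))"
    using closed g unfolding units_of_def Units_def ring_mat_def by auto
qed (simp add: units_of_def ring_mat_def mult)

lemma is_rep_carrier:
  assumes "is_rep G d \<rho>" "g \<in> carrier G"
  shows "\<rho> g \<in> carrier_mat d d"
proof -
  have "\<rho> g \<in> Units (ring_mat TYPE(complex) d ())"
    using assms unfolding is_rep_def hom_def units_of_def by auto
  then show ?thesis by (simp add: Units_def ring_mat_def)
qed

lemma is_rep_mult:
  assumes "is_rep G d \<rho>" "g \<in> carrier G" "h \<in> carrier G"
  shows "\<rho> (g \<otimes>\<^bsub>G\<^esub> h) = \<rho> g * \<rho> h"
  using hom_mult[of \<rho> G "units_of (ring_mat TYPE(complex) d ())" g h] assms
  by (simp add: is_rep_def units_of_def ring_mat_def)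

lemma (in group) is_rep_one:
  assumes "is_rep G d \<rho>"
  shows "\<rho> \<one> = 1\<^sub>m d"
proof -
  interpret M: ring "ring_mat TYPE(complex) d ()" by (rule ring_mat)
  have "\<rho> \<one> = \<one>\<^bsub>units_of (ring_mat TYPE(complex) d ())\<^esub>"
    using assms hom_one[OF _ is_group M.units_group] unfolding is_rep_def by blast
  then show ?thesis by (simp add: units_of_def ring_mat_def)
qed

lemma (in group) is_rep_pow:
  assumes "is_rep G d \<rho>" "g \<in> carrier G"
  shows "\<rho> (g [^] (k::nat)) = \<rho> g ^\<^sub>m k"
proof (induction k)
  case 0
  then show ?case using is_rep_one[OF assms(1)] is_rep_carrier[OF assms] by simp
next
  case (Suc k)
  then show ?case using is_rep_mult[OF assms(1)] assms(2) by simp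
qed

lemma character_eq:
  "g \<in> carrier G \<Longrightarrow> character G \<rho> g = mat_trace (\<rho> g)"
  by (simp add: character_def mat_trace_def)

text \<open>The Adams operations of x, g \<mapsto> x (g^k), take the place of the power sums of
  eigenvalues.\<close>

definition newton_lambda :: "('g, 'm) monoid_scheme \<Rightarrow> nat \<Rightarrow> ('g \<Rightarrow> complex) \<Rightarrow> 'g \<Rightarrow> complex" where
  "newton_lambda G n x =
    (\<lambda>g. if g \<in> carrier G then fps_nth (newton_fps (\<lambda>k. x (g [^]\<^bsub>G\<^esub> k))) n else 0)"

lemma (in group) newton_lambda_character:
  assumes \<rho>: "is_rep G d \<rho>"
  shows "newton_lambda G n (character G \<rho>) = character G (\<lambda>g. exterior_power_mat n (\<rho> g))"
proof
  fix g
  show "newton_lambda G n (character G \<rho>) g = character G (\<lambda>g. exterior_power_mat n (\<rho> g)) g"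
  proof (cases "g \<in> carrier G")
    case True
    have "(\<lambda>k. character G \<rho> (g [^] k)) = (\<lambda>k. mat_trace (\<rho> g ^\<^sub>m k))"
      using True is_rep_pow[OF \<rho> True] by (simp add: character_eq)
    then have "newton_fps (\<lambda>k. character G \<rho> (g [^] k)) = exterior_fps (\<rho> g)"
      using newton_fps_mat_trace[OF is_rep_carrier[OF \<rho> True]] by simp
    then show ?thesis
      using True by (simp add: newton_lambda_def exterior_fps_def character_eq)
  qed (simp add: newton_lambda_def character_def)
qed

lemma newton_lambda_add:
  "newton_lambda G n (\<lambda>g. x g + y g) = (\<lambda>g. \<Sum>i\<le>n. newton_lambda G i x g * newton_lambda G (n - i) y g)"
  by (auto simp: newton_lambda_def newton_fps_add fps_mult_nth atLeast0AtMost)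

lemma newton_lambda_0: "newton_lambda G 0 x = \<one>\<^bsub>fun_ring G\<^esub>"
  by (auto simp: newton_lambda_def fun_ring_def)

text \<open>The numbers of rows and columns are not known to agree in advance. Preimages of the unit
  vectors form a right inverse Q; then P annihilates Q P - 1, and injectivity makes Q a left inverse
  as well.\<close>

lemma mat_two_sided_inverse:
  fixes P :: "complex mat"
  assumes P: "P \<in> carrier_mat d k"
    and inj: "\<And>y. y \<in> carrier_vec k \<Longrightarrow> P *\<^sub>v y = 0\<^sub>v d \<Longrightarrow> y = 0\<^sub>v k"
    and surj: "\<And>x. x \<in> carrier_vec d \<Longrightarrow> \<exists>y\<in>carrier_vec k. P *\<^sub>v y = x"
  obtains Q where "Q \<in> carrier_mat k d" "P * Q = 1\<^sub>m d" "Q * P = 1\<^sub>m k"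
proof -
  obtain q where q: "\<And>j. q j \<in> carrier_vec k" "\<And>j. P *\<^sub>v q j = unit_vec d j"
    using surj[of "unit_vec d _"] by (metis unit_vec_carrier)
  define Q where "Q = mat_of_cols k (map q [0..<d])"
  have Q: "Q \<in> carrier_mat k d" unfolding Q_def by (rule carrier_matI) simp_all
  have colQ: "col Q j = q j" if "j < d" for j
    unfolding Q_def using that q(1) by (subst col_mat_of_cols) auto
  have PQ: "P * Q = 1\<^sub>m d"
  proof (rule mat_col_eqI)
    fix j assume "j < dim_col (1\<^sub>m d)"
    then have j: "j < d" by simp
    show "col (P * Q) j = col (1\<^sub>m d) j"
      unfolding col_mult2[OF P Q j] colQ[OF j] q(2) using j by simp
  qed (use P Q in auto)
  have "Q * P = 1\<^sub>m k"
  proof (rule mat_col_eqI)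
    fix j assume "j < dim_col (1\<^sub>m k)"
    then have j: "j < k" by simp
    let ?y = "col (Q * P) j - unit_vec k j"
    have c: "col (Q * P) j \<in> carrier_vec k" using P Q j by auto
    have "P *\<^sub>v col (Q * P) j = col (P * (Q * P)) j"
      using P Q j by (simp add: col_mult2[of P d k "Q * P" k])
    also have "P * (Q * P) = P"
      using P Q PQ by (simp add: assoc_mult_mat[of P d k Q d P k, symmetric])
    also have "col P j = P *\<^sub>v unit_vec k j" using P j by (intro eq_vecI) auto
    finally have "P *\<^sub>v ?y = 0\<^sub>v d"
      using P c by (simp add: mult_minus_distrib_mat_vec[of P d k])
    then have "?y = 0\<^sub>v k" by (rule inj[rotated]) (use c in auto)
    then have "(col (Q * P) j - unit_vec k j) $ i = 0" if "i < k" for i using that by simp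
    then have "col (Q * P) j = unit_vec k j" by (intro eq_vecI) (use c Q in auto)
    then show "col (Q * P) j = col (1\<^sub>m k) j" using j by simp
  qed (use P Q in auto)
  then show ?thesis using that Q PQ by blast
qed

lemma mat_trace_intertwiner:
  assumes "A \<in> carrier_mat d d" "B \<in> carrier_mat k k" "P \<in> carrier_mat d k" "Q \<in> carrier_mat k d"
    and "P * Q = 1\<^sub>m d" "Q * P = 1\<^sub>m k" "A * P = P * B"
  shows "mat_trace A = mat_trace B"
proof -
  have "mat_trace A = mat_trace (A * (P * Q))" using assms by simp
  also have "A * (P * Q) = (A * P) * Q"
    by (rule assoc_mult_mat[symmetric]) (use assms in auto)
  also have "mat_trace \<dots> = mat_trace (Q * (A * P))"
    by (rule mat_trace_mult_commute) (use assms in auto)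
  also have "Q * (A * P) = (Q * P) * B"
    unfolding assms(7) by (rule assoc_mult_mat[symmetric]) (use assms in auto)
  also have "\<dots> = B" using assms by simp
  finally show ?thesis .
qed

text \<open>The presentation shared by both groups: \<open>r\<^sup>4 = 1\<close>, \<open>r s = s r\<^sup>3\<close>, and \<open>s\<^sup>2\<close> is \<open>1\<close> if \<open>\<tau> = 1\<close>,
  \<open>r\<^sup>2\<close> if \<open>\<tau> = -1\<close>. The conjugacy classes are numbered by \<open>{1}\<close>, \<open>{r\<^sup>2}\<close>, \<open>{r, r\<^sup>3}\<close>,
  \<open>{s, r\<^sup>2 s}\<close>, \<open>{r s, r\<^sup>3 s}\<close>, and a class function is given by its values in this order.\<close>

definition class_index :: "nat \<Rightarrow> nat \<Rightarrow> nat" where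
  "class_index i e = (if e = 0 then (if i = 0 then 0 else if i = 2 then 1 else 2)
     else if even i then 3 else 4)"

text \<open>Collects the facts about either group on which the argument rests. \<open>repr\<close>
  provides a word and a class number for each element, \<open>cls_surj\<close> makes the five values
  of a class function independent, and D is written in a basis in which \<open>r\<close> is diagonal
  and \<open>s\<close> exchanges the two coordinate lines up to the sign \<tau>.\<close>

locale order8 = group G for G :: "('g, 'm) monoid_scheme" (structure) +
  fixes r s :: 'g and cls :: "'g \<Rightarrow> nat" and \<tau> :: int and D :: "'g \<Rightarrow> complex mat"
  assumes r_closed: "r \<in> carrier G" and s_closed: "s \<in> carrier G"
    and repr: "g \<in> carrier G \<Longrightarrow> \<exists>i<4. \<exists>e<2. g = r [^] i \<otimes> s [^] e \<and> cls g = class_index i e"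
    and cls_surj: "{0, 1, 2, 3, 4} \<subseteq> cls ` carrier G"
    and cls_one: "cls \<one> = 0"
    and r4: "r [^] (4::nat) = \<one>"
    and rs: "r \<otimes> s = s \<otimes> r [^] (3::nat)"
    and s2: "\<tau> = 1 \<and> s [^] (2::nat) = \<one> \<or> \<tau> = -1 \<and> s [^] (2::nat) = r [^] (2::nat)"
    and lin_rep: "\<zeta> \<in> {1, -1} \<Longrightarrow> \<eta> \<in> {1, -1} \<Longrightarrow>
      is_rep G 1 (\<lambda>g. mat 1 1 (\<lambda>_. complex_of_int ([1, 1, \<zeta>, \<eta>, \<zeta> * \<eta>] ! cls g)))"
    and D_rep: "is_rep G 2 D"
    and D_r: "D r = mat_of_rows_list 2 [[\<i>, 0], [0, -\<i>]]"
    and D_s: "D s = mat_of_rows_list 2 [[0, of_int \<tau>], [1, 0]]"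
begin

lemma cls_less: "g \<in> carrier G \<Longrightarrow> cls g < 5"
  using repr[of g] by (auto simp: class_index_def split: if_splits)

text \<open>Integer values suffice because all irreducible characters of both groups are integer
  valued.\<close>

definition cf :: "int \<Rightarrow> int \<Rightarrow> int \<Rightarrow> int \<Rightarrow> int \<Rightarrow> 'g \<Rightarrow> complex" where
  "cf a b c d e = (\<lambda>g. if g \<in> carrier G then of_int ([a, b, c, d, e] ! cls g) else 0)"

lemma cls_cases:
  assumes "g \<in> carrier G"
  obtains "cls g = 0" | "cls g = 1" | "cls g = 2" | "cls g = 3" | "cls g = 4"
  using cls_less[OF assms] by (auto simp: less_Suc_eq numeral_eq_Suc)

lemma cf_add: "cf a b c d e g + cf a' b' c' d' e' g = cf (a + a') (b + b') (c + c') (d + d') (e + e') g"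
  by (cases "g \<in> carrier G") (auto simp: cf_def elim!: cls_cases)

lemma cf_mult: "cf a b c d e g * cf a' b' c' d' e' g = cf (a * a') (b * b') (c * c') (d * d') (e * e') g"
  by (cases "g \<in> carrier G") (auto simp: cf_def elim!: cls_cases)

lemma cf_uminus: "- cf a b c d e g = cf (- a) (- b) (- c) (- d) (- e) g"
  by (cases "g \<in> carrier G") (auto simp: cf_def elim!: cls_cases)

lemma cf_eq_iff: "cf a b c d e = cf a' b' c' d' e' \<longleftrightarrow> a = a' \<and> b = b' \<and> c = c' \<and> d = d' \<and> e = e'"
proof
  assume eq: "cf a b c d e = cf a' b' c' d' e'"
  have val: "[a, b, c, d, e] ! k = [a', b', c', d', e'] ! k" if k: "k \<in> {0, 1, 2, 3, 4}" for k
  proof -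
    from subsetD[OF cls_surj k] obtain g where "k = cls g" "g \<in> carrier G" by (rule imageE)
    then show ?thesis using fun_cong[OF eq, of g] by (simp only: cf_def if_True of_int_eq_iff)
  qed
  have "a = a'" using val[of 0] by simp
  moreover have "b = b'" using val[of 1] by simp
  moreover have "c = c'" using val[of 2] by simp
  moreover have "d = d'" using val[of 3] by simp
  moreover have "e = e'" using val[of 4] by simp
  ultimately show "a = a' \<and> b = b' \<and> c = c' \<and> d = d' \<and> e = e'" by blast
qed simp

lemma cf_one: "cf a b c d e \<one> = of_int a"
  by (simp add: cf_def cls_one)

lemma character_eq_cfI:
  assumes "\<And>i e. i < 4 \<Longrightarrow> e < 2 \<Longrightarrow>
    mat_trace (\<rho> (r [^] (i::nat) \<otimes> s [^] (e::nat))) = of_int ([v0, v1, v2, v3, v4] ! class_index i e)"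
  shows "character G \<rho> = cf v0 v1 v2 v3 v4"
proof
  fix g show "character G \<rho> g = cf v0 v1 v2 v3 v4 g"
  proof (cases "g \<in> carrier G")
    case True
    obtain i e where "i < 4" "e < 2" "g = r [^] (i::nat) \<otimes> s [^] (e::nat)" "cls g = class_index i e"
      using repr[OF True] by blast
    then show ?thesis using True assms[of i e] by (simp add: character_eq cf_def)
  qed (simp add: character_def cf_def)
qed

text \<open>The column space of P is nonzero and stable under \<open>r\<close> and \<open>s\<close>,
  hence under the group. Irreducibility makes it the whole space, so P is invertible and traces can
  be computed with BR and BS. Finding an irreducible character is thus reduced to finding a small
  invariant subspace.\<close>

lemma irrep_trace:
  assumes irrep: "is_irrep G d \<rho>"
    and P: "P \<in> carrier_mat d k" and k: "0 < k"
    and inj: "\<And>y. y \<in> carrier_vec k \<Longrightarrow> P *\<^sub>v y = 0\<^sub>v d \<Longrightarrow> y = 0\<^sub>v k"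
    and BR: "BR \<in> carrier_mat k k" "\<rho> r * P = P * BR"
    and BS: "BS \<in> carrier_mat k k" "\<rho> s * P = P * BS"
  shows "mat_trace (\<rho> (r [^] (i::nat) \<otimes> s [^] (e::nat))) = mat_trace (BR ^\<^sub>m i * BS ^\<^sub>m e)"
proof -
  have rep: "is_rep G d \<rho>" using irrep by (simp add: is_irrep_def)
  note R = is_rep_carrier[OF rep r_closed] and S = is_rep_carrier[OF rep s_closed]
  have pow: "(A ^\<^sub>m n) * P = P * (B ^\<^sub>m n)"
    if "A \<in> carrier_mat d d" "B \<in> carrier_mat k k" "A * P = P * B" for A B n
  proof (induction n)
    case 0
    then show ?case using that P by simp
  next
    case (Suc n)
    have c: "A ^\<^sub>m n \<in> carrier_mat d d" "B ^\<^sub>m n \<in> carrier_mat k k" using that by auto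
    have "A ^\<^sub>m n * A * P = A ^\<^sub>m n * (A * P)" by (rule assoc_mult_mat[OF c(1) that(1) P])
    also have "\<dots> = A ^\<^sub>m n * P * B"
      unfolding that(3) by (rule assoc_mult_mat[OF c(1) P that(2), symmetric])
    also have "\<dots> = P * (B ^\<^sub>m n * B)"
      unfolding Suc by (rule assoc_mult_mat[OF P c(2) that(2)])
    finally show ?case by simp
  qed
  have \<rho>: "\<rho> (r [^] i \<otimes> s [^] e) = \<rho> r ^\<^sub>m i * \<rho> s ^\<^sub>m e" for i e :: nat
    using is_rep_mult[OF rep] is_rep_pow[OF rep] r_closed s_closed by simp
  have inter: "\<rho> (r [^] i \<otimes> s [^] e) * P = P * (BR ^\<^sub>m i * BS ^\<^sub>m e)" for i e :: nat
  proof -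
    have c: "\<rho> r ^\<^sub>m i \<in> carrier_mat d d" "\<rho> s ^\<^sub>m e \<in> carrier_mat d d"
      "BR ^\<^sub>m i \<in> carrier_mat k k" "BS ^\<^sub>m e \<in> carrier_mat k k"
      using R S BR BS by auto
    have "\<rho> r ^\<^sub>m i * \<rho> s ^\<^sub>m e * P = \<rho> r ^\<^sub>m i * (\<rho> s ^\<^sub>m e * P)"
      by (rule assoc_mult_mat[OF c(1,2) P])
    also have "\<dots> = \<rho> r ^\<^sub>m i * P * BS ^\<^sub>m e"
      unfolding pow[OF S BS] by (rule assoc_mult_mat[OF c(1) P c(4), symmetric])
    also have "\<dots> = P * (BR ^\<^sub>m i * BS ^\<^sub>m e)"
      unfolding pow[OF R BR] by (rule assoc_mult_mat[OF P c(3,4)])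
    finally show ?thesis by (simp add: \<rho>)
  qed
  let ?W = "{P *\<^sub>v y | y. y \<in> carrier_vec k}"
  have sub: "VectorSpace.subspace class_ring ?W (module_vec TYPE(complex) d)"
  proof (rule VectorSpace.subspace.intro)
    show "vectorspace class_ring (module_vec TYPE(complex) d)" by (rule vec_vs)
    show "submodule class_ring ?W (module_vec TYPE(complex) d)"
    proof (rule submodule.intro)
      show "Module.module class_ring (module_vec TYPE(complex) d)" by (rule vec_module)
      show "?W \<subseteq> carrier (module_vec TYPE(complex) d)"
        using P by (auto simp: module_vec_simps)
      show "\<zero>\<^bsub>module_vec TYPE(complex) d\<^esub> \<in> ?W"
        using P by (auto simp: module_vec_simps intro!: exI[of _ "0\<^sub>v k"])
    next
      fix x y assume "x \<in> ?W" "y \<in> ?W"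
      then obtain x' y' where "x = P *\<^sub>v x'" "y = P *\<^sub>v y'" "x' \<in> carrier_vec k" "y' \<in> carrier_vec k"
        by blast
      then show "x \<oplus>\<^bsub>module_vec TYPE(complex) d\<^esub> y \<in> ?W"
        using mult_add_distrib_mat_vec[OF P, of x' y']
        by (auto simp: module_vec_simps intro!: exI[of _ "x' + y'"])
    next
      fix c :: complex and x assume "x \<in> ?W"
      then obtain x' where "x = P *\<^sub>v x'" "x' \<in> carrier_vec k" by blast
      then show "c \<odot>\<^bsub>module_vec TYPE(complex) d\<^esub> x \<in> ?W"
        using mult_mat_vec[OF P, of x' c]
        by (auto simp: module_vec_simps intro!: exI[of _ "c \<cdot>\<^sub>v x'"])
    qed
  qed
  have inv: "\<forall>g\<in>carrier G. \<forall>w\<in>?W. \<rho> g *\<^sub>v w \<in> ?W"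
  proof (intro ballI)
    fix g w assume g: "g \<in> carrier G" and "w \<in> ?W"
    then obtain y where y: "w = P *\<^sub>v y" "y \<in> carrier_vec k" by blast
    obtain i e where ie: "g = r [^] (i::nat) \<otimes> s [^] (e::nat)" using repr[OF g] by blast
    have "\<rho> g *\<^sub>v w = (\<rho> g * P) *\<^sub>v y"
      using y P is_rep_carrier[OF rep g] by (simp add: assoc_mult_mat_vec)
    also have "\<dots> = P *\<^sub>v ((BR ^\<^sub>m i * BS ^\<^sub>m e) *\<^sub>v y)"
      unfolding ie inter using P BR BS y by (intro assoc_mult_mat_vec) auto
    finally show "\<rho> g *\<^sub>v w \<in> ?W"
      using BR BS y by (auto intro!: exI[of _ "(BR ^\<^sub>m i * BS ^\<^sub>m e) *\<^sub>v y"] mult_mat_vec_carrier)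
  qed
  have "?W \<noteq> {0\<^sub>v d}"
  proof
    assume W: "?W = {0\<^sub>v d}"
    have "P *\<^sub>v unit_vec k 0 \<in> ?W" by (rule CollectI, rule exI[of _ "unit_vec k 0"]) simp
    then have "P *\<^sub>v unit_vec k 0 = 0\<^sub>v d" unfolding W by simp
    then have "unit_vec k 0 = (0\<^sub>v k :: complex vec)" by (intro inj) auto
    then have "unit_vec k 0 $ 0 = (0\<^sub>v k :: complex vec) $ 0" by simp
    then show False using k by simp
  qed
  then have W: "?W = carrier_vec d" using irrep sub inv unfolding is_irrep_def by blast
  then have surj: "\<exists>y\<in>carrier_vec k. P *\<^sub>v y = x" if "x \<in> carrier_vec d" for x
  proof -
    have "x \<in> ?W" unfolding W by (rule that)
    then show ?thesis by blast
  qed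
  obtain Q where "Q \<in> carrier_mat k d" "P * Q = 1\<^sub>m d" "Q * P = 1\<^sub>m k"
    using mat_two_sided_inverse[OF P inj surj] by blast
  then show ?thesis
    using P BR BS inter is_rep_carrier[OF rep] r_closed s_closed
    by (intro mat_trace_intertwiner[of _ d _ k P Q]) auto
qed

end

section \<open>Irreducibility of the explicit representations\<close>

lemma subspace_module_vecD:
  fixes W :: "complex vec set"
  assumes "VectorSpace.subspace class_ring W (module_vec TYPE(complex) d)"
  shows "W \<subseteq> carrier_vec d" and "0\<^sub>v d \<in> W"
    and "\<And>x y. x \<in> W \<Longrightarrow> y \<in> W \<Longrightarrow> x + y \<in> W" and "\<And>c x. x \<in> W \<Longrightarrow> c \<cdot>\<^sub>v x \<in> W"
proof -
  have sub: "submodule class_ring W (module_vec TYPE(complex) d)"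
    using assms by (rule VectorSpace.subspace.submod)
  show "W \<subseteq> carrier_vec d" "0\<^sub>v d \<in> W" "\<And>x y. x \<in> W \<Longrightarrow> y \<in> W \<Longrightarrow> x + y \<in> W"
    using submodule.subset[OF sub] submodule.zero_closed[OF sub] submodule.m_closed[OF sub]
    by (simp_all add: module_vec_simps)
  show "\<And>c x. x \<in> W \<Longrightarrow> c \<cdot>\<^sub>v x \<in> W"
    using submodule.smult_closed[OF sub] by (simp add: module_vec_simps)
qed

lemma is_irrep_dim_1:
  assumes "is_rep G 1 \<rho>"
  shows "is_irrep G 1 \<rho>"
proof -
  have "W = carrier_vec 1"
    if W: "VectorSpace.subspace class_ring W (module_vec TYPE(complex) 1)" and nz: "W \<noteq> {0\<^sub>v 1}" for W
  proof
    note D = subspace_module_vecD[OF W]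
    show "W \<subseteq> carrier_vec 1" by (rule D(1))
    obtain w where w: "w \<in> W" "w \<noteq> 0\<^sub>v 1" using D(2) nz by blast
    then have wc: "w \<in> carrier_vec 1" using D(1) by blast
    then have "w $ 0 \<noteq> 0" using w(2) by (metis eq_vecI carrier_vecD index_zero_vec less_one)
    then have "x = (x $ 0 / w $ 0) \<cdot>\<^sub>v w" if "x \<in> carrier_vec 1" for x
      using that wc by (intro eq_vecI) auto
    then show "carrier_vec 1 \<subseteq> W" using D(4)[OF w(1)] by (metis subsetI)
  qed
  then show ?thesis using assms unfolding is_irrep_def by (auto simp del: One_nat_def)
qed

definition diag2 :: "complex \<Rightarrow> complex \<Rightarrow> complex mat" where
  "diag2 a b = mat 2 2 (\<lambda>(i, j). if i = j then (if i = 0 then a else b) else 0)"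

lemma sum_lessThan_2: "(\<Sum>i = 0..<(2::nat). f i) = f 0 + (f 1 :: complex)"
  by (simp add: numeral_2_eq_2)

lemma less_2_cases_iff': "(i::nat) < 2 \<longleftrightarrow> i = 0 \<or> i = 1"
  by auto

lemma diag2_pow: "diag2 a b ^\<^sub>m k = diag2 (a ^ k) (b ^ k)"
proof (induction k)
  case 0
  show ?case by (intro eq_matI) (auto simp: diag2_def)
next
  case (Suc k)
  have "diag2 (a ^ k) (b ^ k) * diag2 a b = diag2 (a ^ Suc k) (b ^ Suc k)"
    by (intro eq_matI) (auto simp: diag2_def scalar_prod_def sum_lessThan_2 less_2_cases_iff')
  then show ?case by (simp add: Suc)
qed

lemma mat_1_1_pow: "mat 1 1 (\<lambda>_. a :: complex) ^\<^sub>m k = mat 1 1 (\<lambda>_. a ^ k)"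
proof (induction k)
  case 0
  show ?case by (intro eq_matI) auto
next
  case (Suc k)
  have "mat 1 1 (\<lambda>_. a ^ k) * mat 1 1 (\<lambda>_. a) = mat 1 1 (\<lambda>_. a ^ Suc k)"
    by (intro eq_matI) (auto simp: scalar_prod_def)
  then show ?case by (simp only: pow_mat.simps Suc)
qed

context order8
begin

abbreviation swap2 :: "complex mat" where
  "swap2 \<equiv> mat_of_rows_list 2 [[0, of_int \<tau>], [1, 0]]"

lemma swap2_carrier: "swap2 \<in> carrier_mat 2 2"
  by (rule carrier_matI) (simp_all add: mat_of_rows_list_def)

lemma mat_trace_diag2_swap2:
  assumes "e < 2"
  shows "mat_trace (diag2 a b * swap2 ^\<^sub>m e) = (if e = 0 then a + b else 0)"
proof -
  have "e = 0 \<or> e = 1" using assms by auto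
  then show ?thesis
    by (auto simp: mat_trace_def diag2_def mat_of_rows_list_def scalar_prod_def sum_lessThan_2
        lessThan_atLeast0)
qed

text \<open>As \<open>D r\<close> has the distinct eigenvalues i and -i, the vectors w - i D(r) w
  and w + i D(r) w isolate the two coordinates of w. One of them is nonzero, and \<open>D s\<close>
  moves its coordinate line to the other one.\<close>

lemma D_irrep: "is_irrep G 2 D"
proof -
  have "W = carrier_vec 2"
    if W: "VectorSpace.subspace class_ring W (module_vec TYPE(complex) 2)"
      and inv: "\<forall>g\<in>carrier G. \<forall>w\<in>W. D g *\<^sub>v w \<in> W" and nz: "W \<noteq> {0\<^sub>v 2}" for W
  proof
    note S = subspace_module_vecD[OF W]
    show "W \<subseteq> carrier_vec 2" by (rule S(1))
    let ?v = "\<lambda>a b. vec 2 (\<lambda>i. if i = 0 then a else b) :: complex vec"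
    have R: "D r *\<^sub>v ?v a b = ?v (\<i> * a) (- \<i> * b)" for a b
      by (intro eq_vecI)
        (auto simp: D_r mat_of_rows_list_def scalar_prod_def sum_lessThan_2 less_2_cases_iff')
    have S': "D s *\<^sub>v ?v a b = ?v (of_int \<tau> * b) a" for a b
      by (intro eq_vecI)
        (auto simp: D_s mat_of_rows_list_def scalar_prod_def sum_lessThan_2 less_2_cases_iff')
    have \<tau>: "\<tau> = 1 \<or> \<tau> = -1" using s2 by blast
    have v: "?v (x $ 0) (x $ 1) = x" if "x \<in> carrier_vec 2" for x
      using that by (intro eq_vecI) (auto simp: less_2_cases_iff')
    obtain w where w: "w \<in> W" "w \<noteq> 0\<^sub>v 2" using S(2) nz by blast
    define a b where "a = w $ 0" and "b = w $ 1"
    have wv: "w = ?v a b" using v[of w] S(1) w(1) unfolding a_def b_def by auto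
    have ab: "a \<noteq> 0 \<or> b \<noteq> 0"
      using w(2) unfolding wv by (auto simp: less_2_cases_iff')
    have Rw: "?v (\<i> * a) (- \<i> * b) \<in> W" using inv r_closed w(1) R[of a b] unfolding wv by metis
    have "w + (- \<i>) \<cdot>\<^sub>v ?v (\<i> * a) (- \<i> * b) = ?v (2 * a) 0"
      unfolding wv by (intro eq_vecI) (auto simp: less_2_cases_iff')
    then have a': "?v (2 * a) 0 \<in> W" using S(3)[OF w(1) S(4)[OF Rw, of "- \<i>"]] by simp
    have "w + \<i> \<cdot>\<^sub>v ?v (\<i> * a) (- \<i> * b) = ?v 0 (2 * b)"
      unfolding wv by (intro eq_vecI) (auto simp: less_2_cases_iff')
    then have b': "?v 0 (2 * b) \<in> W" using S(3)[OF w(1) S(4)[OF Rw, of \<i>]] by simp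
    have smult: "c \<cdot>\<^sub>v ?v x y = ?v (c * x) (c * y)" for c x y
      by (intro eq_vecI) (auto simp: less_2_cases_iff')
    have e: "?v 1 0 \<in> W \<and> ?v 0 1 \<in> W"
    proof (cases "a = 0")
      case False
      then have e0: "?v 1 0 \<in> W" using S(4)[OF a', of "1 / (2 * a)"] by (simp add: smult cong: if_cong)
      moreover have "?v 0 1 \<in> W" using inv s_closed e0 S'[of 1 0] by (metis mult_zero_right)
      ultimately show ?thesis by blast
    next
      case True
      then have e1: "?v 0 1 \<in> W" using S(4)[OF b', of "1 / (2 * b)"] ab by (simp add: smult cong: if_cong)
      moreover have "?v (of_int \<tau>) 0 \<in> W" using inv s_closed e1 S'[of 0 1] by (metis mult.right_neutral)
      \<comment> \<open>A second factor \<tau> restores the unit vector, since \<tau> is 1 or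
        -1.\<close>
      then have "of_int \<tau> \<cdot>\<^sub>v ?v (of_int \<tau>) 0 \<in> W" by (rule S(4))
      then have "?v 1 0 \<in> W" using \<tau> by (auto simp: smult cong: if_cong)
      ultimately show ?thesis by blast
    qed
    have "?v x y \<in> W" for x y
    proof -
      have "x \<cdot>\<^sub>v ?v 1 0 + y \<cdot>\<^sub>v ?v 0 1 = ?v x y"
        by (intro eq_vecI) (auto simp: less_2_cases_iff')
      then show ?thesis using e S(3) S(4) by metis
    qed
    then show "carrier_vec 2 \<subseteq> W" using v by (metis subsetI)
  qed
  then show ?thesis using D_rep unfolding is_irrep_def by auto
qed

section \<open>Classification of the irreducible characters\<close>

lemma less_4_less_2_cases:
  assumes "i < (4::nat)" "e < (2::nat)"
  obtains "i = 0" "e = 0" | "i = 1" "e = 0" | "i = 2" "e = 0" | "i = 3" "e = 0"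
    | "i = 0" "e = 1" | "i = 1" "e = 1" | "i = 2" "e = 1" | "i = 3" "e = 1"
proof -
  have "i = 0 \<or> i = 1 \<or> i = 2 \<or> i = 3" "e = 0 \<or> e = 1" using assms by auto
  then show ?thesis using that by blast
qed

text \<open>\<open>irrep_trace\<close> applies with the common eigenvector w as the only column of
  P. As \<zeta> is a sign, the resulting trace depends only on the parity of the exponent of
  \<open>r\<close>.\<close>

lemma irrep_character_1:
  assumes irrep: "is_irrep G d \<rho>"
    and w: "w \<in> carrier_vec d" "w \<noteq> 0\<^sub>v d"
    and R: "\<rho> r *\<^sub>v w = of_int \<zeta> \<cdot>\<^sub>v w" and S: "\<rho> s *\<^sub>v w = of_int \<eta> \<cdot>\<^sub>v w"
    and \<zeta>: "\<zeta> = 1 \<or> \<zeta> = -1"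
  shows "character G \<rho> = cf 1 1 \<zeta> \<eta> (\<zeta> * \<eta>)"
proof -
  have rep: "is_rep G d \<rho>" using irrep by (simp add: is_irrep_def)
  note Rc = is_rep_carrier[OF rep r_closed] and Sc = is_rep_carrier[OF rep s_closed]
  define P where "P = mat d 1 (\<lambda>(i, j). w $ i)"
  have P: "P \<in> carrier_mat d 1" by (simp add: P_def)
  have inter: "A * P = P * mat 1 1 (\<lambda>_. c)" if "A \<in> carrier_mat d d" "A *\<^sub>v w = c \<cdot>\<^sub>v w" for A c
  proof (rule eq_matI)
    fix i j assume "i < dim_row (P * mat 1 1 (\<lambda>_. c))" "j < dim_col (P * mat 1 1 (\<lambda>_. c))"
    then have i: "i < d" and j: "j = 0" by (auto simp: P_def)
    have "col P 0 = w" using w(1) by (intro eq_vecI) (auto simp: P_def)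
    then have "(A * P) $$ (i, j) = (A *\<^sub>v w) $ i" using that(1) i j P by simp
    also have "\<dots> = (P * mat 1 1 (\<lambda>_. c)) $$ (i, j)"
      using that(2) w(1) i j by (simp add: P_def scalar_prod_def)
    finally show "(A * P) $$ (i, j) = (P * mat 1 1 (\<lambda>_. c)) $$ (i, j)" .
  qed (use that P in auto)
  have inj: "y = 0\<^sub>v 1" if y: "y \<in> carrier_vec 1" "P *\<^sub>v y = 0\<^sub>v d" for y
  proof -
    obtain i where i: "i < d" "w $ i \<noteq> 0" using w by (metis carrier_vecD eq_vecI index_zero_vec)
    have "(P *\<^sub>v y) $ i = w $ i * y $ 0"
      using i y(1) by (simp add: P_def scalar_prod_def)
    then have "y $ 0 = 0" using y(2) i by simp
    then show ?thesis using y(1) by (intro eq_vecI) auto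
  qed
  have tr: "mat_trace (\<rho> (r [^] (i::nat) \<otimes> s [^] (e::nat))) = of_int \<zeta> ^ i * of_int \<eta> ^ e" for i e
  proof -
    have "mat_trace (\<rho> (r [^] i \<otimes> s [^] e))
        = mat_trace (mat 1 1 (\<lambda>_. of_int \<zeta>) ^\<^sub>m i * mat 1 1 (\<lambda>_. of_int \<eta>) ^\<^sub>m e)"
      by (rule irrep_trace[OF irrep P _ inj _ inter[OF Rc R] _ inter[OF Sc S]]) auto
    then show ?thesis
      unfolding mat_1_1_pow by (simp add: mat_trace_def scalar_prod_def)
  qed
  show ?thesis
  proof (rule character_eq_cfI)
    fix i e :: nat assume "i < 4" "e < 2"
    then show "mat_trace (\<rho> (r [^] i \<otimes> s [^] e))
        = of_int ([1, 1, \<zeta>, \<eta>, \<zeta> * \<eta>] ! class_index i e)"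
      unfolding tr using \<zeta> by (elim less_4_less_2_cases) (auto simp: class_index_def power2_eq_square power3_eq_cube)
  qed
qed

text \<open>The span of v and u is an invariant plane on which \<open>r\<close> and \<open>s\<close>
  act by the matrices of D, with \<zeta> in place of i. The trace at \<open>r\<close> is \<zeta> -
  \<zeta> = 0, so the choice between i and -i does not show in the character.\<close>

lemma irrep_character_2:
  assumes irrep: "is_irrep G d \<rho>"
    and v: "v \<in> carrier_vec d" "v \<noteq> 0\<^sub>v d" and u: "u \<in> carrier_vec d"
    and R: "\<rho> r *\<^sub>v v = \<zeta> \<cdot>\<^sub>v v" "\<rho> r *\<^sub>v u = (- \<zeta>) \<cdot>\<^sub>v u"
    and S: "\<rho> s *\<^sub>v v = u" "\<rho> s *\<^sub>v u = of_int \<tau> \<cdot>\<^sub>v v"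
    and \<zeta>: "\<zeta>\<^sup>2 = -1"
  shows "character G \<rho> = cf 2 (-2) 0 0 0"
proof -
  have rep: "is_rep G d \<rho>" using irrep by (simp add: is_irrep_def)
  note Rc = is_rep_carrier[OF rep r_closed] and Sc = is_rep_carrier[OF rep s_closed]
  have \<tau>0: "\<tau> \<noteq> 0" using s2 by auto
  have \<zeta>0: "\<zeta> \<noteq> 0" using \<zeta> by auto
  define P where "P = mat d 2 (\<lambda>(i, j). if j = 0 then v $ i else u $ i)"
  have P: "P \<in> carrier_mat d 2" by (simp add: P_def)
  have col0: "col P 0 = v" using v(1) by (intro eq_vecI) (auto simp: P_def)
  have col1: "col P 1 = u" using u(1) by (intro eq_vecI) (auto simp: P_def)
  have Pv: "(P *\<^sub>v y) $ i = v $ i * y $ 0 + u $ i * y $ 1" if "i < d" "y \<in> carrier_vec 2" for y i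
    using that by (simp add: P_def scalar_prod_def sum_lessThan_2)
  have inter: "A * P = P * B"
    if A: "A \<in> carrier_mat d d" and B: "B \<in> carrier_mat 2 2"
      and c0: "A *\<^sub>v v = B $$ (0, 0) \<cdot>\<^sub>v v + B $$ (1, 0) \<cdot>\<^sub>v u"
      and c1: "A *\<^sub>v u = B $$ (0, 1) \<cdot>\<^sub>v v + B $$ (1, 1) \<cdot>\<^sub>v u" for A B
  proof (rule eq_matI)
    fix i j assume "i < dim_row (P * B)" "j < dim_col (P * B)"
    then have i: "i < d" and j: "j < 2" using P B by auto
    have "(A * P) $$ (i, j) = (A *\<^sub>v col P j) $ i" using A i j P by simp
    also have "\<dots> = (P *\<^sub>v col B j) $ i"
    proof -
      have "(P *\<^sub>v col B j) $ i = v $ i * B $$ (0, j) + u $ i * B $$ (1, j)"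
        using Pv[OF i, of "col B j"] B j by simp
      moreover have "j = 0 \<or> j = 1" using j by auto
      ultimately show ?thesis
        using i u v(1) by (elim disjE) (simp_all add: c0 c1 col0 col1[simplified] mult.commute)
    qed
    also have "\<dots> = (P * B) $$ (i, j)" using P B i j by simp
    finally show "(A * P) $$ (i, j) = (P * B) $$ (i, j)" .
  qed (use that P in auto)
  have inter_r: "\<rho> r * P = P * diag2 \<zeta> (- \<zeta>)"
  proof (rule inter[OF Rc])
    show "\<rho> r *\<^sub>v v = diag2 \<zeta> (- \<zeta>) $$ (0, 0) \<cdot>\<^sub>v v + diag2 \<zeta> (- \<zeta>) $$ (1, 0) \<cdot>\<^sub>v u"
      unfolding R using u v by (intro eq_vecI) (auto simp: diag2_def)
    show "\<rho> r *\<^sub>v u = diag2 \<zeta> (- \<zeta>) $$ (0, 1) \<cdot>\<^sub>v v + diag2 \<zeta> (- \<zeta>) $$ (1, 1) \<cdot>\<^sub>v u"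
      unfolding R using u v by (intro eq_vecI) (auto simp: diag2_def)
  qed (simp add: diag2_def)
  have inter_s: "\<rho> s * P = P * swap2"
  proof (rule inter[OF Sc])
    show "\<rho> s *\<^sub>v v = swap2 $$ (0, 0) \<cdot>\<^sub>v v + swap2 $$ (1, 0) \<cdot>\<^sub>v u"
      unfolding S using u v by (intro eq_vecI) (auto simp: mat_of_rows_list_def)
    show "\<rho> s *\<^sub>v u = swap2 $$ (0, 1) \<cdot>\<^sub>v v + swap2 $$ (1, 1) \<cdot>\<^sub>v u"
      unfolding S(2) using u v by (intro eq_vecI) (auto simp: mat_of_rows_list_def)
  qed (rule swap2_carrier)
  have inj: "y = 0\<^sub>v 2" if y: "y \<in> carrier_vec 2" "P *\<^sub>v y = 0\<^sub>v d" for y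
  proof -
    \<comment> \<open>Applying \<open>\<rho> r\<close> to P y = 0 changes the relative sign of its
      two terms, so both vanish. This is the independence of eigenvectors for \<zeta> and -
      \<zeta>.\<close>
    have z0: "P *\<^sub>v (diag2 \<zeta> (- \<zeta>) *\<^sub>v y) = 0\<^sub>v d"
    proof -
      have "P *\<^sub>v (diag2 \<zeta> (- \<zeta>) *\<^sub>v y) = (P * diag2 \<zeta> (- \<zeta>)) *\<^sub>v y"
        using P y(1) by (intro assoc_mult_mat_vec[symmetric]) (auto simp: diag2_def)
      also have "\<dots> = \<rho> r *\<^sub>v (P *\<^sub>v y)"
        unfolding inter_r[symmetric] using P y(1) Rc by (intro assoc_mult_mat_vec) auto
      also have "\<dots> = 0\<^sub>v d" unfolding y(2) using Rc by (intro eq_vecI) auto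
      finally show ?thesis .
    qed
    have dy: "diag2 \<zeta> (- \<zeta>) *\<^sub>v y = vec 2 (\<lambda>i. if i = 0 then \<zeta> * y $ 0 else - \<zeta> * y $ 1)"
      using y(1) by (intro eq_vecI) (auto simp: diag2_def scalar_prod_def sum_lessThan_2 less_2_cases_iff')
    have eqs: "v $ i * y $ 0 = 0" "u $ i * y $ 1 = 0" if "i < d" for i
    proof -
      have e1: "v $ i * y $ 0 + u $ i * y $ 1 = 0" using Pv[OF that y(1)] y(2) that by simp
      have "\<zeta> * (v $ i * y $ 0 - u $ i * y $ 1) = 0"
        using Pv[OF that, of "diag2 \<zeta> (- \<zeta>) *\<^sub>v y"] z0 that by (auto simp: dy algebra_simps)
      then have e2: "v $ i * y $ 0 - u $ i * y $ 1 = 0" using \<zeta>0 by simp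
      have "2 * (v $ i * y $ 0) = 0" using e1 e2 by (simp add: algebra_simps)
      then show "v $ i * y $ 0 = 0" by simp
      then show "u $ i * y $ 1 = 0" using e1 by (simp only: add_0)
    qed
    obtain i where i: "i < d" "v $ i \<noteq> 0" using v by (metis carrier_vecD eq_vecI index_zero_vec)
    have "u \<noteq> 0\<^sub>v d"
    proof
      assume "u = 0\<^sub>v d"
      then have "of_int \<tau> \<cdot>\<^sub>v v = \<rho> s *\<^sub>v 0\<^sub>v d" using S(2) by simp
      also have "\<dots> = 0\<^sub>v d" using Sc by (intro eq_vecI) auto
      finally have "of_int \<tau> \<cdot>\<^sub>v v = 0\<^sub>v d" .
      then have "(of_int \<tau> \<cdot>\<^sub>v v) $ i = 0" using i by simp
      then show False using i v(1) \<tau>0 by simp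
    qed
    then obtain j where j: "j < d" "u $ j \<noteq> 0" using u by (metis carrier_vecD eq_vecI index_zero_vec)
    have "y $ 0 = 0" "y $ 1 = 0" using eqs(1)[OF i(1)] i(2) eqs(2)[OF j(1)] j(2) by auto
    then show ?thesis using y(1) by (intro eq_vecI) (auto simp: less_2_cases_iff')
  qed
  have tr: "mat_trace (\<rho> (r [^] (i::nat) \<otimes> s [^] (e::nat)))
      = mat_trace (diag2 (\<zeta> ^ i) ((- \<zeta>) ^ i) * swap2 ^\<^sub>m e)" for i e
    unfolding diag2_pow[symmetric]
    by (rule irrep_trace[OF irrep P _ inj _ inter_r _ inter_s]) (auto simp: diag2_def intro: swap2_carrier)
  have p3: "\<zeta> ^ 3 = - \<zeta>" using \<zeta> by (simp add: power3_eq_cube power2_eq_square)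
  show ?thesis
  proof (rule character_eq_cfI)
    fix i e :: nat assume i: "i < 4" and e: "e < 2"
    show "mat_trace (\<rho> (r [^] i \<otimes> s [^] e)) = of_int ([2, - 2, 0, 0, 0] ! class_index i e)"
      unfolding tr mat_trace_diag2_swap2[OF e] using i e
      by (elim less_4_less_2_cases) (simp_all add: class_index_def \<zeta> p3)
  qed
qed

text \<open>An eigenvector v of \<open>\<rho> r\<close> has an eigenvalue with \<zeta>^4 = 1, and u
  = \<rho>(s) v is an eigenvector for \<zeta>^3. If \<zeta>^2 = 1, then \<open>r\<close> is the same
  scalar on v and u while \<open>s\<close> exchanges them, so v + u, or v itself if that sum is
  zero, is a common eigenvector. If \<zeta>^2 = -1, the eigenvalues are opposite and v, u span a
  plane as in D.\<close>

lemma irrep_character: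
  assumes irrep: "is_irrep G d \<rho>"
  shows "character G \<rho> = cf 2 (-2) 0 0 0 \<or>
    (\<exists>\<zeta>\<in>{1, -1}. \<exists>\<eta>\<in>{1, -1}. character G \<rho> = cf 1 1 \<zeta> \<eta> (\<zeta> * \<eta>))"
proof -
  have rep: "is_rep G d \<rho>" and d: "0 < d" using irrep by (auto simp: is_irrep_def)
  note R = is_rep_carrier[OF rep r_closed] and S = is_rep_carrier[OF rep s_closed]
  obtain as where as: "char_poly (\<rho> r) = (\<Prod>a\<leftarrow>as. [:- a, 1:])" "length as = d"
    using char_poly_factorized[OF R] by blast
  then obtain \<zeta> as' where "as = \<zeta> # as'" using d by (cases as) auto
  then have "eigenvalue (\<rho> r) \<zeta>" by (simp add: eigenvalue_root_char_poly[OF R] as)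
  then obtain v where ev: "eigenvector (\<rho> r) v \<zeta>" unfolding eigenvalue_def by blast
  then have v: "v \<in> carrier_vec d" "v \<noteq> 0\<^sub>v d" and Rv: "\<rho> r *\<^sub>v v = \<zeta> \<cdot>\<^sub>v v"
    using R unfolding eigenvector_def by auto
  note pow = eigenvector_pow[OF R ev]
  obtain i where i: "i < d" "v $ i \<noteq> 0" using v by (metis carrier_vecD eq_vecI index_zero_vec)
  have "\<rho> r ^\<^sub>m 4 = 1\<^sub>m d" using is_rep_pow[OF rep r_closed, of 4] is_rep_one[OF rep] r4 by simp
  then have "v = \<zeta> ^ 4 \<cdot>\<^sub>v v" using pow[of 4] v by simp
  then have "v $ i = \<zeta> ^ 4 * v $ i" using i v by (metis carrier_vecD index_smult_vec(1))
  then have "\<zeta> ^ 4 = 1" using i by simp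
  then have "(\<zeta>\<^sup>2)\<^sup>2 = 1" by (simp flip: power_mult)
  then have \<zeta>2: "\<zeta>\<^sup>2 = 1 \<or> \<zeta>\<^sup>2 = -1" by (rule power2_eq_1_iff[THEN iffD1])
  define u where "u = \<rho> s *\<^sub>v v"
  have u: "u \<in> carrier_vec d" unfolding u_def using S v by simp
  have "\<rho> r * \<rho> s = \<rho> s * \<rho> r ^\<^sub>m 3"
    using is_rep_mult[OF rep r_closed s_closed] is_rep_mult[OF rep s_closed, of "r [^] (3::nat)"]
      is_rep_pow[OF rep r_closed, of 3] rs r_closed by simp
  then have "\<rho> r *\<^sub>v u = \<rho> s *\<^sub>v (\<rho> r ^\<^sub>m 3 *\<^sub>v v)"
    unfolding u_def using R S v by (metis assoc_mult_mat_vec pow_carrier_mat)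
  also have "\<dots> = \<zeta> ^ 3 \<cdot>\<^sub>v u"
    unfolding pow u_def using S v by (simp add: mult_mat_vec)
  finally have Ru: "\<rho> r *\<^sub>v u = \<zeta> ^ 3 \<cdot>\<^sub>v u" .
  have "\<rho> s *\<^sub>v u = \<rho> s ^\<^sub>m 2 *\<^sub>v v"
    unfolding u_def using S v by (simp add: numeral_2_eq_2)
  then have "\<rho> s *\<^sub>v u = \<rho> (s [^] (2::nat)) *\<^sub>v v" by (simp add: is_rep_pow[OF rep s_closed])
  then have Su: "\<tau> = 1 \<and> \<rho> s *\<^sub>v u = v \<or> \<tau> = -1 \<and> \<rho> s *\<^sub>v u = \<zeta>\<^sup>2 \<cdot>\<^sub>v v"
    using s2 is_rep_pow[OF rep r_closed, of 2] is_rep_one[OF rep] pow[of 2] v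
    by (elim disjE conjE) simp_all
  show ?thesis
  proof (cases "\<zeta>\<^sup>2 = 1")
    case True
    \<comment> \<open>This holds in either group: s^2 is 1 or r^2, and here r^2 fixes v.\<close>
    then have Su': "\<rho> s *\<^sub>v u = v" using Su by auto
    have "\<zeta> = 1 \<or> \<zeta> = -1" using True by (simp add: power2_eq_1_iff)
    then obtain z :: int where z: "\<zeta> = of_int z" "z = 1 \<or> z = -1"
      by (metis of_int_1 of_int_minus)
    have \<zeta>3: "\<zeta> ^ 3 = \<zeta>" using True by (simp add: power3_eq_cube power2_eq_square)
    show ?thesis
    proof (cases "v + u = 0\<^sub>v d")
      case False
      have r': "\<rho> r *\<^sub>v (v + u) = of_int z \<cdot>\<^sub>v (v + u)"
        using R v u Rv Ru unfolding z(1)[symmetric] \<zeta>3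
        by (simp add: mult_add_distrib_mat_vec smult_add_distrib_vec)
      have s': "\<rho> s *\<^sub>v (v + u) = of_int 1 \<cdot>\<^sub>v (v + u)"
        using S v u Su' by (simp add: mult_add_distrib_mat_vec u_def[symmetric] comm_add_vec[of u d v])
      have "character G \<rho> = cf 1 1 z 1 (z * 1)"
        by (rule irrep_character_1[OF irrep _ False r' s' z(2)]) (use u v in simp)
      then show ?thesis using z by auto
    next
      case True
      have u': "u = of_int (-1) \<cdot>\<^sub>v v"
      proof (rule eq_vecI)
        fix k assume "k < dim_vec (of_int (-1) \<cdot>\<^sub>v v)"
        then have k: "k < d" using v by simp
        have "(v + u) $ k = 0" using True k by simp
        then show "u $ k = (of_int (-1) \<cdot>\<^sub>v v) $ k"
          using k u v by (simp add: add_eq_0_iff)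
      qed (use u v in simp)
      have "character G \<rho> = cf 1 1 z (-1) (z * -1)"
        by (rule irrep_character_1[OF irrep v Rv[unfolded z(1)] u'[unfolded u_def] z(2)])
      then show ?thesis using z by auto
    qed
  next
    case False
    then have \<zeta>2: "\<zeta>\<^sup>2 = -1" using \<zeta>2 by simp
    have "\<zeta> ^ 3 = - \<zeta>" using \<zeta>2 by (simp add: power3_eq_cube power2_eq_square)
    then show ?thesis
      using irrep_character_2[OF irrep v u Rv _ u_def[symmetric] _ \<zeta>2] Ru Su \<zeta>2 by auto
  qed
qed

end

section \<open>The lattice of virtual characters\<close>

lemma fun_ring_simps:
  "carrier (fun_ring G) = {f. \<forall>g. g \<notin> carrier G \<longrightarrow> f g = 0}"
  "f \<oplus>\<^bsub>fun_ring G\<^esub> f' = (\<lambda>g. f g + f' g)" "f \<otimes>\<^bsub>fun_ring G\<^esub> f' = (\<lambda>g. f g * f' g)"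
  "\<zero>\<^bsub>fun_ring G\<^esub> = (\<lambda>g. 0)" "\<one>\<^bsub>fun_ring G\<^esub> = (\<lambda>g. if g \<in> carrier G then 1 else 0)"
  by (simp_all add: fun_ring_def)

lemma cring_fun_ring: "cring (fun_ring G)"
proof (intro cringI abelian_groupI comm_monoidI)
  fix x assume "x \<in> carrier (fun_ring G)"
  then show "\<exists>y\<in>carrier (fun_ring G). y \<oplus>\<^bsub>fun_ring G\<^esub> x = \<zero>\<^bsub>fun_ring G\<^esub>"
    by (intro bexI[of _ "\<lambda>g. - x g"]) (auto simp: fun_ring_simps)
qed (auto simp: fun_ring_simps algebra_simps fun_eq_iff)

lemma char_ring_simps:
  "f \<oplus>\<^bsub>char_ring G\<^esub> f' = (\<lambda>g. f g + f' g)" "f \<otimes>\<^bsub>char_ring G\<^esub> f' = (\<lambda>g. f g * f' g)"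
  "\<zero>\<^bsub>char_ring G\<^esub> = (\<lambda>g. 0)" "\<one>\<^bsub>char_ring G\<^esub> = (\<lambda>g. if g \<in> carrier G then 1 else 0)"
  by (simp_all add: char_ring_def fun_ring_simps)

lemma exterior_fps_1: "exterior_fps (mat 1 1 (\<lambda>_. a)) = 1 + fps_const a * fps_X"
proof -
  have "exterior_fps (mat 1 1 (\<lambda>_. a)) = fps_of_poly [:1, a:]"
  proof (rule exterior_fps_eqI)
    fix t
    have "1\<^sub>m 1 + t \<cdot>\<^sub>m mat 1 1 (\<lambda>_. a) \<in> carrier_mat 1 1" by simp
    then show "det (1\<^sub>m 1 + t \<cdot>\<^sub>m mat 1 1 (\<lambda>_. a)) = poly [:1, a:] t"
      by (subst det_single) simp_all
  qed simp
  then show ?thesis by (simp only: fps_of_poly_linear')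
qed

lemma det_2x2:
  fixes A :: "complex mat"
  assumes A: "A \<in> carrier_mat 2 2"
  shows "det A = A $$ (0, 0) * A $$ (1, 1) - A $$ (0, 1) * A $$ (1, 0)"
proof -
  have det1: "det (mat_delete A 0 j) = A $$ (1, 1 - j)" if "j < 2" for j
  proof -
    have "mat_delete A 0 j \<in> carrier_mat 1 1" using A by (auto simp: mat_delete_def)
    then show ?thesis
      using A that by (subst det_single) (auto simp: mat_delete_def less_2_cases_iff')
  qed
  have "det A = (\<Sum>j<2. A $$ (0, j) * cofactor A 0 j)"
    by (rule laplace_expansion_row[OF A]) simp
  then show ?thesis using det1[of 0] det1[of 1] by (simp add: cofactor_def numeral_2_eq_2)
qed

lemma exterior_fps_2:
  assumes A: "A \<in> carrier_mat 2 2"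
  shows "exterior_fps A = 1 + fps_const (mat_trace A) * fps_X + fps_const (det A) * fps_X\<^sup>2"
proof -
  have "exterior_fps A = fps_of_poly [:1, mat_trace A, det A:]"
  proof (rule exterior_fps_eqI[OF A])
    fix t
    have d1: "det (1\<^sub>m 2 + t \<cdot>\<^sub>m A) = (1 + t * A $$ (0, 0)) * (1 + t * A $$ (1, 1)) - (t * A $$ (0, 1)) * (t * A $$ (1, 0))"
      using A by (subst det_2x2) auto
    have d2: "det A = A $$ (0, 0) * A $$ (1, 1) - A $$ (0, 1) * A $$ (1, 0)"
      using A by (rule det_2x2)
    have d3: "mat_trace A = A $$ (0, 0) + A $$ (1, 1)"
      using A by (simp add: mat_trace_def numeral_2_eq_2)
    show "det (1\<^sub>m 2 + t \<cdot>\<^sub>m A) = poly [:1, mat_trace A, det A:] t"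
      unfolding d1 d2 d3 by (simp add: algebra_simps)
  qed
  then show ?thesis
    by (intro fps_ext) (auto simp: coeff_pCons fps_X_power_iff split: nat.splits)
qed

text \<open>The integer combinations of the values of the five irreducible characters, which are
  \<open>(1, 1, \<zeta>, \<eta>, \<zeta> \<eta>)\<close> with \<open>\<zeta>, \<eta> = \<plusminus> 1\<close>, and \<open>(2, -2, 0, 0, 0)\<close>.\<close>

definition in_lattice :: "int \<Rightarrow> int \<Rightarrow> int \<Rightarrow> int \<Rightarrow> int \<Rightarrow> bool" where
  "in_lattice a b c d e \<longleftrightarrow>
    (\<exists>k l m n. b = a + 4 * k \<and> c = a + 2 * l \<and> d = a + 2 * m \<and> e = a + 2 * (k + l + m + 2 * n))"

lemma in_latticeI:
  "b = a + 4 * k \<Longrightarrow> c = a + 2 * l \<Longrightarrow> d = a + 2 * m \<Longrightarrow> e = a + 2 * (k + l + m + 2 * n)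
    \<Longrightarrow> in_lattice a b c d e"
  unfolding in_lattice_def by blast

lemma in_lattice_add:
  assumes "in_lattice a b c d e" "in_lattice a' b' c' d' e'"
  shows "in_lattice (a + a') (b + b') (c + c') (d + d') (e + e')"
proof -
  obtain k l m n k' l' m' n'
    where "b = a + 4 * k" "c = a + 2 * l" "d = a + 2 * m" "e = a + 2 * (k + l + m + 2 * n)"
      "b' = a' + 4 * k'" "c' = a' + 2 * l'" "d' = a' + 2 * m'" "e' = a' + 2 * (k' + l' + m' + 2 * n')"
    using assms unfolding in_lattice_def by blast
  then show ?thesis
    by (intro in_latticeI[of _ _ "k + k'" _ "l + l'" _ "m + m'" _ "n + n'"]) simp_all
qed

lemma in_lattice_mult:
  assumes "in_lattice a b c d e" "in_lattice a' b' c' d' e'"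
  shows "in_lattice (a * a') (b * b') (c * c') (d * d') (e * e')"
proof -
  obtain k l m n k' l' m' n'
    where "b = a + 4 * k" "c = a + 2 * l" "d = a + 2 * m" "e = a + 2 * (k + l + m + 2 * n)"
      "b' = a' + 4 * k'" "c' = a' + 2 * l'" "d' = a' + 2 * m'" "e' = a' + 2 * (k' + l' + m' + 2 * n')"
    using assms unfolding in_lattice_def by blast
  then show ?thesis
    \<comment> \<open>The last witness is forced by e e': with h = k + l + m + 2 n it is half of
      what remains of a h' + h a' + 2 h h' after subtracting the first three witnesses.\<close>
    by (intro in_latticeI[of _ _ "a * k' + k * a' + 4 * (k * k')" _ "a * l' + l * a' + 2 * (l * l')" _
          "a * m' + m * a' + 2 * (m * m')" _
          "a * n' + n * a' + (k + l + m + 2 * n) * (k' + l' + m' + 2 * n') - 2 * (k * k') - l * l' - m * m'"])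
      (simp_all add: algebra_simps)
qed

lemma in_lattice_const: "in_lattice a a a a a"
  by (rule in_latticeI[of _ _ 0 _ 0 _ 0 _ 0]) simp_all

context order8
begin

definition lattice :: "('g \<Rightarrow> complex) set" where
  "lattice = {cf a b c d e | a b c d e. in_lattice a b c d e}"

lemma cf_in_lattice_iff: "cf a b c d e \<in> lattice \<longleftrightarrow> in_lattice a b c d e"
  unfolding lattice_def by (auto simp: cf_eq_iff)

lemma latticeE:
  assumes "f \<in> lattice"
  obtains a b c d e where "f = cf a b c d e" "in_lattice a b c d e"
  using assms unfolding lattice_def by blast

lemma cf_0: "cf 0 0 0 0 0 = (\<lambda>g. 0)"
proof
  show "cf 0 0 0 0 0 g = 0" for g
    by (cases "g \<in> carrier G") (auto simp: cf_def elim!: cls_cases)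
qed

lemma cf_1: "cf 1 1 1 1 1 = (\<lambda>g. if g \<in> carrier G then 1 else 0)"
proof
  show "cf 1 1 1 1 1 g = (if g \<in> carrier G then 1 else 0)" for g
    by (cases "g \<in> carrier G") (auto simp: cf_def elim!: cls_cases)
qed

lemma cf_smult: "of_int n * cf a b c d e g = cf (n * a) (n * b) (n * c) (n * d) (n * e) g"
  by (cases "g \<in> carrier G") (auto simp: cf_def elim!: cls_cases)

lemma lattice_outside: "f \<in> lattice \<Longrightarrow> g \<notin> carrier G \<Longrightarrow> f g = 0"
  by (auto simp: cf_def elim!: latticeE)

lemma lattice_add: "f \<in> lattice \<Longrightarrow> f' \<in> lattice \<Longrightarrow> (\<lambda>g. f g + f' g) \<in> lattice"
  by (elim latticeE) (simp add: cf_add cf_in_lattice_iff in_lattice_add)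

lemma lattice_mult: "f \<in> lattice \<Longrightarrow> f' \<in> lattice \<Longrightarrow> (\<lambda>g. f g * f' g) \<in> lattice"
  by (elim latticeE) (simp add: cf_mult cf_in_lattice_iff in_lattice_mult)

lemma lattice_uminus: "f \<in> lattice \<Longrightarrow> (\<lambda>g. - f g) \<in> lattice"
  by (elim latticeE) (use in_lattice_mult[OF in_lattice_const[of "-1"]] in \<open>fastforce simp: cf_uminus cf_in_lattice_iff\<close>)

lemma lattice_0: "(\<lambda>g. 0) \<in> lattice"
  unfolding cf_0[symmetric] cf_in_lattice_iff by (rule in_lattice_const)

lemma lattice_sum: "(\<And>i. i \<in> A \<Longrightarrow> f i \<in> lattice) \<Longrightarrow> (\<lambda>g. \<Sum>i\<in>A. f i g) \<in> lattice"
  by (induction A rule: infinite_finite_induct) (simp_all add: lattice_0 lattice_add)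

definition irreducible_characters :: "('g \<Rightarrow> complex) set" where
  "irreducible_characters = insert (cf 2 (-2) 0 0 0) {cf 1 1 \<zeta> \<eta> (\<zeta> * \<eta>) | \<zeta> \<eta>. \<zeta> \<in> {1, -1} \<and> \<eta> \<in> {1, -1}}"

definition linear_rep :: "int \<Rightarrow> int \<Rightarrow> 'g \<Rightarrow> complex mat" where
  "linear_rep \<zeta> \<eta> = (\<lambda>g. mat 1 1 (\<lambda>_. complex_of_int ([1, 1, \<zeta>, \<eta>, \<zeta> * \<eta>] ! cls g)))"

lemma character_linear_rep: "character G (linear_rep \<zeta> \<eta>) = cf 1 1 \<zeta> \<eta> (\<zeta> * \<eta>)"
  by (auto simp: character_def linear_rep_def cf_def)

lemma character_D: "character G D = cf 2 (-2) 0 0 0"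
proof -
  have D_r': "D r = diag2 \<i> (- \<i>)"
    unfolding D_r by (intro eq_matI) (auto simp: diag2_def mat_of_rows_list_def less_2_cases_iff')
  have tr: "mat_trace (D (r [^] i \<otimes> s [^] e)) = mat_trace (diag2 (\<i> ^ i) ((- \<i>) ^ i) * swap2 ^\<^sub>m e)" for i e :: nat
    using is_rep_mult[OF D_rep] is_rep_pow[OF D_rep] r_closed s_closed
    by (simp add: D_r' D_s diag2_pow)
  show ?thesis
  proof (rule character_eq_cfI)
    fix i e :: nat assume i: "i < 4" and e: "e < 2"
    show "mat_trace (D (r [^] i \<otimes> s [^] e)) = of_int ([2, - 2, 0, 0, 0] ! class_index i e)"
      unfolding tr mat_trace_diag2_swap2[OF e] using i e
      by (elim less_4_less_2_cases) (simp_all add: class_index_def power3_eq_cube)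
  qed
qed

text \<open>One inclusion is the classification; for the other, each of the five functions is
  realised by D or by a linear representation.\<close>

lemma irreducible_characters_eq:
  "{character G \<rho> | d \<rho>. is_irrep G d \<rho>} = irreducible_characters"
proof (intro equalityI subsetI)
  fix f assume "f \<in> {character G \<rho> | d \<rho>. is_irrep G d \<rho>}"
  then obtain d \<rho> where "f = character G \<rho>" "is_irrep G d \<rho>" by blast
  then show "f \<in> irreducible_characters"
    using irrep_character[of d \<rho>] unfolding irreducible_characters_def by blast
next
  fix f assume "f \<in> irreducible_characters"
  then consider "f = character G D" | \<zeta> \<eta> where "\<zeta> \<in> {1, -1}" "\<eta> \<in> {1, -1}" "f = character G (linear_rep \<zeta> \<eta>)"
    unfolding irreducible_characters_def character_linear_rep character_D by blast
  then show "f \<in> {character G \<rho> | d \<rho>. is_irrep G d \<rho>}"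
  proof cases
    case 1
    then show ?thesis using D_irrep by blast
  next
    case 2
    then have "is_irrep G 1 (linear_rep \<zeta> \<eta>)"
      using lin_rep unfolding linear_rep_def by (blast intro: is_irrep_dim_1)
    then show ?thesis using 2(3) by blast
  qed
qed

lemma irreducible_characters_lattice: "irreducible_characters \<subseteq> lattice"
proof -
  have "in_lattice 2 (-2) 0 0 0" by (rule in_latticeI[of _ _ "-1" _ "-1" _ "-1" _ 1]) simp_all
  moreover have "in_lattice 1 1 1 1 1" by (rule in_lattice_const)
  moreover have "in_lattice 1 1 1 (-1) (-1)" by (rule in_latticeI[of _ _ 0 _ 0 _ "-1" _ 0]) simp_all
  moreover have "in_lattice 1 1 (-1) 1 (-1)" by (rule in_latticeI[of _ _ 0 _ "-1" _ 0 _ 0]) simp_all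
  moreover have "in_lattice 1 1 (-1) (-1) 1" by (rule in_latticeI[of _ _ 0 _ "-1" _ "-1" _ 1]) simp_all
  ultimately show ?thesis
    unfolding irreducible_characters_def by (auto simp: cf_in_lattice_iff)
qed

lemma cf_combination:
  "(\<lambda>g. of_int n0 * cf a0 b0 c0 d0 e0 g + (of_int n1 * cf a1 b1 c1 d1 e1 g + (of_int n2 * cf a2 b2 c2 d2 e2 g +
      (of_int n3 * cf a3 b3 c3 d3 e3 g + of_int n4 * cf a4 b4 c4 d4 e4 g))))
    = cf (n0 * a0 + (n1 * a1 + (n2 * a2 + (n3 * a3 + n4 * a4)))) (n0 * b0 + (n1 * b1 + (n2 * b2 + (n3 * b3 + n4 * b4))))
       (n0 * c0 + (n1 * c1 + (n2 * c2 + (n3 * c3 + n4 * c4)))) (n0 * d0 + (n1 * d1 + (n2 * d2 + (n3 * d3 + n4 * d4))))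
       (n0 * e0 + (n1 * e1 + (n2 * e2 + (n3 * e3 + n4 * e4))))"
  by (simp add: cf_smult cf_add)

text \<open>The lattice is additively generated by the five irreducible characters. The rule reduces
  claims about virtual characters to honest representations, where exterior powers are
  available.\<close>

lemma lattice_induct [consumes 1, case_names base zero add uminus]:
  assumes f: "f \<in> lattice"
    and base: "\<And>f. f \<in> irreducible_characters \<Longrightarrow> P f"
    and zero: "P (\<lambda>g. 0)"
    and add: "\<And>f f'. f \<in> lattice \<Longrightarrow> P f \<Longrightarrow> f' \<in> lattice \<Longrightarrow> P f' \<Longrightarrow> P (\<lambda>g. f g + f' g)"
    and uminus: "\<And>f. f \<in> lattice \<Longrightarrow> P f \<Longrightarrow> P (\<lambda>g. - f g)"
  shows "P f"
proof -
  have smult_nat: "(\<lambda>g. of_nat n * f g) \<in> lattice \<and> P (\<lambda>g. of_nat n * f g)"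
    if "f \<in> lattice" "P f" for f and n :: nat
  proof (induction n)
    case (Suc n)
    then show ?case using add[of f "\<lambda>g. of_nat n * f g"] lattice_add[of f "\<lambda>g. of_nat n * f g"] that
      by (simp add: algebra_simps)
  qed (simp add: lattice_0 zero)
  have smult: "(\<lambda>g. of_int n * f g) \<in> lattice \<and> P (\<lambda>g. of_int n * f g)" if "f \<in> lattice" "P f" for f and n :: int
  proof (cases n rule: int_cases2)
    case (nonneg k)
    then show ?thesis using smult_nat[OF that, of k] by simp
  next
    case (nonpos k)
    then show ?thesis using smult_nat[OF that, of k] uminus[of "\<lambda>g. of_nat k * f g"]
        lattice_uminus[of "\<lambda>g. of_nat k * f g"] by simp
  qed
  obtain a b c d e where fe: "f = cf a b c d e" "in_lattice a b c d e" using f by (rule latticeE)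
  then obtain k l m n where p: "b = a + 4 * k" "c = a + 2 * l" "d = a + 2 * m" "e = a + 2 * (k + l + m + 2 * n)"
    unfolding in_lattice_def by blast
  have irr: "cf 1 1 1 1 1 \<in> irreducible_characters" "cf 1 1 1 (-1) (-1) \<in> irreducible_characters"
    "cf 1 1 (-1) 1 (-1) \<in> irreducible_characters" "cf 1 1 (-1) (-1) 1 \<in> irreducible_characters"
    "cf 2 (-2) 0 0 0 \<in> irreducible_characters"
    unfolding irreducible_characters_def by (force simp: cf_eq_iff)+
  note i = irr[THEN base] irr[THEN subsetD[OF irreducible_characters_lattice]]
  \<comment> \<open>The coefficients are the multiplicities of the irreducible characters, that is
    the inner products with them for class sizes 1, 1, 2, 2, 2; for D this is (a - b) / 4 = -
    k.\<close>
  have "f = (\<lambda>g. of_int (a + m + l + n + k) * cf 1 1 1 1 1 g + (of_int (- m - n) * cf 1 1 1 (-1) (-1) g +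
      (of_int (- l - n) * cf 1 1 (-1) 1 (-1) g + (of_int (k + n) * cf 1 1 (-1) (-1) 1 g +
        of_int (- k) * cf 2 (-2) 0 0 0 g))))"
    unfolding cf_combination fe(1) p cf_eq_iff by (simp add: algebra_simps)
  then show ?thesis
    using smult[OF i(6,1)] smult[OF i(7,2)] smult[OF i(8,3)] smult[OF i(9,4)] smult[OF i(10,5)]
    by (simp only:) (intro add lattice_add; blast)
qed

lemma char_ring_carrier: "carrier (char_ring G) = lattice"
proof -
  interpret cring "fun_ring G" by (rule cring_fun_ring)
  let ?A = "add_monoid (fun_ring G)"
  have sub: "irreducible_characters \<subseteq> carrier ?A"
    using irreducible_characters_lattice lattice_outside by (auto simp: fun_ring_simps)
  have minus: "inv\<^bsub>?A\<^esub> f = (\<lambda>g. - f g)" if "f \<in> carrier ?A" for f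
    by (rule group.inv_equality[OF a_group]) (use that in \<open>auto simp: fun_ring_simps\<close>)
  have "generate ?A irreducible_characters = lattice"
  proof
    have "subgroup lattice ?A"
    proof (rule group.subgroupI[OF a_group])
      show "lattice \<subseteq> carrier ?A" using lattice_outside by (auto simp: fun_ring_simps)
      then show "inv\<^bsub>?A\<^esub> f \<in> lattice" if "f \<in> lattice" for f
        using minus[of f] that lattice_uminus by auto
    qed (use lattice_0 lattice_add in \<open>auto simp: fun_ring_simps\<close>)
    then show "generate ?A irreducible_characters \<subseteq> lattice"
      by (rule group.generate_subgroup_incl[OF a_group irreducible_characters_lattice])
    have gen: "subgroup (generate ?A irreducible_characters) ?A" by (rule group.generate_is_subgroup[OF a_group sub])
    show "lattice \<subseteq> generate ?A irreducible_characters"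
    proof
      fix f assume "f \<in> lattice"
      then show "f \<in> generate ?A irreducible_characters"
      proof (induction rule: lattice_induct)
        case (base f)
        then show ?case by (rule generate.incl)
      next
        case zero
        have "\<one>\<^bsub>?A\<^esub> = (\<lambda>g. 0)" by (simp add: fun_ring_simps)
        then show ?case using generate.one[of ?A irreducible_characters] by metis
      next
        case (add f f')
        have "f \<otimes>\<^bsub>?A\<^esub> f' = (\<lambda>g. f g + f' g)" by (simp add: fun_ring_simps)
        then show ?case using subgroup.m_closed[OF gen add.IH] by metis
      next
        case (uminus f)
        have "inv\<^bsub>?A\<^esub> f = (\<lambda>g. - f g)" using uminus.IH subgroup.subset[OF gen] minus by blast
        then show ?case using subgroup.m_inv_closed[OF gen uminus.IH] by metis
      qed
    qed
  qed
  then show ?thesis by (simp add: char_ring_def irreducible_characters_eq)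
qed

lemma cring_char_ring: "cring (char_ring G)"
proof (intro cringI abelian_groupI comm_monoidI)
  fix x assume "x \<in> carrier (char_ring G)"
  then show "\<exists>y\<in>carrier (char_ring G). y \<oplus>\<^bsub>char_ring G\<^esub> x = \<zero>\<^bsub>char_ring G\<^esub>"
    by (intro bexI[of _ "\<lambda>g. - x g"]) (auto simp: char_ring_simps char_ring_carrier lattice_uminus)
next
  fix x assume "x \<in> carrier (char_ring G)"
  then show "\<one>\<^bsub>char_ring G\<^esub> \<otimes>\<^bsub>char_ring G\<^esub> x = x"
    using lattice_outside by (auto simp: char_ring_simps char_ring_carrier)
qed (auto simp: char_ring_simps char_ring_carrier algebra_simps fun_eq_iff lattice_add lattice_mult
      lattice_0 cf_1[symmetric] cf_in_lattice_iff in_lattice_const)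

lemma char_ring_finsum:
  assumes "finite A" "\<And>i. i \<in> A \<Longrightarrow> f i \<in> lattice"
  shows "(\<Oplus>\<^bsub>char_ring G\<^esub>i\<in>A. f i) = (\<lambda>g. \<Sum>i\<in>A. f i g)"
proof -
  interpret cring "char_ring G" by (rule cring_char_ring)
  show ?thesis using assms
  proof (induction A rule: finite_induct)
    case empty
    show ?case by (simp add: char_ring_simps)
  next
    case (insert x A)
    then have "(\<Oplus>\<^bsub>char_ring G\<^esub>i\<in>insert x A. f i) = f x \<oplus>\<^bsub>char_ring G\<^esub> (\<Oplus>\<^bsub>char_ring G\<^esub>i\<in>A. f i)"
      by (intro finsum_insert) (auto simp: char_ring_carrier)
    then show ?case using insert by (simp add: char_ring_simps)
  qed
qed

lemma char_ring_minus:
  assumes "f \<in> lattice"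
  shows "\<ominus>\<^bsub>char_ring G\<^esub> f = (\<lambda>g. - f g)"
proof -
  interpret cring "char_ring G" by (rule cring_char_ring)
  show ?thesis
    by (rule minus_equality) (use assms in \<open>auto simp: char_ring_simps char_ring_carrier lattice_uminus\<close>)
qed

end

section \<open>The lambda and gamma operations\<close>

text \<open>The expansion t + t^2 + ... of t / (1 - t).\<close>

definition shift_fps :: "complex fps" where
  "shift_fps = Abs_fps (\<lambda>n. if n = 0 then 0 else 1)"

lemma shift_fps_nth: "fps_nth shift_fps n = (if n = 0 then 0 else 1)"
  by (simp add: shift_fps_def)

lemma shift_fps_eq: "shift_fps = fps_X + fps_X * shift_fps"
  by (rule fps_ext) (auto simp: shift_fps_nth)

lemma shift_fps_mult: "shift_fps * (1 - fps_X) = fps_X"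
proof -
  have "shift_fps * (1 - fps_X) = shift_fps - fps_X * shift_fps" by (simp add: algebra_simps)
  also have "\<dots> = fps_X" by (subst (1) shift_fps_eq) simp
  finally show ?thesis .
qed

lemma shift_fps_power_Suc: "shift_fps ^ Suc i = fps_X * (shift_fps ^ i + shift_fps ^ Suc i)"
proof -
  have "shift_fps ^ Suc i = (fps_X + fps_X * shift_fps) * shift_fps ^ i"
    unfolding power_Suc by (subst (1) shift_fps_eq) simp
  also have "\<dots> = fps_X * (shift_fps ^ i + shift_fps ^ Suc i)" by (simp add: distrib_left distrib_right mult.assoc)
  finally show ?thesis .
qed

text \<open>The equation \<open>shift_fps = fps_X + fps_X * shift_fps\<close> makes the coefficients
  of the powers satisfy Pascal's rule.\<close>

lemma shift_fps_power_nth: "fps_nth (shift_fps ^ Suc i) (Suc n) = of_nat (n choose i)"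
proof (induction n arbitrary: i)
  case (0 i)
  have "fps_nth (shift_fps ^ Suc i) (Suc 0) = fps_nth (shift_fps ^ i + shift_fps ^ Suc i) 0"
    by (subst shift_fps_power_Suc) simp
  then show ?case by (cases i) (simp_all add: shift_fps_nth)
next
  case (Suc n i)
  have "fps_nth (shift_fps ^ Suc i) (Suc (Suc n)) = fps_nth (shift_fps ^ i + shift_fps ^ Suc i) (Suc n)"
    by (subst shift_fps_power_Suc) simp
  then have "fps_nth (shift_fps ^ Suc i) (Suc (Suc n))
      = fps_nth (shift_fps ^ i) (Suc n) + of_nat (n choose i)"
    by (simp only: fps_add_nth Suc)
  moreover have "fps_nth (shift_fps ^ i) (Suc n) = (case i of 0 \<Rightarrow> 0 | Suc j \<Rightarrow> of_nat (n choose j))"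
    by (cases i) (simp_all only: Suc nat.case power_0, simp)
  ultimately show ?case by (cases i) simp_all
qed

lemma one_plus_fps_X_power_nth: "fps_nth ((1 + fps_X) ^ n) k = (of_nat (n choose k) :: complex)"
proof (induction n arbitrary: k)
  case (Suc n)
  have "(1 + fps_X) ^ Suc n = ((1 + fps_X) ^ n + fps_X * (1 + fps_X) ^ n :: complex fps)" by (simp add: algebra_simps)
  then have "fps_nth ((1 + fps_X) ^ Suc n) k
      = fps_nth ((1 + fps_X) ^ n) k + (fps_nth (fps_X * (1 + fps_X) ^ n) k :: complex)"
    by (simp only: fps_add_nth)
  then show ?case using Suc by (cases k) (simp_all del: power_Suc)
next
  case 0
  show ?case by (cases k) simp_all
qed

text \<open>The substitution \<open>\<gamma>\<^sub>t = \<lambda>\<^bsub>t/(1-t)\<^esub>\<close>, coefficientwise.\<close>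

lemma compose_shift_fps_nth:
  "fps_nth (f oo shift_fps) (Suc n) = fps_nth (f * (1 + fps_X) ^ n) (Suc n)"
proof -
  have "fps_nth (f oo shift_fps) (Suc n) = (\<Sum>i=0..Suc n. fps_nth f i * fps_nth (shift_fps ^ i) (Suc n))"
    by (simp only: fps_compose_nth)
  also have "\<dots> = (\<Sum>i=0..Suc n. fps_nth f i * of_nat (n choose (Suc n - i)))"
  proof (rule sum.cong[OF refl])
    fix i assume i: "i \<in> {0..Suc n}"
    show "fps_nth f i * fps_nth (shift_fps ^ i) (Suc n) = fps_nth f i * of_nat (n choose (Suc n - i))"
    \<comment> \<open>For i = 0 both sides vanish, because n choose (n + 1) is 0; otherwise the
      symmetry of binomial coefficients applies.\<close>
    proof (cases i)
      case (Suc j)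
      then have "n choose j = n choose (Suc n - i)" using i binomial_symmetric[of j n] by simp
      then show ?thesis unfolding Suc shift_fps_power_nth by simp
    qed simp
  qed
  also have "\<dots> = fps_nth (f * (1 + fps_X) ^ n) (Suc n)"
    by (simp only: fps_mult_nth one_plus_fps_X_power_nth)
  finally show ?thesis .
qed

lemma compose_shift_fps_mult: "(f * g) oo shift_fps = (f oo shift_fps) * (g oo shift_fps)"
  by (rule fps_compose_mult_distrib) (simp add: shift_fps_nth)

context order8
begin

text \<open>On generators the determinant is 1 at \<open>r\<close> and - \<tau> at \<open>s\<close>:
  it is the trivial character for \<tau> = -1 and a sign character for \<tau> = 1. Here \<tau>
  becomes visible in the character ring.\<close>

lemma det_D:
  assumes g: "g \<in> carrier G"
  shows "det (D g) = cf 1 1 1 (- \<tau>) (- \<tau>) g"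
proof -
  obtain i e where ie: "i < 4" "e < 2" "g = r [^] (i::nat) \<otimes> s [^] (e::nat)" "cls g = class_index i e"
    using repr[OF g] by blast
  note R = is_rep_carrier[OF D_rep r_closed] and S = is_rep_carrier[OF D_rep s_closed]
  have pow: "det (A ^\<^sub>m k) = det A ^ k" if "A \<in> carrier_mat 2 2" for A :: "complex mat" and k
    using that by (induction k) (simp_all add: det_mult[of _ 2])
  have detr: "det (D r) = 1" using det_2x2[OF R] by (simp add: D_r mat_of_rows_list_def)
  have dets: "det (D s) = - of_int \<tau>" using det_2x2[OF S] by (simp add: D_s mat_of_rows_list_def)
  have "D g = D r ^\<^sub>m i * D s ^\<^sub>m e"
    using is_rep_mult[OF D_rep] is_rep_pow[OF D_rep] r_closed s_closed by (simp add: ie(3))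
  then have "det (D g) = det (D r) ^ i * det (D s) ^ e"
    using det_mult[of "D r ^\<^sub>m i" 2 "D s ^\<^sub>m e"] R S by (simp add: pow)
  then have det: "det (D g) = (- of_int \<tau>) ^ e" by (simp add: detr dets)
  show ?thesis using g ie(1,2) unfolding cf_def ie(4) det
    by (elim less_4_less_2_cases) (auto simp: class_index_def)
qed

lemma exterior_fps_linear_rep:
  "exterior_fps (linear_rep \<zeta> \<eta> g) = 1 + fps_const (complex_of_int ([1, 1, \<zeta>, \<eta>, \<zeta> * \<eta>] ! cls g)) * fps_X"
  unfolding linear_rep_def by (rule exterior_fps_1)

lemma exterior_fps_D:
  assumes "g \<in> carrier G"
  shows "exterior_fps (D g) = 1 + fps_const (cf 2 (-2) 0 0 0 g) * fps_X
    + fps_const (cf 1 1 1 (- \<tau>) (- \<tau>) g) * fps_X\<^sup>2"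
  using exterior_fps_2[OF is_rep_carrier[OF D_rep assms]]
  unfolding det_D[OF assms] character_D[symmetric] character_eq[OF assms, of D] .

lemma linear_rep_is_rep: "\<zeta> \<in> {1, -1} \<Longrightarrow> \<eta> \<in> {1, -1} \<Longrightarrow> is_rep G 1 (linear_rep \<zeta> \<eta>)"
  unfolding linear_rep_def by (rule lin_rep)

lemma \<tau>_cases: "\<tau> = 1 \<or> \<tau> = -1"
  using s2 by blast

lemma linear_in_irreducible:
  "\<zeta> \<in> {1, -1} \<Longrightarrow> \<eta> \<in> {1, -1} \<Longrightarrow> cf 1 1 \<zeta> \<eta> (\<zeta> * \<eta>) \<in> irreducible_characters"
  unfolding irreducible_characters_def by blast

lemma linear_in_lattice:
  "\<zeta> \<in> {1, -1} \<Longrightarrow> \<eta> \<in> {1, -1} \<Longrightarrow> cf 1 1 \<zeta> \<eta> (\<zeta> * \<eta>) \<in> lattice"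
  using linear_in_irreducible irreducible_characters_lattice by blast

lemma D_in_lattice: "cf 2 (-2) 0 0 0 \<in> lattice"
  using irreducible_characters_lattice unfolding irreducible_characters_def by blast

lemma det_in_lattice: "cf 1 1 1 (- \<tau>) (- \<tau>) \<in> lattice"
  using \<tau>_cases linear_in_lattice[of 1 "- \<tau>"] by auto

lemma const_in_lattice: "cf k k k k k \<in> lattice"
  by (simp add: cf_in_lattice_iff in_lattice_const)

lemma exterior_power_characterI:
  assumes "\<And>g. g \<in> carrier G \<Longrightarrow> fps_nth (exterior_fps (\<rho> g)) n = h g" "h \<in> lattice"
  shows "character G (\<lambda>g. exterior_power_mat n (\<rho> g)) = h"
proof
  show "character G (\<lambda>g. exterior_power_mat n (\<rho> g)) g = h g" for g
    using assms(1)[of g] lattice_outside[OF assms(2), of g]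
    by (cases "g \<in> carrier G") (simp_all add: character_eq exterior_fps_def, simp add: character_def)
qed

lemma exterior_power_D: "character G (\<lambda>g. exterior_power_mat n (D g)) \<in> lattice"
proof -
  let ?h = "if n = 0 then cf 1 1 1 1 1 else if n = 1 then cf 2 (-2) 0 0 0
    else if n = 2 then cf 1 1 1 (- \<tau>) (- \<tau>) else (\<lambda>g. 0)"
  have h: "?h \<in> lattice"
    using const_in_lattice D_in_lattice det_in_lattice lattice_0 by simp
  have v: "fps_nth (exterior_fps (D g)) n = ?h g" if "g \<in> carrier G" for g
    using that by (auto simp: exterior_fps_D cf_1 fps_X_power_iff)
  have "character G (\<lambda>g. exterior_power_mat n (D g)) = ?h" by (rule exterior_power_characterI[OF v h])
  then show ?thesis by (rule ssubst) (rule h)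
qed

lemma exterior_power_linear_rep:
  assumes "\<zeta> \<in> {1, -1}" "\<eta> \<in> {1, -1}"
  shows "character G (\<lambda>g. exterior_power_mat n (linear_rep \<zeta> \<eta> g)) \<in> lattice"
proof -
  let ?h = "if n = 0 then cf 1 1 1 1 1 else if n = 1 then cf 1 1 \<zeta> \<eta> (\<zeta> * \<eta>) else (\<lambda>g. 0)"
  have h: "?h \<in> lattice"
    using const_in_lattice linear_in_lattice[OF assms] lattice_0 by simp
  have v: "fps_nth (exterior_fps (linear_rep \<zeta> \<eta> g)) n = ?h g" if "g \<in> carrier G" for g
    using that by (auto simp: exterior_fps_linear_rep cf_1, auto simp: cf_def)
  have "character G (\<lambda>g. exterior_power_mat n (linear_rep \<zeta> \<eta> g)) = ?h"
    by (rule exterior_power_characterI[OF v h])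
  then show ?thesis by (rule ssubst) (rule h)
qed

lemma newton_lambda_zero: "newton_lambda G n (\<lambda>g. 0) = (if n = 0 then cf 1 1 1 1 1 else (\<lambda>g. 0))"
  by (auto simp: newton_lambda_def newton_fps_zero cf_1)

lemma newton_lambda_irreducible:
  assumes "f \<in> irreducible_characters"
  shows "newton_lambda G n f \<in> lattice"
proof -
  consider "f = character G D" | \<zeta> \<eta> where "\<zeta> \<in> {1, -1}" "\<eta> \<in> {1, -1}" "f = character G (linear_rep \<zeta> \<eta>)"
    using assms unfolding irreducible_characters_def character_linear_rep character_D by blast
  then show ?thesis
  proof cases
    case 1
    show ?thesis unfolding 1 newton_lambda_character[OF D_rep] by (rule exterior_power_D)
  next
    case 2
    show ?thesis
      unfolding 2(3) newton_lambda_character[OF linear_rep_is_rep[OF 2(1,2)]]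
      by (rule exterior_power_linear_rep[OF 2(1,2)])
  qed
qed

text \<open>On irreducible characters Newton's formula gives characters of exterior powers, which
  are known in dimensions 1 and 2. Sums are handled by the convolution formula, and negatives by
  inverting a series with constant term 1, which needs no division.\<close>

lemma newton_lambda_closed: "f \<in> lattice \<Longrightarrow> newton_lambda G n f \<in> lattice"
proof (induction arbitrary: n rule: lattice_induct)
  case (base f)
  then show ?case by (rule newton_lambda_irreducible)
next
  case zero
  show ?case by (simp add: newton_lambda_zero const_in_lattice lattice_0)
next
  case (add f f')
  then show ?case unfolding newton_lambda_add by (intro lattice_sum lattice_mult)
next
  case (uminus f)
  have L0: "newton_lambda G 0 f = cf 1 1 1 1 1" by (simp add: newton_lambda_0 fun_ring_simps cf_1)
  let ?L' = "\<lambda>n. newton_lambda G n (\<lambda>g. - f g)"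
  show ?case
  proof (induction n rule: less_induct)
    case (less n)
    \<comment> \<open>Coefficient n of lambda_t(f) lambda_t(- f) = lambda_t(0), solved for
      lambda^n(- f), whose cofactor is lambda^0(f) = 1.\<close>
    have "?L' n g = newton_lambda G n (\<lambda>g. 0) g + - (\<Sum>i\<in>{1..n}. newton_lambda G i f g * ?L' (n - i) g)" for g
    proof -
      have "newton_lambda G n (\<lambda>g. 0) g = (\<Sum>i\<le>n. newton_lambda G i f g * ?L' (n - i) g)"
        using fun_cong[OF newton_lambda_add[of G n f "\<lambda>g. - f g"], of g] by simp
      also have "{..n} = insert 0 {1..n}" by auto
      also have "(\<Sum>i\<in>insert 0 {1..n}. newton_lambda G i f g * ?L' (n - i) g)
        = newton_lambda G 0 f g * ?L' n g + (\<Sum>i\<in>{1..n}. newton_lambda G i f g * ?L' (n - i) g)"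
        by simp
      also have "newton_lambda G 0 f g * ?L' n g = ?L' n g"
        by (simp add: L0 cf_1) (simp add: newton_lambda_def)
      finally show ?thesis by simp
    qed
    then have "?L' n = (\<lambda>g. newton_lambda G n (\<lambda>g. 0) g
        + - (\<Sum>i\<in>{1..n}. newton_lambda G i f g * ?L' (n - i) g))"
      by (rule ext)
    also have "\<dots> \<in> lattice"
    proof (intro lattice_add lattice_uminus lattice_sum lattice_mult)
      show "newton_lambda G n (\<lambda>g. 0) \<in> lattice"
        by (simp add: newton_lambda_zero const_in_lattice lattice_0)
      fix i assume "i \<in> {1..n}"
      then show "?L' (n - i) \<in> lattice" by (intro less) auto
    qed (rule uminus)
    finally show ?case .
  qed
qed

lemma is_lambda_structure_newton: "is_lambda_structure G (newton_lambda G)"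
  unfolding is_lambda_structure_def
proof (intro conjI allI ballI impI)
  show "newton_lambda G n \<in> carrier (char_ring G) \<rightarrow> carrier (char_ring G)" for n
    by (auto simp: char_ring_carrier newton_lambda_closed)
  show "newton_lambda G n (character G \<rho>) = character G (\<lambda>g. exterior_power_mat n (\<rho> g))"
    if "is_rep G d \<rho>" for n d \<rho>
    using that by (rule newton_lambda_character)
  show "newton_lambda G 0 x = \<one>\<^bsub>char_ring G\<^esub>" for x
    by (simp add: newton_lambda_0 fun_ring_simps char_ring_simps)
  show "newton_lambda G n (x \<oplus>\<^bsub>char_ring G\<^esub> y)
      = (\<Oplus>\<^bsub>char_ring G\<^esub>i\<in>{..n}. newton_lambda G i x \<otimes>\<^bsub>char_ring G\<^esub> newton_lambda G (n - i) y)"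
    if "x \<in> carrier (char_ring G)" "y \<in> carrier (char_ring G)" for n x y
    using that by (simp add: char_ring_simps newton_lambda_add char_ring_finsum char_ring_carrier
        newton_lambda_closed lattice_mult)
qed

text \<open>Newton's formula has served its purpose once a solution exists. From here on
  \<open>lambda_op\<close> is accessed through the defining conditions only, which prescribe
  lambda_t on characters and make it multiplicative.\<close>

lemma is_lambda_structure_lambda_op: "is_lambda_structure G (lambda_op G)"
  unfolding lambda_op_def by (rule someI[of "is_lambda_structure G", OF is_lambda_structure_newton])

lemma lambda_op_closed: "f \<in> lattice \<Longrightarrow> lambda_op G n f \<in> lattice"
  using is_lambda_structure_lambda_op unfolding is_lambda_structure_def char_ring_carrier by blast

lemma lambda_op_character:
  "is_rep G d \<rho> \<Longrightarrow> lambda_op G n (character G \<rho>) = character G (\<lambda>g. exterior_power_mat n (\<rho> g))"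
  using is_lambda_structure_lambda_op unfolding is_lambda_structure_def by blast

lemma lambda_op_0: "f \<in> lattice \<Longrightarrow> lambda_op G 0 f = cf 1 1 1 1 1"
  using is_lambda_structure_lambda_op
  unfolding is_lambda_structure_def char_ring_carrier cf_1 char_ring_simps by blast

lemma lambda_op_add:
  assumes "f \<in> lattice" "f' \<in> lattice"
  shows "lambda_op G n (\<lambda>g. f g + f' g) g = (\<Sum>i\<le>n. lambda_op G i f g * lambda_op G (n - i) f' g)"
proof -
  have "lambda_op G n (f \<oplus>\<^bsub>char_ring G\<^esub> f')
      = (\<Oplus>\<^bsub>char_ring G\<^esub>i\<in>{..n}. lambda_op G i f \<otimes>\<^bsub>char_ring G\<^esub> lambda_op G (n - i) f')"
    using is_lambda_structure_lambda_op assms unfolding is_lambda_structure_def char_ring_carrier by blast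
  then show ?thesis
    using assms by (simp add: char_ring_simps char_ring_finsum lambda_op_closed lattice_mult)
qed

definition lambda_fps :: "('g \<Rightarrow> complex) \<Rightarrow> 'g \<Rightarrow> complex fps" where
  "lambda_fps f g = Abs_fps (\<lambda>n. lambda_op G n f g)"

definition gamma_fps :: "('g \<Rightarrow> complex) \<Rightarrow> 'g \<Rightarrow> complex fps" where
  "gamma_fps f g = lambda_fps f g oo shift_fps"

lemma lambda_fps_add:
  assumes "f \<in> lattice" "f' \<in> lattice"
  shows "lambda_fps (\<lambda>g. f g + f' g) g = lambda_fps f g * lambda_fps f' g"
  by (rule fps_ext) (simp add: lambda_fps_def lambda_op_add[OF assms] fps_mult_nth atLeast0AtMost)

lemma gamma_fps_add:
  assumes "f \<in> lattice" "f' \<in> lattice"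
  shows "gamma_fps (\<lambda>g. f g + f' g) g = gamma_fps f g * gamma_fps f' g"
  by (simp add: gamma_fps_def lambda_fps_add[OF assms] compose_shift_fps_mult)

lemma lambda_fps_character:
  assumes "is_rep G d \<rho>" "g \<in> carrier G"
  shows "lambda_fps (character G \<rho>) g = exterior_fps (\<rho> g)"
  by (rule fps_ext)
    (simp add: lambda_fps_def exterior_fps_def lambda_op_character[OF assms(1)] character_eq[OF assms(2)])

lemma lambda_fps_linear:
  assumes "\<zeta> \<in> {1, -1}" "\<eta> \<in> {1, -1}" "g \<in> carrier G"
  shows "lambda_fps (cf 1 1 \<zeta> \<eta> (\<zeta> * \<eta>)) g = 1 + fps_const (cf 1 1 \<zeta> \<eta> (\<zeta> * \<eta>) g) * fps_X"
  using lambda_fps_character[OF linear_rep_is_rep[OF assms(1,2)] assms(3)] assms(3)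
  by (simp only: character_linear_rep exterior_fps_linear_rep cf_def if_True)

lemma lambda_fps_D:
  assumes "g \<in> carrier G"
  shows "lambda_fps (cf 2 (-2) 0 0 0) g
    = 1 + fps_const (cf 2 (-2) 0 0 0 g) * fps_X + fps_const (cf 1 1 1 (- \<tau>) (- \<tau>) g) * fps_X\<^sup>2"
  using lambda_fps_character[OF D_rep assms] by (simp only: character_D exterior_fps_D[OF assms])

lemma lambda_fps_one:
  assumes "g \<in> carrier G"
  shows "lambda_fps (cf 1 1 1 1 1) g = 1 + fps_X"
  using lambda_fps_linear[of 1 1 g] assms by (simp add: cf_1)

lemma lambda_fps_nat:
  assumes "g \<in> carrier G"
  shows "lambda_fps (cf (int k) (int k) (int k) (int k) (int k)) g = (1 + fps_X) ^ k"
proof (induction k)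
  case 0
  \<comment> \<open>lambda_t(0) is idempotent and has constant term 1; there are no zero divisors
    among complex power series, so it is 1.\<close>
  have c: "lambda_fps (cf 0 0 0 0 0) g = lambda_fps (cf 0 0 0 0 0) g * lambda_fps (cf 0 0 0 0 0) g"
    using lambda_fps_add[OF const_in_lattice[of 0] const_in_lattice[of 0], of g] by (simp add: cf_add)
  have "fps_nth (lambda_fps (cf 0 0 0 0 0) g) 0 = 1"
    using assms by (simp add: lambda_fps_def lambda_op_0 const_in_lattice cf_1)
  then have "lambda_fps (cf 0 0 0 0 0) g \<noteq> 0" by auto
  then show ?case using c by simp
next
  case (Suc k)
  have "lambda_fps (cf (1 + int k) (1 + int k) (1 + int k) (1 + int k) (1 + int k)) g
      = lambda_fps (cf 1 1 1 1 1) g * lambda_fps (cf (int k) (int k) (int k) (int k) (int k)) g"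
    using lambda_fps_add[OF const_in_lattice[of 1] const_in_lattice[of "int k"], of g]
    by (simp only: cf_add)
  then show ?case by (simp add: lambda_fps_one[OF assms] Suc)
qed

lemma char_ring_int_one: "[(k::int)] \<cdot>\<^bsub>char_ring G\<^esub> \<one>\<^bsub>char_ring G\<^esub> = cf k k k k k"
proof -
  interpret cring "char_ring G" by (rule cring_char_ring)
  have nat: "[n] \<cdot>\<^bsub>char_ring G\<^esub> \<one>\<^bsub>char_ring G\<^esub> = cf (int n) (int n) (int n) (int n) (int n)" for n :: nat
  proof (induction n)
    case 0
    show ?case by (simp add: char_ring_simps cf_0)
  next
    case (Suc n)
    have "[Suc n] \<cdot>\<^bsub>char_ring G\<^esub> \<one>\<^bsub>char_ring G\<^esub>
        = [n] \<cdot>\<^bsub>char_ring G\<^esub> \<one>\<^bsub>char_ring G\<^esub> \<oplus>\<^bsub>char_ring G\<^esub> \<one>\<^bsub>char_ring G\<^esub>"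
      by (rule add.nat_pow_Suc)
    then show ?case unfolding Suc by (simp add: char_ring_simps cf_1[symmetric] cf_add add.commute)
  qed
  show ?thesis
  proof (cases k rule: int_cases2)
    case (nonneg n)
    have "[k] \<cdot>\<^bsub>char_ring G\<^esub> \<one>\<^bsub>char_ring G\<^esub> = [n] \<cdot>\<^bsub>char_ring G\<^esub> \<one>\<^bsub>char_ring G\<^esub>"
      unfolding nonneg add_pow_def by (rule int_pow_int)
    then show ?thesis unfolding nat nonneg .
  next
    case (nonpos n)
    have "[k] \<cdot>\<^bsub>char_ring G\<^esub> \<one>\<^bsub>char_ring G\<^esub>
        = \<ominus>\<^bsub>char_ring G\<^esub> ([n] \<cdot>\<^bsub>char_ring G\<^esub> \<one>\<^bsub>char_ring G\<^esub>)"
      unfolding nonpos by (rule add.int_pow_neg_int) simp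
    then show ?thesis
      unfolding nat nonpos by (simp add: char_ring_minus const_in_lattice cf_uminus)
  qed
qed

lemma gamma_op_eq:
  "gamma_op G n f
    = lambda_op G n (\<lambda>g. f g + cf (int n - 1) (int n - 1) (int n - 1) (int n - 1) (int n - 1) g)"
  by (simp only: gamma_op_def char_ring_int_one char_ring_simps(1))

lemma gamma_op_closed: "f \<in> lattice \<Longrightarrow> gamma_op G n f \<in> lattice"
  unfolding gamma_op_eq by (intro lambda_op_closed lattice_add const_in_lattice)

lemma gamma_op_0: "f \<in> lattice \<Longrightarrow> gamma_op G 0 f = cf 1 1 1 1 1"
  unfolding gamma_op_eq by (intro lambda_op_0 lattice_add const_in_lattice)

text \<open>lambda^n(f + n - 1) is coefficient n of lambda_t(f) (1 + t)^(n - 1), which is also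
  coefficient n of lambda_t(f) after substituting t / (1 - t). For n = 0 the added integer n - 1 is
  negative, so this case is separate.\<close>

lemma gamma_op_nth:
  assumes f: "f \<in> lattice" and g: "g \<in> carrier G"
  shows "gamma_op G n f g = fps_nth (gamma_fps f g) n"
proof (cases n)
  case 0
  then show ?thesis using f g by (simp add: gamma_op_0 gamma_fps_def lambda_fps_def lambda_op_0)
next
  case (Suc m)
  have "gamma_op G n f g = fps_nth (lambda_fps (\<lambda>g. f g + cf (int m) (int m) (int m) (int m) (int m) g) g) n"
    unfolding gamma_op_eq lambda_fps_def using Suc by simp
  also have "\<dots> = fps_nth (gamma_fps f g) n"
    unfolding lambda_fps_add[OF f const_in_lattice] lambda_fps_nat[OF g] gamma_fps_def Suc
    by (rule compose_shift_fps_nth[symmetric])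
  finally show ?thesis .
qed

lemma gamma_op_add:
  assumes "f \<in> lattice" "f' \<in> lattice"
  shows "gamma_op G n (\<lambda>g. f g + f' g) = (\<lambda>g. \<Sum>i\<le>n. gamma_op G i f g * gamma_op G (n - i) f' g)"
proof
  fix g show "gamma_op G n (\<lambda>g. f g + f' g) g = (\<Sum>i\<le>n. gamma_op G i f g * gamma_op G (n - i) f' g)"
  proof (cases "g \<in> carrier G")
    case True
    then show ?thesis
      using assms by (simp add: gamma_op_nth lattice_add gamma_fps_add fps_mult_nth atLeast0AtMost)
  next
    case False
    then show ?thesis
      using assms by (simp add: lattice_outside[OF gamma_op_closed] lattice_add)
  qed
qed

text \<open>This is gamma_t(1) = 1 / (1 - t) without an inverse. Below, subtracting 1 from an
  argument becomes multiplication of its gamma series by 1 - t.\<close>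

lemma gamma_fps_one:
  assumes "g \<in> carrier G"
  shows "gamma_fps (cf 1 1 1 1 1) g * (1 - fps_X) = 1"
proof -
  have "gamma_fps (cf 1 1 1 1 1) g = 1 + shift_fps"
    unfolding gamma_fps_def lambda_fps_one[OF assms] by (simp add: fps_compose_add_distrib shift_fps_nth)
  then have "gamma_fps (cf 1 1 1 1 1) g * (1 - fps_X) = 1 - fps_X + shift_fps * (1 - fps_X)"
    by (simp add: distrib_right)
  then show ?thesis by (simp only: shift_fps_mult) simp
qed

text \<open>Multiplying gamma_t(\<chi>) = 1 + \<chi> t / (1 - t) by 1 - t clears the denominator, so
  the series breaks off after degree 1.\<close>

lemma gamma_fps_linear:
  assumes "\<zeta> \<in> {1, -1}" "\<eta> \<in> {1, -1}" and g: "g \<in> carrier G"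
  shows "gamma_fps (cf 0 0 (\<zeta> - 1) (\<eta> - 1) (\<zeta> * \<eta> - 1)) g
    = 1 + fps_const (cf 0 0 (\<zeta> - 1) (\<eta> - 1) (\<zeta> * \<eta> - 1) g) * fps_X"
proof -
  let ?x = "cf 0 0 (\<zeta> - 1) (\<eta> - 1) (\<zeta> * \<eta> - 1)" and ?c = "cf 1 1 \<zeta> \<eta> (\<zeta> * \<eta>)"
  have "?x = (\<lambda>g. ?c g + cf (-1) (-1) (-1) (-1) (-1) g)" by (simp add: cf_add)
  then have x: "?x \<in> lattice"
    using lattice_add[OF linear_in_lattice[OF assms(1,2)] const_in_lattice[of "-1"]] by simp
  have "?c = (\<lambda>g. ?x g + cf 1 1 1 1 1 g)" by (simp add: cf_add)
  then have *: "gamma_fps ?c g = gamma_fps ?x g * gamma_fps (cf 1 1 1 1 1) g"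
    using gamma_fps_add[OF x const_in_lattice[of 1], of g] by simp
  have "gamma_fps ?x g = gamma_fps ?x g * (gamma_fps (cf 1 1 1 1 1) g * (1 - fps_X))"
    by (simp add: gamma_fps_one[OF g])
  also have "\<dots> = gamma_fps ?c g * (1 - fps_X)" unfolding * by (simp add: mult.assoc)
  also have "gamma_fps ?c g = 1 + fps_const (?c g) * shift_fps"
    unfolding gamma_fps_def lambda_fps_linear[OF assms]
    by (simp add: fps_compose_add_distrib shift_fps_nth compose_shift_fps_mult)
  also have "\<dots> * (1 - fps_X) = 1 - fps_X + fps_const (?c g) * (shift_fps * (1 - fps_X))"
    by (simp only: distrib_right mult_1_left mult.assoc)
  also have "\<dots> = 1 + (fps_const (?c g) - 1) * fps_X"
    unfolding shift_fps_mult by (simp add: left_diff_distrib)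
  also have "fps_const (?c g) - 1 = fps_const (?c g - 1)"
    by (simp only: fps_const_1_eq_1[symmetric] fps_const_sub)
  also have "?c g - 1 = ?x g"
    using g by (auto simp: cf_def elim!: cls_cases)
  finally show ?thesis .
qed

text \<open>With s = t / (1 - t), multiplying 1 + D s + (det D) s^2 by (1 - t)^2 clears the
  denominators. The coefficient of t^2 is 1 - D + det D.\<close>

lemma gamma_fps_D:
  assumes g: "g \<in> carrier G"
  shows "gamma_fps (cf 0 (-4) (-2) (-2) (-2)) g
    = 1 + fps_const (cf 0 (-4) (-2) (-2) (-2) g) * fps_X
      + fps_const (cf 0 4 2 (1 - \<tau>) (1 - \<tau>) g) * fps_X\<^sup>2"
proof -
  let ?x = "cf 0 (-4) (-2) (-2) (-2)" and ?c = "cf 2 (-2) 0 0 0" and ?d = "cf 1 1 1 (- \<tau>) (- \<tau>)"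
  let ?\<gamma> = "gamma_fps (cf 1 1 1 1 1) g"
  \<comment> \<open>Pairs each power of s with as many factors 1 - t, so that
    \<open>shift_fps_mult\<close> can cancel them.\<close>
  have ring: "(1 + a * s + b * (s * s)) * (u * u) = u * u + a * (s * u) * u + b * ((s * u) * (s * u))"
    for a b s u :: "complex fps"
    by (simp add: algebra_simps)
  have "?x = (\<lambda>g. ?c g + cf (-2) (-2) (-2) (-2) (-2) g)" by (simp add: cf_add)
  then have x: "?x \<in> lattice"
    using lattice_add[OF D_in_lattice const_in_lattice[of "-2"]] by simp
  have 2: "gamma_fps (cf 2 2 2 2 2) g = ?\<gamma> * ?\<gamma>"
    using gamma_fps_add[OF const_in_lattice[of 1] const_in_lattice[of 1], of g] by (simp add: cf_add)
  have "?c = (\<lambda>g. ?x g + cf 2 2 2 2 2 g)" by (simp add: cf_add)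
  then have *: "gamma_fps ?c g = gamma_fps ?x g * (?\<gamma> * ?\<gamma>)"
    using gamma_fps_add[OF x const_in_lattice[of 2], of g] 2 by simp
  have "gamma_fps ?x g = gamma_fps ?x g * ((?\<gamma> * (1 - fps_X)) * (?\<gamma> * (1 - fps_X)))"
    by (simp add: gamma_fps_one[OF g])
  also have "\<dots> = gamma_fps ?c g * ((1 - fps_X) * (1 - fps_X))" unfolding * by (simp only: ac_simps)
  also have "gamma_fps ?c g = 1 + fps_const (?c g) * shift_fps + fps_const (?d g) * (shift_fps * shift_fps)"
    unfolding gamma_fps_def lambda_fps_D[OF g] power2_eq_square
    by (simp add: fps_compose_add_distrib shift_fps_nth compose_shift_fps_mult)
  also have "\<dots> * ((1 - fps_X) * (1 - fps_X)) = (1 - fps_X) * (1 - fps_X)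
      + fps_const (?c g) * (shift_fps * (1 - fps_X)) * (1 - fps_X)
      + fps_const (?d g) * ((shift_fps * (1 - fps_X)) * (shift_fps * (1 - fps_X)))"
    by (rule ring)
  also have "\<dots> = 1 + (fps_const (?c g) - 2) * fps_X + (1 - fps_const (?c g) + fps_const (?d g)) * fps_X\<^sup>2"
    unfolding shift_fps_mult by (simp add: algebra_simps power2_eq_square)
  also have "fps_const (?c g) - 2 = fps_const (?c g - 2)"
    by (simp only: numeral_fps_const fps_const_sub)
  also have "1 - fps_const (?c g) + fps_const (?d g) = fps_const (1 - ?c g + ?d g)"
    by (simp only: fps_const_1_eq_1[symmetric] fps_const_sub fps_const_add)
  also have "?c g - 2 = ?x g"
    using g by (auto simp: cf_def elim!: cls_cases)
  also have "1 - ?c g + ?d g = cf 0 4 2 (1 - \<tau>) (1 - \<tau>) g"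
    using g by (auto simp: cf_def elim!: cls_cases)
  finally show ?thesis .
qed

end

section \<open>The gamma filtration\<close>

definition eval_monomial :: "(indet \<Rightarrow>\<^sub>0 nat) \<Rightarrow> int \<Rightarrow> int \<Rightarrow> int \<Rightarrow> int" where
  "eval_monomial m a b c =
    a ^ Poly_Mapping.lookup m V1 * b ^ Poly_Mapping.lookup m V2 * c ^ Poly_Mapping.lookup m V3"

text \<open>A homomorphism from polynomials to class functions amounts to five such evaluations, one
  for each conjugacy class. This keeps all later computations in the integers.\<close>

definition eval_poly3 :: "poly3 \<Rightarrow> int \<Rightarrow> int \<Rightarrow> int \<Rightarrow> int" where
  "eval_poly3 p a b c = (\<Sum>m\<in>Poly_Mapping.keys p. Poly_Mapping.lookup p m * eval_monomial m a b c)"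

lemma eval_monomial_add: "eval_monomial (m + m') a b c = eval_monomial m a b c * eval_monomial m' a b c"
  by (simp add: eval_monomial_def lookup_add power_add)

lemma eval_poly3_superset:
  assumes "finite A" "Poly_Mapping.keys p \<subseteq> A"
  shows "eval_poly3 p a b c = (\<Sum>m\<in>A. Poly_Mapping.lookup p m * eval_monomial m a b c)"
  unfolding eval_poly3_def by (rule sum.mono_neutral_left) (use assms in \<open>auto simp: in_keys_iff\<close>)

lemma eval_poly3_0 [simp]: "eval_poly3 0 a b c = 0"
  by (simp add: eval_poly3_def)

lemma eval_poly3_add [simp]: "eval_poly3 (p + q) a b c = eval_poly3 p a b c + eval_poly3 q a b c"
proof -
  let ?A = "Poly_Mapping.keys p \<union> Poly_Mapping.keys q"
  have "eval_poly3 (p + q) a b c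
      = (\<Sum>m\<in>?A. Poly_Mapping.lookup (p + q) m * eval_monomial m a b c)"
    by (rule eval_poly3_superset) (use keys_add[of p q] in auto)
  also have "\<dots> = eval_poly3 p a b c + eval_poly3 q a b c"
    by (simp add: eval_poly3_superset[of ?A] lookup_add algebra_simps sum.distrib)
  finally show ?thesis .
qed

lemma eval_poly3_sum: "eval_poly3 (\<Sum>i\<in>A. f i) a b c = (\<Sum>i\<in>A. eval_poly3 (f i) a b c)"
  by (induction A rule: infinite_finite_induct) simp_all

lemma eval_poly3_single: "eval_poly3 (Poly_Mapping.single m k) a b c = k * eval_monomial m a b c"
  by (subst eval_poly3_superset[of "{m}"]) auto

lemma poly3_sum_single:
  fixes p :: poly3
  shows "(\<Sum>m\<in>Poly_Mapping.keys p. Poly_Mapping.single m (Poly_Mapping.lookup p m)) = p"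
proof (rule poly_mapping_eqI)
  fix k
  show "Poly_Mapping.lookup (\<Sum>m\<in>Poly_Mapping.keys p. Poly_Mapping.single m (Poly_Mapping.lookup p m)) k
      = Poly_Mapping.lookup p k"
    by (auto simp: lookup_sum lookup_single when_def sum.delta in_keys_iff)
qed

lemma eval_poly3_mult [simp]: "eval_poly3 (p * q) a b c = eval_poly3 p a b c * eval_poly3 q a b c"
proof -
  let ?s = "\<lambda>p m. Poly_Mapping.single m (Poly_Mapping.lookup p m)"
  have "p * q = (\<Sum>m\<in>Poly_Mapping.keys p. \<Sum>m'\<in>Poly_Mapping.keys q. ?s p m * ?s q m')"
    using sum_product[of "?s p" "Poly_Mapping.keys p" "?s q" "Poly_Mapping.keys q"]
    unfolding poly3_sum_single .
  then have "eval_poly3 (p * q) a b c = (\<Sum>m\<in>Poly_Mapping.keys p. \<Sum>m'\<in>Poly_Mapping.keys q.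
      (Poly_Mapping.lookup p m * eval_monomial m a b c) * (Poly_Mapping.lookup q m' * eval_monomial m' a b c))"
    by (simp add: eval_poly3_sum mult_single eval_poly3_single eval_monomial_add algebra_simps)
  then show ?thesis unfolding eval_poly3_def sum_product .
qed

lemma eval_poly3_of_int [simp]: "eval_poly3 (of_int k) a b c = k"
  by (simp add: eval_poly3_single eval_monomial_def single_of_int[symmetric] del: single_of_int)

lemma eval_poly3_1 [simp]: "eval_poly3 1 a b c = 1"
  using eval_poly3_of_int[of 1] by simp

lemma eval_poly3_numeral [simp]: "eval_poly3 (numeral k) a b c = numeral k"
  using eval_poly3_of_int[of "numeral k"] by simp

lemma eval_poly3_uminus [simp]: "eval_poly3 (- p) a b c = - eval_poly3 p a b c"
  using eval_poly3_add[of p "- p" a b c] by simp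

lemma eval_poly3_diff [simp]: "eval_poly3 (p - q) a b c = eval_poly3 p a b c - eval_poly3 q a b c"
  using eval_poly3_add[of p "- q" a b c] by simp

lemma eval_poly3_power [simp]: "eval_poly3 (p ^ n) a b c = eval_poly3 p a b c ^ n"
  by (induction n) simp_all

lemma eval_poly3_var [simp]:
  "eval_poly3 (var V1) a b c = a" "eval_poly3 (var V2) a b c = b" "eval_poly3 (var V3) a b c = c"
  by (simp_all add: var_def eval_poly3_single eval_monomial_def lookup_single)

text \<open>The nesting and the final factor 1 let a monomial be built by multiplying powers of
  variables onto 1, as \<open>ev_var_power_mult\<close> requires.\<close>

lemma single_eq_var_powers:
  "Poly_Mapping.single m k = of_int k * (var V1 ^ Poly_Mapping.lookup m V1 *
    (var V2 ^ Poly_Mapping.lookup m V2 * (var V3 ^ Poly_Mapping.lookup m V3 * 1)))"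
proof -
  have pow: "var v ^ n = Poly_Mapping.single (Poly_Mapping.single v n) 1" for v n
    by (induction n) (simp_all add: var_def mult_single single_add[symmetric])
  have "m = Poly_Mapping.single V1 (Poly_Mapping.lookup m V1) +
      (Poly_Mapping.single V2 (Poly_Mapping.lookup m V2) + Poly_Mapping.single V3 (Poly_Mapping.lookup m V3))"
  proof (rule poly_mapping_eqI)
    fix v show "Poly_Mapping.lookup m v = Poly_Mapping.lookup (Poly_Mapping.single V1 (Poly_Mapping.lookup m V1) +
      (Poly_Mapping.single V2 (Poly_Mapping.lookup m V2) + Poly_Mapping.single V3 (Poly_Mapping.lookup m V3))) v"
      by (cases v) (simp_all add: lookup_add lookup_single)
  qed
  then have "Poly_Mapping.single m k = Poly_Mapping.single 0 k * Poly_Mapping.single (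
      Poly_Mapping.single V1 (Poly_Mapping.lookup m V1) +
      (Poly_Mapping.single V2 (Poly_Mapping.lookup m V2) + Poly_Mapping.single V3 (Poly_Mapping.lookup m V3))) 1"
    by (simp add: mult_single)
  then show ?thesis by (simp add: pow mult_single single_of_int[symmetric] del: single_of_int)
qed

definition degree_ge :: "nat \<Rightarrow> poly3 \<Rightarrow> bool" where
  "degree_ge n p \<longleftrightarrow> (\<forall>m\<in>Poly_Mapping.keys p. n \<le> monomial_degree m)"

lemma degree_ge_add: "degree_ge n p \<Longrightarrow> degree_ge n q \<Longrightarrow> degree_ge n (p + q)"
  using keys_add[of p q] by (auto simp: degree_ge_def)

lemma homogeneous_degree_ge: "homogeneous k p \<Longrightarrow> n \<le> k \<Longrightarrow> degree_ge n p"
  by (simp add: degree_ge_def homogeneous_def)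

lemma degree_ge_minus_homogeneous_part:
  assumes "degree_ge n p"
  shows "degree_ge (Suc n) (p - homogeneous_part n p)"
  unfolding degree_ge_def
proof
  fix m assume "m \<in> Poly_Mapping.keys (p - homogeneous_part n p)"
  then have "m \<in> Poly_Mapping.keys p" "monomial_degree m \<noteq> n"
    by (auto simp: in_keys_iff lookup_minus lookup_homogeneous_part)
  then show "Suc n \<le> monomial_degree m"
    using assms by (fastforce simp: degree_ge_def)
qed

section \<open>Products of gamma operations on the augmentation ideal\<close>

context order8
begin

lemma cf_outside: "g \<notin> carrier G \<Longrightarrow> cf a b c d e g = 0"
  by (simp add: cf_def)

definition aug_ideal :: "('g \<Rightarrow> complex) set" where
  "aug_ideal = augmentation_ideal G"

lemma aug_ideal_eq: "aug_ideal = {f \<in> lattice. f \<one> = 0}"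
  by (simp add: aug_ideal_def augmentation_ideal_def augmentation_def char_ring_carrier)

lemma linear_minus_one_in_aug_ideal:
  assumes "\<zeta> \<in> {1, -1}" "\<eta> \<in> {1, -1}"
  shows "cf 0 0 (\<zeta> - 1) (\<eta> - 1) (\<zeta> * \<eta> - 1) \<in> aug_ideal"
  using lattice_add[OF linear_in_lattice[OF assms] const_in_lattice[of "-1"]]
  by (simp add: aug_ideal_eq cf_add cf_one)

lemma D_minus_two_in_aug_ideal: "cf 0 (-4) (-2) (-2) (-2) \<in> aug_ideal"
  using lattice_add[OF D_in_lattice const_in_lattice[of "-2"]] by (simp add: aug_ideal_eq cf_add cf_one)

lemma aug_ideal_lattice: "f \<in> aug_ideal \<Longrightarrow> f \<in> lattice"
  by (simp add: aug_ideal_eq)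

lemma gamma_op_linear:
  assumes "\<zeta> \<in> {1, -1}" "\<eta> \<in> {1, -1}"
  shows "gamma_op G n (cf 0 0 (\<zeta> - 1) (\<eta> - 1) (\<zeta> * \<eta> - 1)) =
    (if n = 0 then cf 1 1 1 1 1
     else if n = 1 then cf 0 0 (\<zeta> - 1) (\<eta> - 1) (\<zeta> * \<eta> - 1) else (\<lambda>g. 0))" (is "gamma_op G n ?f = ?h")
proof
  note f = aug_ideal_lattice[OF linear_minus_one_in_aug_ideal[OF assms]]
  fix g show "gamma_op G n ?f g = ?h g"
  proof (cases "g \<in> carrier G")
    case True
    then show ?thesis unfolding gamma_op_nth[OF f True] gamma_fps_linear[OF assms True]
      by (auto simp: cf_1)
  next
    case False
    show ?thesis
      unfolding lattice_outside[OF gamma_op_closed[OF f] False] using False by (simp add: cf_outside)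
  qed
qed

lemma gamma_op_D:
  "gamma_op G n (cf 0 (-4) (-2) (-2) (-2)) =
    (if n = 0 then cf 1 1 1 1 1 else if n = 1 then cf 0 (-4) (-2) (-2) (-2)
     else if n = 2 then cf 0 4 2 (1 - \<tau>) (1 - \<tau>) else (\<lambda>g. 0))" (is "gamma_op G n ?f = ?h")
proof
  note f = aug_ideal_lattice[OF D_minus_two_in_aug_ideal]
  fix g show "gamma_op G n ?f g = ?h g"
  proof (cases "g \<in> carrier G")
    case True
    then show ?thesis unfolding gamma_op_nth[OF f True] gamma_fps_D[OF True]
      by (auto simp: cf_1 fps_X_power_iff)
  next
    case False
    show ?thesis
      unfolding lattice_outside[OF gamma_op_closed[OF f] False] using False by (simp add: cf_outside)
  qed
qed

lemma gamma_op_zero: "gamma_op G n (\<lambda>g. 0) = (if n = 0 then cf 1 1 1 1 1 else (\<lambda>g. 0))"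
  using gamma_op_linear[of 1 1 n] by (auto simp: cf_0)

definition gamma_products :: "nat \<Rightarrow> ('g \<Rightarrow> complex) set" where
  "gamma_products n = {(\<Otimes>\<^bsub>char_ring G\<^esub>j\<in>{..<k}. gamma_op G (i j) (x j)) | (k::nat) i x.
      (\<forall>j<k. x j \<in> aug_ideal) \<and> n \<le> (\<Sum>j<k. i j)}"

lemma gamma_filtration_eq: "gamma_filtration G n = generate (add_monoid (char_ring G)) (gamma_products n)"
  by (simp add: gamma_filtration_def gamma_products_def aug_ideal_def)

lemma gamma_finprod_Suc:
  assumes "\<And>j. j < Suc k \<Longrightarrow> x j \<in> aug_ideal"
  shows "(\<Otimes>\<^bsub>char_ring G\<^esub>j\<in>{..<Suc k}. gamma_op G (i j) (x j))
    = (\<lambda>g. gamma_op G (i k) (x k) g * (\<Otimes>\<^bsub>char_ring G\<^esub>j\<in>{..<k}. gamma_op G (i j) (x j)) g)"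
proof -
  interpret cring "char_ring G" by (rule cring_char_ring)
  have c: "gamma_op G (i j) (x j) \<in> carrier (char_ring G)" if "j < Suc k" for j
    using assms[OF that] gamma_op_closed aug_ideal_lattice by (simp add: char_ring_carrier)
  have "(\<Otimes>\<^bsub>char_ring G\<^esub>j\<in>insert k {..<k}. gamma_op G (i j) (x j))
    = gamma_op G (i k) (x k) \<otimes>\<^bsub>char_ring G\<^esub> (\<Otimes>\<^bsub>char_ring G\<^esub>j\<in>{..<k}. gamma_op G (i j) (x j))"
    by (rule finprod_insert) (use c in auto)
  then show ?thesis by (simp add: char_ring_simps lessThan_Suc)
qed

lemma one_in_gamma_products: "cf 1 1 1 1 1 \<in> gamma_products 0"
proof -
  interpret cring "char_ring G" by (rule cring_char_ring)
  have "(\<Otimes>\<^bsub>char_ring G\<^esub>j\<in>{..<0::nat}. gamma_op G (i j) (x j)) = cf 1 1 1 1 1" for i x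
    by (simp add: char_ring_simps cf_1)
  then show ?thesis unfolding gamma_products_def by (auto intro!: exI[of _ "0::nat"])
qed

lemma gamma_products_mono: "n \<le> m \<Longrightarrow> gamma_products m \<subseteq> gamma_products n"
  unfolding gamma_products_def by (auto intro: order_trans)

text \<open>The new factor is placed at index k, just beyond those already present, by updating both
  families.\<close>

lemma gamma_products_mult:
  assumes f: "f \<in> aug_ideal" and p: "p \<in> gamma_products n"
  shows "(\<lambda>g. gamma_op G l f g * p g) \<in> gamma_products (l + n)"
proof -
  interpret cring "char_ring G" by (rule cring_char_ring)
  obtain k :: nat and i x where p_eq: "p = (\<Otimes>\<^bsub>char_ring G\<^esub>j\<in>{..<k}. gamma_op G (i j) (x j))"
    and x: "\<forall>j<k. x j \<in> aug_ideal" and n: "n \<le> (\<Sum>j<k. i j)"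
    using p unfolding gamma_products_def by blast
  let ?i = "i(k := l)" and ?x = "x(k := f)"
  have x': "\<forall>j<Suc k. ?x j \<in> aug_ideal" using x f by (auto simp: less_Suc_eq)
  have "(\<Otimes>\<^bsub>char_ring G\<^esub>j\<in>{..<k}. gamma_op G (?i j) (?x j)) = p"
    unfolding p_eq
    by (rule finprod_cong') (use x gamma_op_closed aug_ideal_lattice in \<open>auto simp: char_ring_carrier\<close>)
  then have "(\<Otimes>\<^bsub>char_ring G\<^esub>j\<in>{..<Suc k}. gamma_op G (?i j) (?x j)) = (\<lambda>g. gamma_op G l f g * p g)"
    using gamma_finprod_Suc[of k ?x ?i] x' by simp
  moreover have "l + n \<le> (\<Sum>j<Suc k. ?i j)" using n by simp
  ultimately show ?thesis
    using x' unfolding gamma_products_def by (intro CollectI exI[of _ "Suc k"] exI[of _ ?i] exI[of _ ?x]) simp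
qed

lemma gamma_products_lattice: "gamma_products n \<subseteq> lattice"
proof
  interpret cring "char_ring G" by (rule cring_char_ring)
  fix p assume "p \<in> gamma_products n"
  then obtain k :: nat and i x where p: "p = (\<Otimes>\<^bsub>char_ring G\<^esub>j\<in>{..<k}. gamma_op G (i j) (x j))"
    and x: "\<forall>j<k. x j \<in> aug_ideal"
    unfolding gamma_products_def by blast
  have "p \<in> carrier (char_ring G)"
    unfolding p by (rule finprod_closed) (use x gamma_op_closed aug_ideal_lattice in \<open>auto simp: char_ring_carrier\<close>)
  then show "p \<in> lattice" by (simp add: char_ring_carrier)
qed

lemma gamma_filtration_subgroup: "subgroup (gamma_filtration G n) (add_monoid (char_ring G))"
proof -
  interpret cring "char_ring G" by (rule cring_char_ring)
  show ?thesis
    unfolding gamma_filtration_eq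
    by (rule group.generate_is_subgroup[OF a_group]) (use gamma_products_lattice in \<open>simp add: char_ring_carrier\<close>)
qed

lemma gamma_products_filtration: "gamma_products n \<subseteq> gamma_filtration G n"
  unfolding gamma_filtration_eq by (auto intro: generate.incl)

lemma gamma_filtration_lattice: "gamma_filtration G n \<subseteq> lattice"
  using subgroup.subset[OF gamma_filtration_subgroup] by (simp add: char_ring_carrier)

lemma gamma_filtration_add:
  "f \<in> gamma_filtration G n \<Longrightarrow> f' \<in> gamma_filtration G n \<Longrightarrow> (\<lambda>g. f g + f' g) \<in> gamma_filtration G n"
  using subgroup.m_closed[OF gamma_filtration_subgroup, of f n f'] by (simp add: char_ring_simps(1))

lemma gamma_filtration_zero: "(\<lambda>g. 0) \<in> gamma_filtration G n"
  using subgroup.one_closed[OF gamma_filtration_subgroup, of n] by (simp add: char_ring_simps(3))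

lemma gamma_filtration_uminus:
  assumes f: "f \<in> gamma_filtration G n"
  shows "(\<lambda>g. - f g) \<in> gamma_filtration G n"
proof -
  have "\<ominus>\<^bsub>char_ring G\<^esub> f \<in> gamma_filtration G n"
    using subgroup.m_inv_closed[OF gamma_filtration_subgroup f] by (simp add: a_inv_def)
  moreover have "f \<in> lattice" using f gamma_filtration_lattice by blast
  ultimately show ?thesis by (simp only: char_ring_minus)
qed

lemma of_int_mult_closed:
  assumes f: "f \<in> A" and zero: "(\<lambda>g. 0) \<in> A"
    and add: "\<And>f f'. f \<in> A \<Longrightarrow> f' \<in> A \<Longrightarrow> (\<lambda>g. f g + f' g) \<in> A"
    and uminus: "\<And>f. f \<in> A \<Longrightarrow> (\<lambda>g. - f g) \<in> A"
  shows "(\<lambda>g. of_int n * f g :: complex) \<in> A"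
proof -
  have nat: "(\<lambda>g. of_nat k * f g) \<in> A" for k :: nat
  proof (induction k)
    case (Suc k)
    then show ?case using add[OF f Suc] by (simp add: algebra_simps)
  qed (simp add: zero)
  show ?thesis
  proof (cases n rule: int_cases2)
    case (nonneg k)
    then show ?thesis using nat[of k] by simp
  next
    case (nonpos k)
    then show ?thesis using uminus[OF nat[of k]] by simp
  qed
qed

end

text \<open>\<open>M n\<close> is a candidate for the value vectors of \<open>\<Gamma>\<^sup>n\<close>. The first two variables are sent to
  \<open>\<chi> - 1\<close> for linear characters \<open>\<chi>\<close>, and the third one to \<open>\<gamma>\<^sup>2(D - 2)\<close>, whose values are
  \<open>0, 4, 2, 1 - \<tau>, 1 - \<tau>\<close>.\<close>

locale gamma_presentation = order8 G r s cls \<tau> D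
  for G :: "('g, 'm) monoid_scheme" (structure) and r s cls \<tau> D +
  fixes M :: "nat \<Rightarrow> int \<Rightarrow> int \<Rightarrow> int \<Rightarrow> int \<Rightarrow> int \<Rightarrow> bool"
    and xs ys :: "nat \<Rightarrow> int" and S :: "poly3 set"
  assumes M_0: "in_lattice a b c d e \<Longrightarrow> M 0 a b c d e"
    and M_lattice: "M n a b c d e \<Longrightarrow> in_lattice a b c d e"
    and M_add: "M n a b c d e \<Longrightarrow> M n a' b' c' d' e' \<Longrightarrow> M n (a + a') (b + b') (c + c') (d + d') (e + e')"
    and M_mult: "M m a b c d e \<Longrightarrow> M n a' b' c' d' e' \<Longrightarrow>
      M (m + n) (a * a') (b * b') (c * c') (d * d') (e * e')"
    and M_Suc: "M (Suc n) a b c d e \<Longrightarrow> M n a b c d e"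
    and M_zero: "M n 0 0 0 0 0"
    and M_linear: "M 1 0 0 0 (-2) (-2)" "M 1 0 0 (-2) 0 (-2)" "M 1 0 0 (-2) (-2) 0"
    and M_D: "M 1 0 (-4) (-2) (-2) (-2)" "M 2 0 4 2 (1 - \<tau>) (1 - \<tau>)"
    and xs: "\<exists>\<zeta>\<in>{1, -1}. \<exists>\<eta>\<in>{1, -1}. xs = (\<lambda>k. [0, 0, \<zeta> - 1, \<eta> - 1, \<zeta> * \<eta> - 1] ! k)"
    and ys: "\<exists>\<zeta>\<in>{1, -1}. \<exists>\<eta>\<in>{1, -1}. ys = (\<lambda>k. [0, 0, \<zeta> - 1, \<eta> - 1, \<zeta> * \<eta> - 1] ! k)"
    and M_span: "M n a b c d e \<Longrightarrow> \<exists>p. degree_ge n p \<and>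
      a = eval_poly3 p (xs 0) (ys 0) 0 \<and> b = eval_poly3 p (xs 1) (ys 1) 4 \<and>
      c = eval_poly3 p (xs 2) (ys 2) 2 \<and> d = eval_poly3 p (xs 3) (ys 3) (1 - \<tau>) \<and>
      e = eval_poly3 p (xs 4) (ys 4) (1 - \<tau>)"
    and rel: "s' \<in> S \<Longrightarrow> \<exists>n. homogeneous n s' \<and>
      M (Suc n) (eval_poly3 s' (xs 0) (ys 0) 0) (eval_poly3 s' (xs 1) (ys 1) 4)
        (eval_poly3 s' (xs 2) (ys 2) 2) (eval_poly3 s' (xs 3) (ys 3) (1 - \<tau>))
        (eval_poly3 s' (xs 4) (ys 4) (1 - \<tau>))"
    and normal_form: "homogeneous n p \<Longrightarrow> \<exists>q. homogeneous n q \<and> p - q \<in> genideal poly3_ring S \<and>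
      (M (Suc n) (eval_poly3 q (xs 0) (ys 0) 0) (eval_poly3 q (xs 1) (ys 1) 4)
        (eval_poly3 q (xs 2) (ys 2) 2) (eval_poly3 q (xs 3) (ys 3) (1 - \<tau>))
        (eval_poly3 q (xs 4) (ys 4) (1 - \<tau>)) \<longrightarrow> q \<in> genideal poly3_ring S)"
begin

section \<open>Upper bound for the gamma filtration\<close>

definition level_set :: "nat \<Rightarrow> ('g \<Rightarrow> complex) set" where
  "level_set n = {cf a b c d e | a b c d e. M n a b c d e}"

lemma cf_in_level_set_iff: "cf a b c d e \<in> level_set n \<longleftrightarrow> M n a b c d e"
  unfolding level_set_def by (auto simp: cf_eq_iff)

lemma level_set_E:
  assumes "f \<in> level_set n"
  obtains a b c d e where "f = cf a b c d e" "M n a b c d e"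
  using assms unfolding level_set_def by blast

lemma level_set_lattice: "level_set n \<subseteq> lattice"
  by (auto elim!: level_set_E simp: cf_in_lattice_iff intro: M_lattice)

lemma level_set_0: "level_set 0 = lattice"
  using level_set_lattice by (auto elim!: latticeE simp: cf_in_level_set_iff intro: M_0)

lemma level_set_add: "f \<in> level_set n \<Longrightarrow> f' \<in> level_set n \<Longrightarrow> (\<lambda>g. f g + f' g) \<in> level_set n"
  by (elim level_set_E) (simp add: cf_add cf_in_level_set_iff M_add)

lemma level_set_uminus: "f \<in> level_set n \<Longrightarrow> (\<lambda>g. - f g) \<in> level_set n"
  by (elim level_set_E) (use M_mult[OF M_0[OF in_lattice_const[of "-1"]]] in \<open>fastforce simp: cf_uminus cf_in_level_set_iff\<close>)

lemma level_set_mult: "f \<in> level_set m \<Longrightarrow> f' \<in> level_set n \<Longrightarrow> (\<lambda>g. f g * f' g) \<in> level_set (m + n)"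
  by (elim level_set_E) (simp add: cf_mult cf_in_level_set_iff M_mult)

lemma level_set_zero: "(\<lambda>g. 0) \<in> level_set n"
  unfolding cf_0[symmetric] cf_in_level_set_iff by (rule M_zero)

lemma level_set_one: "cf 1 1 1 1 1 \<in> level_set 0"
  unfolding level_set_0 by (rule const_in_lattice)

lemma M_one: "M 0 1 1 1 1 1"
  by (rule M_0[OF in_lattice_const])

lemma level_set_sum: "(\<And>i. i \<in> A \<Longrightarrow> f i \<in> level_set n) \<Longrightarrow> (\<lambda>g. \<Sum>i\<in>A. f i g) \<in> level_set n"
  by (induction A rule: infinite_finite_induct) (simp_all add: level_set_zero level_set_add)

lemma level_set_antimono: "n \<le> m \<Longrightarrow> level_set m \<subseteq> level_set n"
proof (induction rule: dec_induct)
  case (step m)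
  have "level_set (Suc m) \<subseteq> level_set m" by (auto elim!: level_set_E simp: cf_in_level_set_iff intro: M_Suc)
  then show ?case using step by blast
qed simp

text \<open>As \<open>\<gamma>\<^sub>t\<close> is multiplicative, this set is a subgroup.\<close>

definition gamma_bounded :: "('g \<Rightarrow> complex) set" where
  "gamma_bounded = {f \<in> lattice. \<forall>n. gamma_op G n f \<in> level_set n}"

lemma gamma_bounded_zero: "(\<lambda>g. 0) \<in> gamma_bounded"
  by (simp add: gamma_bounded_def gamma_op_zero lattice_0 level_set_one level_set_zero)

lemma gamma_bounded_add:
  assumes "f \<in> gamma_bounded" "f' \<in> gamma_bounded"
  shows "(\<lambda>g. f g + f' g) \<in> gamma_bounded"
proof -
  have f: "f \<in> lattice" "f' \<in> lattice" using assms by (auto simp: gamma_bounded_def)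
  have "(\<lambda>g. \<Sum>i\<le>n. gamma_op G i f g * gamma_op G (n - i) f' g) \<in> level_set n" for n
  proof (rule level_set_sum)
    fix i assume "i \<in> {..n}"
    then show "(\<lambda>g. gamma_op G i f g * gamma_op G (n - i) f' g) \<in> level_set n"
      using level_set_mult[of "gamma_op G i f" i "gamma_op G (n - i) f'" "n - i"] assms
      by (simp add: gamma_bounded_def)
  qed
  then show ?thesis by (simp add: gamma_bounded_def gamma_op_add f lattice_add)
qed

text \<open>The identity gamma_t(f) gamma_t(- f) = gamma_t(0) determines gamma^n(- f) recursively
  from products of total weight n, and the level sets are compatible with products.\<close>

lemma gamma_bounded_uminus:
  assumes "f \<in> gamma_bounded"
  shows "(\<lambda>g. - f g) \<in> gamma_bounded"
proof -
  have f: "f \<in> lattice" and fM: "\<And>n. gamma_op G n f \<in> level_set n" using assms by (auto simp: gamma_bounded_def)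
  let ?f = "\<lambda>g. - f g"
  have f': "?f \<in> lattice" by (rule lattice_uminus[OF f])
  have "gamma_op G n ?f \<in> level_set n" for n
  proof (induction n rule: less_induct)
    case (less n)
    have "gamma_op G n ?f g = gamma_op G n (\<lambda>g. 0) g
        + - (\<Sum>i\<in>{1..n}. gamma_op G i f g * gamma_op G (n - i) ?f g)" for g
    proof -
      have "gamma_op G n (\<lambda>g. 0) g = (\<Sum>i\<le>n. gamma_op G i f g * gamma_op G (n - i) ?f g)"
        using fun_cong[OF gamma_op_add[OF f f', of n], of g] by simp
      also have "{..n} = insert 0 {1..n}" by auto
      also have "(\<Sum>i\<in>insert 0 {1..n}. gamma_op G i f g * gamma_op G (n - i) ?f g)
        = gamma_op G 0 f g * gamma_op G n ?f g + (\<Sum>i\<in>{1..n}. gamma_op G i f g * gamma_op G (n - i) ?f g)"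
        by simp
      also have "gamma_op G 0 f g * gamma_op G n ?f g = gamma_op G n ?f g"
        using lattice_outside[OF gamma_op_closed[OF f']] by (simp add: gamma_op_0[OF f] cf_1)
      finally show ?thesis by simp
    qed
    then have "gamma_op G n ?f = (\<lambda>g. gamma_op G n (\<lambda>g. 0) g
        + - (\<Sum>i\<in>{1..n}. gamma_op G i f g * gamma_op G (n - i) ?f g))"
      by (rule ext)
    also have "\<dots> \<in> level_set n"
    proof (intro level_set_add level_set_uminus level_set_sum)
      show "gamma_op G n (\<lambda>g. 0) \<in> level_set n" by (simp add: gamma_op_zero level_set_one level_set_zero)
      fix i assume i: "i \<in> {1..n}"
      then have "gamma_op G (n - i) ?f \<in> level_set (n - i)" by (intro less) auto
      then show "(\<lambda>g. gamma_op G i f g * gamma_op G (n - i) ?f g) \<in> level_set n"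
        using level_set_mult[OF fM[of i], of "gamma_op G (n - i) ?f" "n - i"] i by simp
    qed
    finally show ?case .
  qed
  then show ?thesis using f' by (simp add: gamma_bounded_def)
qed

text \<open>The augmentation ideal is spanned by D - 2 and the elements \<chi> - 1 for the three
  nontrivial linear \<chi>. Their gamma series are explicit polynomials, so \<open>M_linear\<close>
  and \<open>M_D\<close> suffice.\<close>

lemma aug_ideal_gamma_bounded: "aug_ideal \<subseteq> gamma_bounded"
proof
  have linear: "cf 0 0 (\<zeta> - 1) (\<eta> - 1) (\<zeta> * \<eta> - 1) \<in> gamma_bounded"
    if "\<zeta> \<in> {1, -1}" "\<eta> \<in> {1, -1}" "M 1 0 0 (\<zeta> - 1) (\<eta> - 1) (\<zeta> * \<eta> - 1)" for \<zeta> \<eta>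
    using that(3) aug_ideal_lattice[OF linear_minus_one_in_aug_ideal[OF that(1,2)]]
    by (simp add: gamma_bounded_def gamma_op_linear[OF that(1,2)] M_one level_set_zero cf_in_level_set_iff)
  have A: "cf 0 0 0 (-2) (-2) \<in> gamma_bounded" using linear[of 1 "-1"] M_linear(1) by simp
  have B: "cf 0 0 (-2) 0 (-2) \<in> gamma_bounded" using linear[of "-1" 1] M_linear(2) by simp
  have C: "cf 0 0 (-2) (-2) 0 \<in> gamma_bounded" using linear[of "-1" "-1"] M_linear(3) by simp
  have D': "cf 0 (-4) (-2) (-2) (-2) \<in> gamma_bounded"
    using aug_ideal_lattice[OF D_minus_two_in_aug_ideal] M_D
    by (simp add: gamma_bounded_def gamma_op_D M_one level_set_zero cf_in_level_set_iff)
  note smult = of_int_mult_closed[OF _ gamma_bounded_zero gamma_bounded_add gamma_bounded_uminus]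
  fix f assume "f \<in> aug_ideal"
  then obtain a b c d e where f: "f = cf a b c d e" "in_lattice a b c d e" "a = 0"
    unfolding aug_ideal_eq by (auto elim!: latticeE simp: cf_one)
  then obtain k l m n where p: "b = 4 * k" "c = 2 * l" "d = 2 * m" "e = 2 * (k + l + m + 2 * n)"
    unfolding in_lattice_def by auto
  \<comment> \<open>The multiplicities are those found in \<open>lattice_induct\<close>. The trivial
    character contributes 1 - 1 = 0, kept as a term so that \<open>cf_combination\<close>
    applies.\<close>
  have "f = (\<lambda>g. of_int 0 * cf 0 0 0 0 0 g + (of_int (- m - n) * cf 0 0 0 (-2) (-2) g + (of_int (- l - n) * cf 0 0 (-2) 0 (-2) g +
      (of_int (k + n) * cf 0 0 (-2) (-2) 0 g + of_int (- k) * cf 0 (-4) (-2) (-2) (-2) g))))"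
    unfolding cf_combination f p cf_eq_iff by (simp add: algebra_simps)
  also have "\<dots> \<in> gamma_bounded"
    by (intro gamma_bounded_add smult A B C D') (simp_all add: cf_0 gamma_bounded_zero)
  finally show "f \<in> gamma_bounded" .
qed

lemma gamma_products_level_set: "gamma_products n \<subseteq> level_set n"
proof
  interpret cring "char_ring G" by (rule cring_char_ring)
  fix p assume "p \<in> gamma_products n"
  then obtain k :: nat and i x where p: "p = (\<Otimes>\<^bsub>char_ring G\<^esub>j\<in>{..<k}. gamma_op G (i j) (x j))"
    and x: "\<forall>j<k. x j \<in> aug_ideal" and n: "n \<le> (\<Sum>j<k. i j)"
    unfolding gamma_products_def by blast
  have "(\<Otimes>\<^bsub>char_ring G\<^esub>j\<in>{..<k}. gamma_op G (i j) (x j)) \<in> level_set (\<Sum>j<k. i j)"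
    using x
  proof (induction k)
    case 0
    show ?case using level_set_one by (simp add: char_ring_simps cf_1)
  next
    case (Suc k)
    have "gamma_op G (i k) (x k) \<in> level_set (i k)"
      using Suc.prems aug_ideal_gamma_bounded by (auto simp: gamma_bounded_def)
    then show ?case
      using Suc level_set_mult by (simp add: gamma_finprod_Suc add.commute)
  qed
  then show "p \<in> level_set n" unfolding p using level_set_antimono[OF n] by blast
qed

lemma gamma_filtration_level_set: "gamma_filtration G n \<subseteq> level_set n"
proof -
  interpret cring "char_ring G" by (rule cring_char_ring)
  have minus: "inv\<^bsub>add_monoid (char_ring G)\<^esub> f \<in> level_set n" if "f \<in> level_set n" for f
  proof -
    have "inv\<^bsub>add_monoid (char_ring G)\<^esub> f = (\<lambda>g. - f g)"
      using char_ring_minus[of f] that level_set_lattice[of n] by (auto simp: a_inv_def)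
    then show ?thesis using level_set_uminus[OF that] by simp
  qed
  have "subgroup (level_set n) (add_monoid (char_ring G))"
  proof (rule group.subgroupI[OF a_group])
    show "level_set n \<noteq> {}" using level_set_zero by blast
  qed (use level_set_lattice minus level_set_add in \<open>auto simp: char_ring_carrier char_ring_simps(1)\<close>)
  then show ?thesis
    unfolding gamma_filtration_eq by (rule group.generate_subgroup_incl[OF a_group gamma_products_level_set])
qed

section \<open>Lower bound for the gamma filtration\<close>

definition ev :: "poly3 \<Rightarrow> 'g \<Rightarrow> complex" where
  "ev p = cf (eval_poly3 p (xs 0) (ys 0) 0) (eval_poly3 p (xs 1) (ys 1) 4) (eval_poly3 p (xs 2) (ys 2) 2)
    (eval_poly3 p (xs 3) (ys 3) (1 - \<tau>)) (eval_poly3 p (xs 4) (ys 4) (1 - \<tau>))"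

lemma ev_add: "ev (p + q) = (\<lambda>g. ev p g + ev q g)"
  by (simp add: ev_def cf_add)

lemma ev_mult: "ev (p * q) = (\<lambda>g. ev p g * ev q g)"
  by (simp add: ev_def cf_mult)

lemma ev_0: "ev 0 = (\<lambda>g. 0)"
  by (simp add: ev_def cf_0)

lemma ev_1: "ev 1 = cf 1 1 1 1 1"
  by (simp add: ev_def)

lemma ev_of_int_mult: "ev (of_int k * p) = (\<lambda>g. of_int k * ev p g)"
  by (simp add: ev_def cf_smult)

lemma ev_linear_gamma:
  assumes "\<exists>\<zeta>\<in>{1, -1}. \<exists>\<eta>\<in>{1, -1}. zs = (\<lambda>k. [0, 0, \<zeta> - 1, \<eta> - 1, \<zeta> * \<eta> - 1] ! k)"
  shows "cf (zs 0) (zs 1) (zs 2) (zs 3) (zs 4) \<in> aug_ideal \<and>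
    gamma_op G 1 (cf (zs 0) (zs 1) (zs 2) (zs 3) (zs 4)) = cf (zs 0) (zs 1) (zs 2) (zs 3) (zs 4)"
proof -
  obtain \<zeta> \<eta> where *: "\<zeta> \<in> {1, -1}" "\<eta> \<in> {1, -1}" and zs: "zs = (\<lambda>k. [0, 0, \<zeta> - 1, \<eta> - 1, \<zeta> * \<eta> - 1] ! k)"
    using assms by blast
  show ?thesis using gamma_op_linear[OF *, of 1] linear_minus_one_in_aug_ideal[OF *] by (simp add: zs)
qed

lemma ev_var_mult:
  assumes "ev p \<in> gamma_products n"
  shows "ev (var v * p) \<in> gamma_products (indet_degree v + n)"
proof (cases v)
  case V1
  have "ev (var V1) = cf (xs 0) (xs 1) (xs 2) (xs 3) (xs 4)" by (simp add: ev_def)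
  then show ?thesis
    using ev_linear_gamma[OF xs] gamma_products_mult[OF _ assms, of _ 1] unfolding V1 ev_mult by fastforce
next
  case V2
  have "ev (var V2) = cf (ys 0) (ys 1) (ys 2) (ys 3) (ys 4)" by (simp add: ev_def)
  then show ?thesis
    using ev_linear_gamma[OF ys] gamma_products_mult[OF _ assms, of _ 1] unfolding V2 ev_mult by fastforce
next
  case V3
  have "ev (var V3) = gamma_op G 2 (cf 0 (-4) (-2) (-2) (-2))" by (simp add: ev_def gamma_op_D)
  then show ?thesis
    using gamma_products_mult[OF D_minus_two_in_aug_ideal assms, of 2] unfolding V3 ev_mult by simp
qed

lemma ev_var_power_mult:
  "ev p \<in> gamma_products n \<Longrightarrow> ev (var v ^ k * p) \<in> gamma_products (k * indet_degree v + n)"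
  by (induction k) (auto simp: mult.assoc add.assoc dest!: ev_var_mult[of _ _ v])

text \<open>Each variable goes to a gamma operation, of index its own degree, on an element of the
  augmentation ideal. A monomial thus becomes a product of weight
  \<open>monomial_degree m\<close>.\<close>

lemma ev_single:
  assumes "n \<le> monomial_degree m"
  shows "ev (Poly_Mapping.single m k) \<in> gamma_filtration G n"
proof -
  let ?p = "var V1 ^ Poly_Mapping.lookup m V1 *
    (var V2 ^ Poly_Mapping.lookup m V2 * (var V3 ^ Poly_Mapping.lookup m V3 * 1))"
  have "ev ?p \<in> gamma_products (Poly_Mapping.lookup m V1 * indet_degree V1 +
      (Poly_Mapping.lookup m V2 * indet_degree V2 + (Poly_Mapping.lookup m V3 * indet_degree V3 + 0)))"
    by (intro ev_var_power_mult) (simp add: ev_1 one_in_gamma_products)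
  then have "ev ?p \<in> gamma_products (monomial_degree m)"
    by (simp add: monomial_degree_eq mult.commute add.assoc)
  then have "ev ?p \<in> gamma_filtration G n"
    using gamma_products_mono[OF assms] gamma_products_filtration by blast
  then have "(\<lambda>g. of_int k * ev ?p g) \<in> gamma_filtration G n"
    by (rule of_int_mult_closed[OF _ gamma_filtration_zero gamma_filtration_add gamma_filtration_uminus])
  then show ?thesis by (simp only: single_eq_var_powers ev_of_int_mult)
qed

lemma ev_sum: "(\<And>i. i \<in> A \<Longrightarrow> ev (f i) \<in> gamma_filtration G n) \<Longrightarrow> ev (\<Sum>i\<in>A. f i) \<in> gamma_filtration G n"
  by (induction A rule: infinite_finite_induct)
    (simp_all add: ev_0 gamma_filtration_zero ev_add gamma_filtration_add)

lemma ev_degree_ge: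
  assumes "degree_ge n p"
  shows "ev p \<in> gamma_filtration G n"
proof -
  have "ev (\<Sum>m\<in>Poly_Mapping.keys p. Poly_Mapping.single m (Poly_Mapping.lookup p m)) \<in> gamma_filtration G n"
    by (intro ev_sum ev_single) (use assms in \<open>simp add: degree_ge_def\<close>)
  then show ?thesis by (simp only: poly3_sum_single)
qed

lemma level_set_span:
  assumes "f \<in> level_set n"
  obtains p where "degree_ge n p" "f = ev p"
proof -
  obtain a b c d e where f: "f = cf a b c d e" "M n a b c d e" using assms by (rule level_set_E)
  then show ?thesis using M_span[OF f(2)] that unfolding ev_def by blast
qed

text \<open>The upper bound rests on \<open>aug_ideal_gamma_bounded\<close>, the lower bound on
  \<open>M_span\<close>.\<close>

lemma gamma_filtration_eq_level_set: "gamma_filtration G n = level_set n"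
  using gamma_filtration_level_set ev_degree_ge by (auto elim: level_set_span)

sublocale filtered_ring "char_ring G" "gamma_filtration G"
proof (rule filtered_ring.intro[OF cring_char_ring], rule filtered_ring_axioms.intro)
  show "additive_subgroup (gamma_filtration G n) (char_ring G)" for n
    by (rule additive_subgroup.intro[OF gamma_filtration_subgroup])
  show "f \<otimes>\<^bsub>char_ring G\<^esub> f' \<in> gamma_filtration G (m + n)"
    if "f \<in> gamma_filtration G m" "f' \<in> gamma_filtration G n" for f f' m n
    using that unfolding gamma_filtration_eq_level_set char_ring_simps by (rule level_set_mult)
  show "gamma_filtration G (Suc n) \<subseteq> gamma_filtration G n" for n
    unfolding gamma_filtration_eq_level_set by (rule level_set_antimono) simp
  show "\<one>\<^bsub>char_ring G\<^esub> \<in> gamma_filtration G 0"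
    unfolding gamma_filtration_eq_level_set char_ring_simps cf_1[symmetric] by (rule level_set_one)
qed

theorem graded_char_ring_presentation:
  "graded_ring_isomorphic (graded_char_ring G) (graded_char_component G) (presented_ring S) (presented_component S)"
  unfolding graded_char_ring_def graded_char_component_def
proof (rule graded_presentation)
  have ev_lattice: "ev p \<in> lattice" for p
    using ev_degree_ge[of 0 p] gamma_filtration_lattice by (auto simp: degree_ge_def)
  show "ev \<in> Ring.ring_hom poly3_ring (char_ring G)"
    by (rule ring_hom_memI) (simp_all add: char_ring_carrier char_ring_simps ev_lattice ev_add ev_mult ev_1 cf_1)
  show ev_F: "ev p \<in> gamma_filtration G n" if "homogeneous n p" for n p
    using ev_degree_ge[OF homogeneous_degree_ge[OF that order.refl]] .
  show "\<exists>p. homogeneous n p \<and> ev p \<ominus>\<^bsub>char_ring G\<^esub> f \<in> gamma_filtration G (Suc n)"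
    if f: "f \<in> gamma_filtration G n" for n f
  proof -
    obtain p where p: "degree_ge n p" "f = ev p"
      using f unfolding gamma_filtration_eq_level_set by (rule level_set_span)
    \<comment> \<open>Terms of degree above n land in the next step, so the part of degree n already
      represents the class of f.\<close>
    let ?q = "homogeneous_part n p"
    have "ev (p - ?q) \<in> gamma_filtration G (Suc n)"
      by (rule ev_degree_ge[OF degree_ge_minus_homogeneous_part[OF p(1)]])
    then have "(\<lambda>g. - ev (p - ?q) g) \<in> gamma_filtration G (Suc n)" by (rule gamma_filtration_uminus)
    also have "(\<lambda>g. - ev (p - ?q) g) = ev ?q \<ominus>\<^bsub>char_ring G\<^esub> f"
      unfolding p(2) a_minus_def char_ring_minus[OF ev_lattice] char_ring_simps(1)
      using fun_cong[OF ev_add[of "p - ?q" ?q]] by (simp add: fun_eq_iff)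
    finally show ?thesis using homogeneous_part_homogeneous by blast
  qed
  show "\<exists>n. homogeneous n s' \<and> ev s' \<in> gamma_filtration G (Suc n)" if "s' \<in> S" for s'
    using rel[OF that] by (simp add: gamma_filtration_eq_level_set ev_def cf_in_level_set_iff)
  show "\<exists>q. homogeneous n q \<and> p - q \<in> genideal poly3_ring S \<and>
      (ev q \<in> gamma_filtration G (Suc n) \<longrightarrow> q \<in> genideal poly3_ring S)" if "homogeneous n p" for n p
    using normal_form[OF that] by (simp add: gamma_filtration_eq_level_set ev_def cf_in_level_set_iff)
qed

end

section \<open>Congruences for the filtration of D4 and Q8\<close>

text \<open>With \<open>q = 2\<^sup>k\<close> and \<open>k > 0\<close>, these are the value vectors of \<open>\<Gamma>\<^bsup>2k\<^esup>\<close> and \<open>\<Gamma>\<^bsup>2k+1\<^esup>\<close>. They are obtained as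
  the spans of the values of the monomials of these degrees in the three generators. For
  both groups \<open>level_odd_Q8 1\<close> is the augmentation ideal.\<close>

definition level_even_D4 :: "int \<Rightarrow> int \<Rightarrow> int \<Rightarrow> int \<Rightarrow> int \<Rightarrow> int \<Rightarrow> bool" where
  "level_even_D4 q v0 v1 v2 v3 v4 \<longleftrightarrow> (\<exists>k l m n. v0 = 0 \<and> v1 = q * q * k \<and>
    v2 = q * k + 2 * q * l \<and> v3 = q * q * m \<and> v4 = q * q * n)"

lemma level_even_D4I:
  "v0 = 0 \<Longrightarrow> v1 = q * q * k \<Longrightarrow> v2 = q * k + 2 * q * l \<Longrightarrow> v3 = q * q * m
    \<Longrightarrow> v4 = q * q * n \<Longrightarrow> level_even_D4 q v0 v1 v2 v3 v4"
  unfolding level_even_D4_def by blast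

definition level_odd_D4 :: "int \<Rightarrow> int \<Rightarrow> int \<Rightarrow> int \<Rightarrow> int \<Rightarrow> int \<Rightarrow> bool" where
  "level_odd_D4 q v0 v1 v2 v3 v4 \<longleftrightarrow> (\<exists>k l m n. v0 = 0 \<and> v1 = 4 * q * q * k \<and>
    v2 = 2 * q * l \<and> v3 = 2 * q * q * m \<and> v4 = 2 * q * q * n)"

lemma level_odd_D4I:
  "v0 = 0 \<Longrightarrow> v1 = 4 * q * q * k \<Longrightarrow> v2 = 2 * q * l \<Longrightarrow> v3 = 2 * q * q * m
    \<Longrightarrow> v4 = 2 * q * q * n \<Longrightarrow> level_odd_D4 q v0 v1 v2 v3 v4"
  unfolding level_odd_D4_def by blast

definition level_even_Q8 :: "int \<Rightarrow> int \<Rightarrow> int \<Rightarrow> int \<Rightarrow> int \<Rightarrow> int \<Rightarrow> bool" where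
  "level_even_Q8 q v0 v1 v2 v3 v4 \<longleftrightarrow> (\<exists>k l m n. v0 = 0 \<and> v1 = q * q * k \<and>
    v2 = q * k + 2 * q * l \<and> v3 = q * k + 2 * q * m \<and> v4 = q * k + 2 * q * n)"

lemma level_even_Q8I:
  "v0 = 0 \<Longrightarrow> v1 = q * q * k \<Longrightarrow> v2 = q * k + 2 * q * l \<Longrightarrow> v3 = q * k + 2 * q * m
    \<Longrightarrow> v4 = q * k + 2 * q * n \<Longrightarrow> level_even_Q8 q v0 v1 v2 v3 v4"
  unfolding level_even_Q8_def by blast

definition level_odd_Q8 :: "int \<Rightarrow> int \<Rightarrow> int \<Rightarrow> int \<Rightarrow> int \<Rightarrow> int \<Rightarrow> bool" where
  "level_odd_Q8 q v0 v1 v2 v3 v4 \<longleftrightarrow> (\<exists>k l m n. v0 = 0 \<and> v1 = 4 * q * q * k \<and>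
    v2 = 2 * q * l \<and> v3 = 2 * q * m \<and> v4 = 2 * q * (l + m + k + 2 * n))"

lemma level_odd_Q8I:
  "v0 = 0 \<Longrightarrow> v1 = 4 * q * q * k \<Longrightarrow> v2 = 2 * q * l \<Longrightarrow> v3 = 2 * q * m
    \<Longrightarrow> v4 = 2 * q * (l + m + k + 2 * n) \<Longrightarrow> level_odd_Q8 q v0 v1 v2 v3 v4"
  unfolding level_odd_Q8_def by blast

text \<open>In the product lemmas the witnesses of uncoupled coordinates are plain products. In a
  coupled coordinate the witness is forced: here l is half the difference of v2 v2' / q and the new
  k.\<close>

lemma in_lattice_mult_level_even_D4:
  assumes "in_lattice v0 v1 v2 v3 v4" "level_even_D4 q v0' v1' v2' v3' v4'"
  shows "level_even_D4 (q) (v0 * v0') (v1 * v1') (v2 * v2') (v3 * v3') (v4 * v4')"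
proof -
  obtain k l m n where "v1 = v0 + 4 * k" "v2 = v0 + 2 * l" "v3 = v0 + 2 * m" "v4 = v0 + 2 * (k + l + m + 2 * n)"
    using assms(1) unfolding in_lattice_def by blast
  moreover obtain k' l' m' n' where "v0' = 0" "v1' = q * q * k'" "v2' = q * k' + 2 * q * l'" "v3' = q * q * m'" "v4' = q * q * n'"
    using assms(2) unfolding level_even_D4_def by blast
  ultimately show ?thesis
    by (intro level_even_D4I[where k = "(v0 + 4 * k) * k'" and l = "(v0 + 2 * l) * l' + l * k' - 2 * k * k'" and m = "(v0 + 2 * m) * m'" and n = "(v0 + 2 * (k + l + m + 2 * n)) * n'"]) (simp_all add: algebra_simps)
qed

lemma in_lattice_mult_level_odd_D4:
  assumes "in_lattice v0 v1 v2 v3 v4" "level_odd_D4 q v0' v1' v2' v3' v4'"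
  shows "level_odd_D4 (q) (v0 * v0') (v1 * v1') (v2 * v2') (v3 * v3') (v4 * v4')"
proof -
  obtain k l m n where "v1 = v0 + 4 * k" "v2 = v0 + 2 * l" "v3 = v0 + 2 * m" "v4 = v0 + 2 * (k + l + m + 2 * n)"
    using assms(1) unfolding in_lattice_def by blast
  moreover obtain k' l' m' n' where "v0' = 0" "v1' = 4 * q * q * k'" "v2' = 2 * q * l'" "v3' = 2 * q * q * m'" "v4' = 2 * q * q * n'"
    using assms(2) unfolding level_odd_D4_def by blast
  ultimately show ?thesis
    by (intro level_odd_D4I[where k = "(v0 + 4 * k) * k'" and l = "(v0 + 2 * l) * l'" and m = "(v0 + 2 * m) * m'" and n = "(v0 + 2 * (k + l + m + 2 * n)) * n'"]) (simp_all add: algebra_simps)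
qed

lemma in_lattice_mult_level_even_Q8:
  assumes "in_lattice v0 v1 v2 v3 v4" "level_even_Q8 q v0' v1' v2' v3' v4'"
  shows "level_even_Q8 (q) (v0 * v0') (v1 * v1') (v2 * v2') (v3 * v3') (v4 * v4')"
proof -
  obtain k l m n where "v1 = v0 + 4 * k" "v2 = v0 + 2 * l" "v3 = v0 + 2 * m" "v4 = v0 + 2 * (k + l + m + 2 * n)"
    using assms(1) unfolding in_lattice_def by blast
  moreover obtain k' l' m' n' where "v0' = 0" "v1' = q * q * k'" "v2' = q * k' + 2 * q * l'" "v3' = q * k' + 2 * q * m'" "v4' = q * k' + 2 * q * n'"
    using assms(2) unfolding level_even_Q8_def by blast
  ultimately show ?thesis
    by (intro level_even_Q8I[where k = "(v0 + 4 * k) * k'" and l = "(v0 + 2 * l) * l' + l * k' - 2 * k * k'" and m = "(v0 + 2 * m) * m' + m * k' - 2 * k * k'" and n = "(v0 + 2 * (k + l + m + 2 * n)) * n' + (k + l + m + 2 * n) * k' - 2 * k * k'"]) (simp_all add: algebra_simps)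
qed

lemma in_lattice_mult_level_odd_Q8:
  assumes "in_lattice v0 v1 v2 v3 v4" "level_odd_Q8 q v0' v1' v2' v3' v4'"
  shows "level_odd_Q8 (q) (v0 * v0') (v1 * v1') (v2 * v2') (v3 * v3') (v4 * v4')"
proof -
  obtain k l m n where "v1 = v0 + 4 * k" "v2 = v0 + 2 * l" "v3 = v0 + 2 * m" "v4 = v0 + 2 * (k + l + m + 2 * n)"
    using assms(1) unfolding in_lattice_def by blast
  moreover obtain k' l' m' n' where "v0' = 0" "v1' = 4 * q * q * k'" "v2' = 2 * q * l'" "v3' = 2 * q * m'" "v4' = 2 * q * (l' + m' + k' + 2 * n')"
    using assms(2) unfolding level_odd_Q8_def by blast
  ultimately show ?thesis
    by (intro level_odd_Q8I[where k = "(v0 + 4 * k) * k'" and l = "(v0 + 2 * l) * l'" and m = "(v0 + 2 * m) * m'" and n = "v0 * n' + (k + l + m + 2 * n) * (l' + m' + k' + 2 * n') - l * l' - m * m' - 2 * k * k'"]) (simp_all add: algebra_simps)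
qed

text \<open>The augmentation ideal is not \<open>level_odd_D4 1\<close>, because it ties v4 to the
  other values modulo 4. A multiplication erases this tie and leaves only the coupling of v1 and v2,
  so degree 1 of D4 has product lemmas of its own.\<close>

lemma augmentation_mult:
  assumes "level_odd_Q8 1 v0 v1 v2 v3 v4" "level_odd_Q8 1 v0' v1' v2' v3' v4'"
  shows "level_even_D4 (2) (v0 * v0') (v1 * v1') (v2 * v2') (v3 * v3') (v4 * v4')"
proof -
  obtain k l m n where "v0 = 0" "v1 = 4 * 1 * 1 * k" "v2 = 2 * 1 * l" "v3 = 2 * 1 * m" "v4 = 2 * 1 * (l + m + k + 2 * n)"
    using assms(1) unfolding level_odd_Q8_def by blast
  moreover obtain k' l' m' n' where "v0' = 0" "v1' = 4 * 1 * 1 * k'" "v2' = 2 * 1 * l'" "v3' = 2 * 1 * m'" "v4' = 2 * 1 * (l' + m' + k' + 2 * n')"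
    using assms(2) unfolding level_odd_Q8_def by blast
  ultimately show ?thesis
    by (intro level_even_D4I[where k = "4 * k * k'" and l = "l * l' - 2 * k * k'" and m = "m * m'" and n = "(l + m + k + 2 * n) * (l' + m' + k' + 2 * n')"]) (simp_all add: algebra_simps)
qed

lemma augmentation_mult_level_even_D4:
  assumes "level_odd_Q8 1 v0 v1 v2 v3 v4" "level_even_D4 q v0' v1' v2' v3' v4'"
  shows "level_odd_D4 (q) (v0 * v0') (v1 * v1') (v2 * v2') (v3 * v3') (v4 * v4')"
proof -
  obtain k l m n where "v0 = 0" "v1 = 4 * 1 * 1 * k" "v2 = 2 * 1 * l" "v3 = 2 * 1 * m" "v4 = 2 * 1 * (l + m + k + 2 * n)"
    using assms(1) unfolding level_odd_Q8_def by blast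
  moreover obtain k' l' m' n' where "v0' = 0" "v1' = q * q * k'" "v2' = q * k' + 2 * q * l'" "v3' = q * q * m'" "v4' = q * q * n'"
    using assms(2) unfolding level_even_D4_def by blast
  ultimately show ?thesis
    by (intro level_odd_D4I[where k = "k * k'" and l = "l * (k' + 2 * l')" and m = "m * m'" and n = "(l + m + k + 2 * n) * n'"]) (simp_all add: algebra_simps)
qed

lemma augmentation_mult_level_odd_D4:
  assumes "level_odd_Q8 1 v0 v1 v2 v3 v4" "level_odd_D4 q v0' v1' v2' v3' v4'"
  shows "level_even_D4 (2 * q) (v0 * v0') (v1 * v1') (v2 * v2') (v3 * v3') (v4 * v4')"
proof -
  obtain k l m n where "v0 = 0" "v1 = 4 * 1 * 1 * k" "v2 = 2 * 1 * l" "v3 = 2 * 1 * m" "v4 = 2 * 1 * (l + m + k + 2 * n)"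
    using assms(1) unfolding level_odd_Q8_def by blast
  moreover obtain k' l' m' n' where "v0' = 0" "v1' = 4 * q * q * k'" "v2' = 2 * q * l'" "v3' = 2 * q * q * m'" "v4' = 2 * q * q * n'"
    using assms(2) unfolding level_odd_D4_def by blast
  ultimately show ?thesis
    by (intro level_even_D4I[where k = "4 * k * k'" and l = "l * l' - 2 * k * k'" and m = "m * m'" and n = "(l + m + k + 2 * n) * n'"]) (simp_all add: algebra_simps)
qed

lemma level_even_D4_mult:
  assumes "level_even_D4 q v0 v1 v2 v3 v4" "level_even_D4 q' v0' v1' v2' v3' v4'"
  shows "level_even_D4 (q * q') (v0 * v0') (v1 * v1') (v2 * v2') (v3 * v3') (v4 * v4')"
proof -
  obtain k l m n where "v0 = 0" "v1 = q * q * k" "v2 = q * k + 2 * q * l" "v3 = q * q * m" "v4 = q * q * n"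
    using assms(1) unfolding level_even_D4_def by blast
  moreover obtain k' l' m' n' where "v0' = 0" "v1' = q' * q' * k'" "v2' = q' * k' + 2 * q' * l'" "v3' = q' * q' * m'" "v4' = q' * q' * n'"
    using assms(2) unfolding level_even_D4_def by blast
  ultimately show ?thesis
    by (intro level_even_D4I[where k = "k * k'" and l = "k * l' + l * k' + 2 * l * l'" and m = "m * m'" and n = "n * n'"]) (simp_all add: algebra_simps)
qed

lemma level_even_D4_mult_odd:
  assumes "level_even_D4 q v0 v1 v2 v3 v4" "level_odd_D4 q' v0' v1' v2' v3' v4'"
  shows "level_odd_D4 (q * q') (v0 * v0') (v1 * v1') (v2 * v2') (v3 * v3') (v4 * v4')"
proof -
  obtain k l m n where "v0 = 0" "v1 = q * q * k" "v2 = q * k + 2 * q * l" "v3 = q * q * m" "v4 = q * q * n"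
    using assms(1) unfolding level_even_D4_def by blast
  moreover obtain k' l' m' n' where "v0' = 0" "v1' = 4 * q' * q' * k'" "v2' = 2 * q' * l'" "v3' = 2 * q' * q' * m'" "v4' = 2 * q' * q' * n'"
    using assms(2) unfolding level_odd_D4_def by blast
  ultimately show ?thesis
    by (intro level_odd_D4I[where k = "k * k'" and l = "(k + 2 * l) * l'" and m = "m * m'" and n = "n * n'"]) (simp_all add: algebra_simps)
qed

lemma level_odd_D4_mult:
  assumes "level_odd_D4 q v0 v1 v2 v3 v4" "level_odd_D4 q' v0' v1' v2' v3' v4'"
  shows "level_even_D4 (2 * (q * q')) (v0 * v0') (v1 * v1') (v2 * v2') (v3 * v3') (v4 * v4')"
proof -
  obtain k l m n where "v0 = 0" "v1 = 4 * q * q * k" "v2 = 2 * q * l" "v3 = 2 * q * q * m" "v4 = 2 * q * q * n"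
    using assms(1) unfolding level_odd_D4_def by blast
  moreover obtain k' l' m' n' where "v0' = 0" "v1' = 4 * q' * q' * k'" "v2' = 2 * q' * l'" "v3' = 2 * q' * q' * m'" "v4' = 2 * q' * q' * n'"
    using assms(2) unfolding level_odd_D4_def by blast
  ultimately show ?thesis
    by (intro level_even_D4I[where k = "4 * k * k'" and l = "l * l' - 2 * k * k'" and m = "m * m'" and n = "n * n'"]) (simp_all add: algebra_simps)
qed

lemma level_even_Q8_mult:
  assumes "level_even_Q8 q v0 v1 v2 v3 v4" "level_even_Q8 q' v0' v1' v2' v3' v4'"
  shows "level_even_Q8 (q * q') (v0 * v0') (v1 * v1') (v2 * v2') (v3 * v3') (v4 * v4')"
proof -
  obtain k l m n where "v0 = 0" "v1 = q * q * k" "v2 = q * k + 2 * q * l" "v3 = q * k + 2 * q * m" "v4 = q * k + 2 * q * n"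
    using assms(1) unfolding level_even_Q8_def by blast
  moreover obtain k' l' m' n' where "v0' = 0" "v1' = q' * q' * k'" "v2' = q' * k' + 2 * q' * l'" "v3' = q' * k' + 2 * q' * m'" "v4' = q' * k' + 2 * q' * n'"
    using assms(2) unfolding level_even_Q8_def by blast
  ultimately show ?thesis
    by (intro level_even_Q8I[where k = "k * k'" and l = "k * l' + l * k' + 2 * l * l'" and m = "k * m' + m * k' + 2 * m * m'" and n = "k * n' + n * k' + 2 * n * n'"]) (simp_all add: algebra_simps)
qed

lemma level_even_Q8_mult_odd:
  assumes "level_even_Q8 q v0 v1 v2 v3 v4" "level_odd_Q8 q' v0' v1' v2' v3' v4'"
  shows "level_odd_Q8 (q * q') (v0 * v0') (v1 * v1') (v2 * v2') (v3 * v3') (v4 * v4')"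
proof -
  obtain k l m n where "v0 = 0" "v1 = q * q * k" "v2 = q * k + 2 * q * l" "v3 = q * k + 2 * q * m" "v4 = q * k + 2 * q * n"
    using assms(1) unfolding level_even_Q8_def by blast
  moreover obtain k' l' m' n' where "v0' = 0" "v1' = 4 * q' * q' * k'" "v2' = 2 * q' * l'" "v3' = 2 * q' * m'" "v4' = 2 * q' * (l' + m' + k' + 2 * n')"
    using assms(2) unfolding level_odd_Q8_def by blast
  ultimately show ?thesis
    by (intro level_odd_Q8I[where k = "k * k'" and l = "(k + 2 * l) * l'" and m = "(k + 2 * m) * m'" and n = "k * n' + n * (l' + m' + k' + 2 * n') - l * l' - m * m'"]) (simp_all add: algebra_simps)
qed

lemma level_odd_Q8_mult:
  assumes "level_odd_Q8 q v0 v1 v2 v3 v4" "level_odd_Q8 q' v0' v1' v2' v3' v4'"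
  shows "level_even_Q8 (2 * (q * q')) (v0 * v0') (v1 * v1') (v2 * v2') (v3 * v3') (v4 * v4')"
proof -
  obtain k l m n where "v0 = 0" "v1 = 4 * q * q * k" "v2 = 2 * q * l" "v3 = 2 * q * m" "v4 = 2 * q * (l + m + k + 2 * n)"
    using assms(1) unfolding level_odd_Q8_def by blast
  moreover obtain k' l' m' n' where "v0' = 0" "v1' = 4 * q' * q' * k'" "v2' = 2 * q' * l'" "v3' = 2 * q' * m'" "v4' = 2 * q' * (l' + m' + k' + 2 * n')"
    using assms(2) unfolding level_odd_Q8_def by blast
  ultimately show ?thesis
    by (intro level_even_Q8I[where k = "4 * k * k'" and l = "l * l' - 2 * k * k'" and m = "m * m' - 2 * k * k'" and n = "(l + m + k + 2 * n) * (l' + m' + k' + 2 * n') - 2 * k * k'"]) (simp_all add: algebra_simps)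
qed

section \<open>Sums and inclusions of the congruences\<close>

lemma level_even_D4_add:
  assumes "level_even_D4 q v0 v1 v2 v3 v4" "level_even_D4 q v0' v1' v2' v3' v4'"
  shows "level_even_D4 q (v0 + v0') (v1 + v1') (v2 + v2') (v3 + v3') (v4 + v4')"
proof -
  obtain k l m n where "v0 = 0" "v1 = q * q * k" "v2 = q * k + 2 * q * l" "v3 = q * q * m" "v4 = q * q * n"
    using assms(1) unfolding level_even_D4_def by blast
  moreover obtain k' l' m' n' where "v0' = 0" "v1' = q * q * k'" "v2' = q * k' + 2 * q * l'" "v3' = q * q * m'" "v4' = q * q * n'"
    using assms(2) unfolding level_even_D4_def by blast
  ultimately show ?thesis
    by (intro level_even_D4I[where k = "k + k'" and l = "l + l'" and m = "m + m'" and n = "n + n'"])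
      (simp_all add: algebra_simps)
qed

lemma level_even_D4_zero: "level_even_D4 q 0 0 0 0 0"
  by (rule level_even_D4I[where k = 0 and l = 0 and m = 0 and n = 0]) simp_all

lemma level_odd_D4_add:
  assumes "level_odd_D4 q v0 v1 v2 v3 v4" "level_odd_D4 q v0' v1' v2' v3' v4'"
  shows "level_odd_D4 q (v0 + v0') (v1 + v1') (v2 + v2') (v3 + v3') (v4 + v4')"
proof -
  obtain k l m n where "v0 = 0" "v1 = 4 * q * q * k" "v2 = 2 * q * l" "v3 = 2 * q * q * m" "v4 = 2 * q * q * n"
    using assms(1) unfolding level_odd_D4_def by blast
  moreover obtain k' l' m' n' where "v0' = 0" "v1' = 4 * q * q * k'" "v2' = 2 * q * l'" "v3' = 2 * q * q * m'" "v4' = 2 * q * q * n'"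
    using assms(2) unfolding level_odd_D4_def by blast
  ultimately show ?thesis
    by (intro level_odd_D4I[where k = "k + k'" and l = "l + l'" and m = "m + m'" and n = "n + n'"])
      (simp_all add: algebra_simps)
qed

lemma level_odd_D4_zero: "level_odd_D4 q 0 0 0 0 0"
  by (rule level_odd_D4I[where k = 0 and l = 0 and m = 0 and n = 0]) simp_all

lemma level_even_Q8_add:
  assumes "level_even_Q8 q v0 v1 v2 v3 v4" "level_even_Q8 q v0' v1' v2' v3' v4'"
  shows "level_even_Q8 q (v0 + v0') (v1 + v1') (v2 + v2') (v3 + v3') (v4 + v4')"
proof -
  obtain k l m n where "v0 = 0" "v1 = q * q * k" "v2 = q * k + 2 * q * l" "v3 = q * k + 2 * q * m" "v4 = q * k + 2 * q * n"
    using assms(1) unfolding level_even_Q8_def by blast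
  moreover obtain k' l' m' n' where "v0' = 0" "v1' = q * q * k'" "v2' = q * k' + 2 * q * l'" "v3' = q * k' + 2 * q * m'" "v4' = q * k' + 2 * q * n'"
    using assms(2) unfolding level_even_Q8_def by blast
  ultimately show ?thesis
    by (intro level_even_Q8I[where k = "k + k'" and l = "l + l'" and m = "m + m'" and n = "n + n'"])
      (simp_all add: algebra_simps)
qed

lemma level_even_Q8_zero: "level_even_Q8 q 0 0 0 0 0"
  by (rule level_even_Q8I[where k = 0 and l = 0 and m = 0 and n = 0]) simp_all

lemma level_odd_Q8_add:
  assumes "level_odd_Q8 q v0 v1 v2 v3 v4" "level_odd_Q8 q v0' v1' v2' v3' v4'"
  shows "level_odd_Q8 q (v0 + v0') (v1 + v1') (v2 + v2') (v3 + v3') (v4 + v4')"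
proof -
  obtain k l m n where "v0 = 0" "v1 = 4 * q * q * k" "v2 = 2 * q * l" "v3 = 2 * q * m" "v4 = 2 * q * (l + m + k + 2 * n)"
    using assms(1) unfolding level_odd_Q8_def by blast
  moreover obtain k' l' m' n' where "v0' = 0" "v1' = 4 * q * q * k'" "v2' = 2 * q * l'" "v3' = 2 * q * m'" "v4' = 2 * q * (l' + m' + k' + 2 * n')"
    using assms(2) unfolding level_odd_Q8_def by blast
  ultimately show ?thesis
    by (intro level_odd_Q8I[where k = "k + k'" and l = "l + l'" and m = "m + m'" and n = "n + n'"])
      (simp_all add: algebra_simps)
qed

lemma level_odd_Q8_zero: "level_odd_Q8 q 0 0 0 0 0"
  by (rule level_odd_Q8I[where k = 0 and l = 0 and m = 0 and n = 0]) simp_all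

lemma level_even_D4_imp_augmentation:
  assumes "level_even_D4 2 v0 v1 v2 v3 v4"
  shows "level_odd_Q8 1 v0 v1 v2 v3 v4"
proof -
  obtain k l m n where "v0 = 0" "v1 = 2 * 2 * k" "v2 = 2 * k + 2 * 2 * l" "v3 = 2 * 2 * m" "v4 = 2 * 2 * n"
    using assms unfolding level_even_D4_def by blast
  then show ?thesis
    by (intro level_odd_Q8I[where k = "k" and l = "k + 2 * l" and m = "2 * m" and n = "n - k - l - m"])
      (simp_all add: algebra_simps)
qed

lemma level_odd_D4_imp_even:
  assumes "level_odd_D4 q v0 v1 v2 v3 v4"
  shows "level_even_D4 q v0 v1 v2 v3 v4"
proof -
  obtain k l m n where "v0 = 0" "v1 = 4 * q * q * k" "v2 = 2 * q * l" "v3 = 2 * q * q * m" "v4 = 2 * q * q * n"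
    using assms unfolding level_odd_D4_def by blast
  then show ?thesis
    by (intro level_even_D4I[where k = "4 * k" and l = "l - 2 * k" and m = "2 * m" and n = "2 * n"])
      (simp_all add: algebra_simps)
qed

lemma level_even_D4_imp_odd:
  assumes "level_even_D4 (2 * q) v0 v1 v2 v3 v4"
  shows "level_odd_D4 q v0 v1 v2 v3 v4"
proof -
  obtain k l m n where "v0 = 0" "v1 = (2 * q) * (2 * q) * k" "v2 = (2 * q) * k + 2 * (2 * q) * l" "v3 = (2 * q) * (2 * q) * m" "v4 = (2 * q) * (2 * q) * n"
    using assms unfolding level_even_D4_def by blast
  then show ?thesis
    by (intro level_odd_D4I[where k = "k" and l = "k + 2 * l" and m = "2 * m" and n = "2 * n"])
      (simp_all add: algebra_simps)
qed

lemma augmentation_imp_in_lattice: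
  assumes "level_odd_Q8 1 v0 v1 v2 v3 v4"
  shows "in_lattice v0 v1 v2 v3 v4"
proof -
  obtain k l m n where "v0 = 0" "v1 = 4 * 1 * 1 * k" "v2 = 2 * 1 * l" "v3 = 2 * 1 * m" "v4 = 2 * 1 * (l + m + k + 2 * n)"
    using assms unfolding level_odd_Q8_def by blast
  then show ?thesis
    by (intro in_latticeI[where k = "k" and l = "l" and m = "m" and n = "n"])
      (simp_all add: algebra_simps)
qed

lemma level_odd_Q8_imp_even:
  assumes "level_odd_Q8 q v0 v1 v2 v3 v4"
  shows "level_even_Q8 q v0 v1 v2 v3 v4"
proof -
  obtain k l m n where "v0 = 0" "v1 = 4 * q * q * k" "v2 = 2 * q * l" "v3 = 2 * q * m" "v4 = 2 * q * (l + m + k + 2 * n)"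
    using assms unfolding level_odd_Q8_def by blast
  then show ?thesis
    by (intro level_even_Q8I[where k = "4 * k" and l = "l - 2 * k" and m = "m - 2 * k" and n = "(l + m + k + 2 * n) - 2 * k"])
      (simp_all add: algebra_simps)
qed

lemma level_even_Q8_imp_odd:
  assumes "level_even_Q8 (2 * q) v0 v1 v2 v3 v4"
  shows "level_odd_Q8 q v0 v1 v2 v3 v4"
proof -
  obtain k l m n where "v0 = 0" "v1 = (2 * q) * (2 * q) * k" "v2 = (2 * q) * k + 2 * (2 * q) * l" "v3 = (2 * q) * k + 2 * (2 * q) * m" "v4 = (2 * q) * k + 2 * (2 * q) * n"
    using assms unfolding level_even_Q8_def by blast
  then show ?thesis
    by (intro level_odd_Q8I[where k = "k" and l = "k + 2 * l" and m = "k + 2 * m" and n = "n - k - l - m"])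
      (simp_all add: algebra_simps)
qed

section \<open>The congruences as filtrations indexed by the degree\<close>

definition level_D4 :: "nat \<Rightarrow> int \<Rightarrow> int \<Rightarrow> int \<Rightarrow> int \<Rightarrow> int \<Rightarrow> bool" where
  "level_D4 n = (if n = 0 then in_lattice else if n = 1 then level_odd_Q8 1
    else if even n then level_even_D4 (2 ^ (n div 2)) else level_odd_D4 (2 ^ (n div 2)))"

definition level_Q8 :: "nat \<Rightarrow> int \<Rightarrow> int \<Rightarrow> int \<Rightarrow> int \<Rightarrow> int \<Rightarrow> bool" where
  "level_Q8 n = (if n = 0 then in_lattice
    else if even n then level_even_Q8 (2 ^ (n div 2)) else level_odd_Q8 (2 ^ (n div 2)))"

lemma level_D4_simps:
  "level_D4 0 = in_lattice" "level_D4 1 = level_odd_Q8 1"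
  "0 < k \<Longrightarrow> n = 2 * k \<Longrightarrow> level_D4 n = level_even_D4 (2 ^ k)"
  "0 < k \<Longrightarrow> n = 2 * k + 1 \<Longrightarrow> level_D4 n = level_odd_D4 (2 ^ k)"
  by (auto simp: level_D4_def)

lemma level_Q8_simps:
  "level_Q8 0 = in_lattice"
  "0 < k \<Longrightarrow> n = 2 * k \<Longrightarrow> level_Q8 n = level_even_Q8 (2 ^ k)"
  "n = 2 * k + 1 \<Longrightarrow> level_Q8 n = level_odd_Q8 (2 ^ k)"
  by (auto simp: level_Q8_def)

lemma nat_level_cases:
  obtains "n = 0" | "n = 1" | k where "0 < k" "n = 2 * k" | k where "0 < k" "n = 2 * k + (1::nat)"
proof -
  have "n = 2 * (n div 2) \<or> n = 2 * (n div 2) + 1" by linarith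
  then show ?thesis using that by (cases "n div 2 = 0") auto
qed

text \<open>The last assumption retains at least one order of each pair of degrees;
  \<open>level_D4_mult\<close> obtains the other order by commutativity.\<close>

lemma level_D4_mult_aux:
  assumes "level_D4 m v0 v1 v2 v3 v4" "level_D4 n v0' v1' v2' v3' v4'"
    and "m = 0 \<or> m = 1 \<and> n \<noteq> 0 \<or> 1 < m \<and> even m \<and> 1 < n \<or> 1 < m \<and> odd m \<and> 1 < n \<and> odd n"
  shows "level_D4 (m + n) (v0 * v0') (v1 * v1') (v2 * v2') (v3 * v3') (v4 * v4')"
proof (cases m rule: nat_level_cases)
  case 1
  then show ?thesis
    using assms(1,2) in_lattice_mult in_lattice_mult_level_odd_Q8 in_lattice_mult_level_even_D4
      in_lattice_mult_level_odd_D4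
    by (auto simp: level_D4_def)
next
  case m: 2
  show ?thesis
  proof (cases n rule: nat_level_cases)
    case 1
    then show ?thesis using m assms(3) by simp
  next
    case 2
    have M: "level_D4 m = level_odd_Q8 1" "level_D4 n = level_odd_Q8 1" "level_D4 (m + n) = level_even_D4 2"
      using m 2 by (simp_all add: level_D4_def)
    show ?thesis using assms(1,2) unfolding M by (rule augmentation_mult)
  next
    case (3 k)
    have M: "level_D4 m = level_odd_Q8 1" "level_D4 n = level_even_D4 (2 ^ k)" "level_D4 (m + n) = level_odd_D4 (2 ^ k)"
      using m 3 level_D4_simps(2) level_D4_simps(3)[of k n] level_D4_simps(4)[of k "m + n"] by (simp_all add: power_add)
    show ?thesis using assms(1,2) unfolding M by (rule augmentation_mult_level_even_D4)
  next
    case (4 k)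
    have M: "level_D4 m = level_odd_Q8 1" "level_D4 n = level_odd_D4 (2 ^ k)" "level_D4 (m + n) = level_even_D4 (2 * 2 ^ k)"
      using m 4 level_D4_simps(2) level_D4_simps(4)[of k n] level_D4_simps(3)[of "k + 1" "m + n"] by (simp_all add: power_add)
    show ?thesis using assms(1,2) unfolding M by (rule augmentation_mult_level_odd_D4)
  qed
next
  case m: (3 k)
  have n: "n \<noteq> 0" "n \<noteq> 1" using assms(3) m by auto
  show ?thesis
  proof (cases n rule: nat_level_cases)
    case n: (3 k')
    have M: "level_D4 m = level_even_D4 (2 ^ k)" "level_D4 n = level_even_D4 (2 ^ k')"
      "level_D4 (m + n) = level_even_D4 (2 ^ k * 2 ^ k')"
      using m n level_D4_simps(3)[of k m] level_D4_simps(3)[of k' n] level_D4_simps(3)[of "k + k'" "m + n"] by (simp_all add: power_add)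
    show ?thesis using assms(1,2) unfolding M by (rule level_even_D4_mult)
  next
    case n: (4 k')
    have M: "level_D4 m = level_even_D4 (2 ^ k)" "level_D4 n = level_odd_D4 (2 ^ k')"
      "level_D4 (m + n) = level_odd_D4 (2 ^ k * 2 ^ k')"
      using m n level_D4_simps(3)[of k m] level_D4_simps(4)[of k' n] level_D4_simps(4)[of "k + k'" "m + n"] by (simp_all add: power_add)
    show ?thesis using assms(1,2) unfolding M by (rule level_even_D4_mult_odd)
  qed (use n in auto)
next
  case m: (4 k)
  have n: "1 < n" "odd n" using assms(3) m by auto
  show ?thesis
  proof (cases n rule: nat_level_cases)
    case n: (4 k')
    have M: "level_D4 m = level_odd_D4 (2 ^ k)" "level_D4 n = level_odd_D4 (2 ^ k')"
      "level_D4 (m + n) = level_even_D4 (2 * (2 ^ k * 2 ^ k'))"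
      using m n level_D4_simps(4)[of k m] level_D4_simps(4)[of k' n] level_D4_simps(3)[of "k + k' + 1" "m + n"] by (simp_all add: power_add)
    show ?thesis using assms(1,2) unfolding M by (rule level_odd_D4_mult)
  qed (use n in auto)
qed

lemma level_D4_mult:
  assumes "level_D4 m v0 v1 v2 v3 v4" "level_D4 n v0' v1' v2' v3' v4'"
  shows "level_D4 (m + n) (v0 * v0') (v1 * v1') (v2 * v2') (v3 * v3') (v4 * v4')"
proof -
  let ?P = "\<lambda>m n. m = 0 \<or> m = 1 \<and> n \<noteq> 0 \<or> 1 < m \<and> even m \<and> 1 < n \<or> 1 < m \<and> odd m \<and> 1 < n \<and> odd n"
  have "?P m n \<or> ?P n m" by (cases "m = 0"; cases "n = 0"; cases "m = 1"; cases "n = 1") auto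
  then show ?thesis
  proof
    assume "?P m n"
    then show ?thesis by (rule level_D4_mult_aux[OF assms])
  next
    assume "?P n m"
    then show ?thesis using level_D4_mult_aux[OF assms(2,1)] by (simp add: mult.commute add.commute)
  qed
qed

lemma level_Q8_mult_aux:
  assumes "level_Q8 m v0 v1 v2 v3 v4" "level_Q8 n v0' v1' v2' v3' v4'"
    and "m = 0 \<or> 0 < m \<and> even m \<and> 0 < n \<or> odd m \<and> odd n"
  shows "level_Q8 (m + n) (v0 * v0') (v1 * v1') (v2 * v2') (v3 * v3') (v4 * v4')"
proof (cases "m = 0")
  case True
  then show ?thesis
    using assms(1,2) in_lattice_mult in_lattice_mult_level_odd_Q8 in_lattice_mult_level_even_Q8
    by (auto simp: level_Q8_def)
next
  case False
  show ?thesis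
  proof (cases "even m")
    case True
    then obtain k where m: "m = 2 * k" "0 < k" using False by (auto elim: evenE)
    have n0: "0 < n" using assms(3) False True by auto
    show ?thesis
    proof (cases "even n")
      case True
      then obtain k' where n: "n = 2 * k'" "0 < k'" using n0 by (auto elim: evenE)
      have M: "level_Q8 m = level_even_Q8 (2 ^ k)" "level_Q8 n = level_even_Q8 (2 ^ k')"
        "level_Q8 (m + n) = level_even_Q8 (2 ^ k * 2 ^ k')"
        using m n level_Q8_simps(2)[of "k + k'" "m + n"] by (simp_all add: level_Q8_simps(2) power_add)
      show ?thesis using assms(1,2) unfolding M by (rule level_even_Q8_mult)
    next
      case False
      then obtain k' where n: "n = 2 * k' + 1" by (auto elim: oddE)
      have M: "level_Q8 m = level_even_Q8 (2 ^ k)" "level_Q8 n = level_odd_Q8 (2 ^ k')"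
        "level_Q8 (m + n) = level_odd_Q8 (2 ^ k * 2 ^ k')"
        using m n level_Q8_simps(2)[of k m] level_Q8_simps(3)[of n k'] level_Q8_simps(3)[of "m + n" "k + k'"] by (simp_all add: power_add)
      show ?thesis using assms(1,2) unfolding M by (rule level_even_Q8_mult_odd)
    qed
  next
    case False
    then obtain k k' where mn: "m = 2 * k + 1" "n = 2 * k' + 1" using assms(3) by (auto elim!: oddE)
    have M: "level_Q8 m = level_odd_Q8 (2 ^ k)" "level_Q8 n = level_odd_Q8 (2 ^ k')"
      "level_Q8 (m + n) = level_even_Q8 (2 * (2 ^ k * 2 ^ k'))"
      using mn level_Q8_simps(3)[of m k] level_Q8_simps(3)[of n k'] level_Q8_simps(2)[of "k + k' + 1" "m + n"] by (simp_all add: power_add)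
    show ?thesis using assms(1,2) unfolding M by (rule level_odd_Q8_mult)
  qed
qed

lemma level_Q8_mult:
  assumes "level_Q8 m v0 v1 v2 v3 v4" "level_Q8 n v0' v1' v2' v3' v4'"
  shows "level_Q8 (m + n) (v0 * v0') (v1 * v1') (v2 * v2') (v3 * v3') (v4 * v4')"
proof -
  let ?P = "\<lambda>m n :: nat. m = 0 \<or> 0 < m \<and> even m \<and> 0 < n \<or> odd m \<and> odd n"
  have "?P m n \<or> ?P n m" by auto
  then show ?thesis
  proof
    assume "?P m n"
    then show ?thesis by (rule level_Q8_mult_aux[OF assms])
  next
    assume "?P n m"
    then show ?thesis using level_Q8_mult_aux[OF assms(2,1)] by (simp add: mult.commute add.commute)
  qed
qed

lemma level_D4_Suc:
  assumes "level_D4 (Suc n) v0 v1 v2 v3 v4"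
  shows "level_D4 n v0 v1 v2 v3 v4"
proof (cases n rule: nat_level_cases)
  case 1
  then show ?thesis using assms augmentation_imp_in_lattice by (simp add: level_D4_def)
next
  case 2
  then show ?thesis using assms level_even_D4_imp_augmentation by (simp add: level_D4_def)
next
  case (3 k)
  then have M: "level_D4 n = level_even_D4 (2 ^ k)" "level_D4 (Suc n) = level_odd_D4 (2 ^ k)"
    using level_D4_simps(3)[of k n] level_D4_simps(4)[of k "Suc n"] by simp_all
  show ?thesis using assms unfolding M by (rule level_odd_D4_imp_even)
next
  case (4 k)
  then have M: "level_D4 n = level_odd_D4 (2 ^ k)" "level_D4 (Suc n) = level_even_D4 (2 * 2 ^ k)"
    using level_D4_simps(4)[of k n] level_D4_simps(3)[of "Suc k" "Suc n"] by simp_all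
  show ?thesis using assms unfolding M by (rule level_even_D4_imp_odd)
qed

lemma level_Q8_Suc:
  assumes "level_Q8 (Suc n) v0 v1 v2 v3 v4"
  shows "level_Q8 n v0 v1 v2 v3 v4"
proof (cases "n = 0")
  case True
  then show ?thesis using assms augmentation_imp_in_lattice by (simp add: level_Q8_def)
next
  case False
  show ?thesis
  proof (cases "even n")
    case True
    then obtain k where "n = 2 * k" "0 < k" using False by (auto elim: evenE)
    then have M: "level_Q8 n = level_even_Q8 (2 ^ k)" "level_Q8 (Suc n) = level_odd_Q8 (2 ^ k)"
      using level_Q8_simps(2)[of k n] level_Q8_simps(3)[of "Suc n" k] by simp_all
    show ?thesis using assms unfolding M by (rule level_odd_Q8_imp_even)
  next
    case False
    then obtain k where "n = 2 * k + 1" by (auto elim: oddE)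
    then have M: "level_Q8 n = level_odd_Q8 (2 ^ k)" "level_Q8 (Suc n) = level_even_Q8 (2 * 2 ^ k)"
      using level_Q8_simps(3)[of n k] level_Q8_simps(2)[of "Suc k" "Suc n"] by simp_all
    show ?thesis using assms unfolding M by (rule level_even_Q8_imp_odd)
  qed
qed

lemma level_D4_imp_in_lattice: "level_D4 n v0 v1 v2 v3 v4 \<Longrightarrow> in_lattice v0 v1 v2 v3 v4"
  by (induction n) (auto simp: level_D4_simps(1) dest: level_D4_Suc)

lemma level_Q8_imp_in_lattice: "level_Q8 n v0 v1 v2 v3 v4 \<Longrightarrow> in_lattice v0 v1 v2 v3 v4"
  by (induction n) (auto simp: level_Q8_simps(1) dest: level_Q8_Suc)

lemma level_D4_add:
  "level_D4 n v0 v1 v2 v3 v4 \<Longrightarrow> level_D4 n v0' v1' v2' v3' v4' \<Longrightarrow>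
    level_D4 n (v0 + v0') (v1 + v1') (v2 + v2') (v3 + v3') (v4 + v4')"
  by (simp add: level_D4_def in_lattice_add level_odd_Q8_add level_even_D4_add level_odd_D4_add split: if_splits)

lemma level_Q8_add:
  "level_Q8 n v0 v1 v2 v3 v4 \<Longrightarrow> level_Q8 n v0' v1' v2' v3' v4' \<Longrightarrow>
    level_Q8 n (v0 + v0') (v1 + v1') (v2 + v2') (v3 + v3') (v4 + v4')"
  by (simp add: level_Q8_def in_lattice_add level_odd_Q8_add level_even_Q8_add split: if_splits)

lemma level_D4_zero: "level_D4 n 0 0 0 0 0"
  by (simp add: level_D4_def in_lattice_const level_odd_Q8_zero level_even_D4_zero level_odd_D4_zero)

lemma level_Q8_zero: "level_Q8 n 0 0 0 0 0"
  by (simp add: level_Q8_def in_lattice_const level_odd_Q8_zero level_even_Q8_zero)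

lemma augmentation_linear:
  "level_odd_Q8 1 0 0 0 (-2) (-2)" "level_odd_Q8 1 0 0 (-2) 0 (-2)" "level_odd_Q8 1 0 0 (-2) (-2) 0"
  "level_odd_Q8 1 0 (-4) (-2) (-2) (-2)"
  by (rule level_odd_Q8I[where k = 0 and l = 0 and m = "-1" and n = 0]
      level_odd_Q8I[where k = 0 and l = "-1" and m = 0 and n = 0]
      level_odd_Q8I[where k = 0 and l = "-1" and m = "-1" and n = 1]
      level_odd_Q8I[where k = "-1" and l = "-1" and m = "-1" and n = 1]; simp; fail)+

section \<open>Normal forms in the presented rings\<close>

lemma genideal_zero: "0 \<in> genideal poly3_ring S"
  and genideal_add: "p \<in> genideal poly3_ring S \<Longrightarrow> q \<in> genideal poly3_ring S \<Longrightarrow> p + q \<in> genideal poly3_ring S"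
  and genideal_mult: "p \<in> genideal poly3_ring S \<Longrightarrow> q * p \<in> genideal poly3_ring S"
  and genideal_base: "s \<in> S \<Longrightarrow> s \<in> genideal poly3_ring S"
proof -
  interpret P: cring poly3_ring by (rule cring_poly3_ring)
  interpret J: ideal "genideal poly3_ring S" poly3_ring by (rule P.genideal_ideal) simp
  show "0 \<in> genideal poly3_ring S" using J.zero_closed by simp
  show "p \<in> genideal poly3_ring S \<Longrightarrow> q \<in> genideal poly3_ring S \<Longrightarrow> p + q \<in> genideal poly3_ring S"
    using J.a_closed[of p q] by simp
  show "p \<in> genideal poly3_ring S \<Longrightarrow> q * p \<in> genideal poly3_ring S"
    using J.I_l_closed[of p q] by simp
  show "s \<in> S \<Longrightarrow> s \<in> genideal poly3_ring S"
    using P.genideal_self[of S] by auto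
qed

definition mono3 :: "nat \<Rightarrow> nat \<Rightarrow> nat \<Rightarrow> poly3" where
  "mono3 i j l = var V1 ^ i * var V2 ^ j * var V3 ^ l"

lemma eval_mono3 [simp]: "eval_poly3 (mono3 i j l) a b c = a ^ i * b ^ j * c ^ l"
  by (simp add: mono3_def)

lemma homogeneous_mono3: "n = i + j + 2 * l \<Longrightarrow> homogeneous n (mono3 i j l)"
  unfolding mono3_def
  using homogeneous_mult[OF homogeneous_mult[OF homogeneous_power[OF homogeneous_var[of V1], of i]
        homogeneous_power[OF homogeneous_var[of V2], of j]] homogeneous_power[OF homogeneous_var[of V3], of l]]
  by simp

lemma homogeneous_of_int_mult: "homogeneous n p \<Longrightarrow> homogeneous n (of_int k * p)"
  using homogeneous_mult[OF homogeneous_of_int[of k], of n p] by simp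

lemma degree_ge_mono3: "n \<le> i + j + 2 * l \<Longrightarrow> degree_ge n (of_int k * mono3 i j l)"
  by (rule homogeneous_degree_ge[OF homogeneous_of_int_mult[OF homogeneous_mono3[OF refl]]])

lemma single_eq_mono3:
  "Poly_Mapping.single m k
    = of_int k * mono3 (Poly_Mapping.lookup m V1) (Poly_Mapping.lookup m V2) (Poly_Mapping.lookup m V3)"
  unfolding single_eq_var_powers[of m k] mono3_def by (simp only: mult_1_right mult.assoc)

text \<open>Reduction modulo the ideal is additive, so it is enough to reduce monomials. Three
  spanning elements per degree serve for both rings.\<close>

lemma normal_form_span:
  assumes mono: "\<And>i j l. i + j + 2 * l = n \<Longrightarrow>
      \<exists>c1 c2 c3. mono3 i j l - (of_int c1 * T1 + of_int c2 * T2 + of_int c3 * T3) \<in> genideal poly3_ring S"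
    and p: "homogeneous n p"
  shows "\<exists>c1 c2 c3. p - (of_int c1 * T1 + of_int c2 * T2 + of_int c3 * T3) \<in> genideal poly3_ring S"
proof -
  let ?J = "genideal poly3_ring S"
  have "\<exists>c1 c2 c3. (\<Sum>m\<in>A. Poly_Mapping.single m (Poly_Mapping.lookup p m))
      - (of_int c1 * T1 + of_int c2 * T2 + of_int c3 * T3) \<in> ?J"
    if "finite A" "A \<subseteq> Poly_Mapping.keys p" for A
    using that
  proof (induction A rule: finite_induct)
    case empty
    show ?case using genideal_zero by (intro exI[of _ 0]) simp
  next
    case (insert m A)
    then obtain c1 c2 c3 where c: "(\<Sum>m\<in>A. Poly_Mapping.single m (Poly_Mapping.lookup p m))
      - (of_int c1 * T1 + of_int c2 * T2 + of_int c3 * T3) \<in> ?J" by auto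
    let ?i = "Poly_Mapping.lookup m V1" and ?j = "Poly_Mapping.lookup m V2" and ?l = "Poly_Mapping.lookup m V3"
    let ?k = "Poly_Mapping.lookup p m"
    have "?i + ?j + 2 * ?l = n"
      using insert.prems p by (auto simp: homogeneous_def monomial_degree_eq)
    then obtain d1 d2 d3 where d: "mono3 ?i ?j ?l - (of_int d1 * T1 + of_int d2 * T2 + of_int d3 * T3) \<in> ?J"
      using mono by blast
    have "(\<Sum>m\<in>insert m A. Poly_Mapping.single m (Poly_Mapping.lookup p m))
        - (of_int (?k * d1 + c1) * T1 + of_int (?k * d2 + c2) * T2 + of_int (?k * d3 + c3) * T3)
      = of_int ?k * (mono3 ?i ?j ?l - (of_int d1 * T1 + of_int d2 * T2 + of_int d3 * T3))
        + ((\<Sum>m\<in>A. Poly_Mapping.single m (Poly_Mapping.lookup p m))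
          - (of_int c1 * T1 + of_int c2 * T2 + of_int c3 * T3))"
      using insert.hyps by (simp add: single_eq_mono3[of m] algebra_simps)
    also have "\<dots> \<in> ?J" by (intro genideal_add genideal_mult c d)
    finally show ?case by blast
  qed
  from this[of "Poly_Mapping.keys p"] show ?thesis by (simp add: poly3_sum_single)
qed

section \<open>Reduction of monomials to normal forms\<close>

definition S_D4 :: "poly3 set" where
  "S_D4 = {2 * var V1, 2 * var V2, 4 * var V3, var V1 * var V2, var V1 * var V3 - var V2 * var V3}"

definition S_Q8 :: "poly3 set" where
  "S_Q8 = {2 * var V1, 2 * var V2, 8 * var V3, var V1 ^ 2, var V2 ^ 2, var V1 * var V2 - 4 * var V3}"

text \<open>Besides x^n and y^n one class of monomials survives in degree n: a power of b, or in odd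
  degree x b^k, which equals y b^k if k > 0. In degree 0 all three elements are 1, and in degree 1
  this one coincides with x.\<close>

definition D4_third :: "nat \<Rightarrow> poly3" where
  "D4_third n = (if even n then mono3 0 0 (n div 2) else mono3 1 0 (n div 2))"

text \<open>From x b = y b and x y = 0 follow x^2 b = x y b = 0 and likewise y^2 b = 0. So b
  tolerates at most one further factor of degree 1, and that may be taken to be x.\<close>

lemma D4_monomial:
  assumes n: "i + j + 2 * l = n"
  shows "\<exists>c1 c2 c3. mono3 i j l - (of_int c1 * mono3 n 0 0 + of_int c2 * mono3 0 n 0 + of_int c3 * D4_third n)
    \<in> genideal poly3_ring S_D4"
proof -
  let ?J = "genideal poly3_ring S_D4"
  have xy: "var V1 * var V2 \<in> ?J" and xu: "var V1 * var V3 - var V2 * var V3 \<in> ?J"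
    by (intro genideal_base; simp add: S_D4_def)+
  have in_J: ?thesis if "mono3 i j l \<in> ?J"
    using that by (intro exI[of _ 0]) simp
  consider "i > 0 \<and> j > 0" | "j = 0 \<and> l = 0" | "i = 0 \<and> l = 0" | "i = 0 \<and> j = 0"
    | "j = 0 \<and> i = 1 \<and> l > 0" | "j = 0 \<and> i > 1 \<and> l > 0" | "i = 0 \<and> j = 1 \<and> l > 0" | "i = 0 \<and> j > 1 \<and> l > 0"
    by fastforce
  then show ?thesis
  proof cases
    case 1
    then obtain i' j' where "i = Suc i'" "j = Suc j'" by (metis Suc_pred)
    then have "mono3 i j l = mono3 i' j' l * (var V1 * var V2)" by (simp add: mono3_def algebra_simps)
    then show ?thesis using in_J genideal_mult[OF xy] by simp
  next
    case 2
    then show ?thesis using n genideal_zero by (intro exI[of _ 1] exI[of _ 0]) simp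
  next
    case 3
    have "mono3 i j l - (of_int 0 * mono3 n 0 0 + of_int 1 * mono3 0 n 0 + of_int 0 * D4_third n) = 0"
      using 3 n by simp
    then show ?thesis using genideal_zero by metis
  next
    case 4
    have "mono3 i j l - (of_int 0 * mono3 n 0 0 + of_int 0 * mono3 0 n 0 + of_int 1 * D4_third n) = 0"
      using 4 n by (auto simp: D4_third_def)
    then show ?thesis using genideal_zero by metis
  next
    case 5
    have "mono3 i j l - (of_int 0 * mono3 n 0 0 + of_int 0 * mono3 0 n 0 + of_int 1 * D4_third n) = 0"
      using 5 n by (auto simp: D4_third_def)
    then show ?thesis using genideal_zero by metis
  next
    case 6
    then obtain i' l' where "i = Suc (Suc i')" "l = Suc l'" "j = 0"
      by (metis Suc_pred less_imp_Suc_add plus_1_eq_Suc add.commute)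
    then have "mono3 i j l = mono3 i' 0 l' * (var V1 * (var V1 * var V3 - var V2 * var V3) + var V3 * (var V1 * var V2))"
      by (simp add: mono3_def algebra_simps)
    then show ?thesis using in_J genideal_mult genideal_add xy xu by metis
  next
    case 7
    then obtain l' where l: "l = Suc l'" by (metis Suc_pred)
    have "mono3 i j l - (of_int 0 * mono3 n 0 0 + of_int 0 * mono3 0 n 0 + of_int 1 * D4_third n)
        = - mono3 0 0 l' * (var V1 * var V3 - var V2 * var V3)"
      using 7 n l by (auto simp: D4_third_def mono3_def algebra_simps)
    then show ?thesis using genideal_mult[OF xu] by metis
  next
    case 8
    then obtain j' l' where "j = Suc (Suc j')" "l = Suc l'" "i = 0"
      by (metis Suc_pred less_imp_Suc_add plus_1_eq_Suc add.commute)
    then have "mono3 i j l = mono3 0 j' l' * ((- var V2) * (var V1 * var V3 - var V2 * var V3) + var V3 * (var V1 * var V2))"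
      by (simp add: mono3_def algebra_simps)
    then show ?thesis using in_J genideal_mult genideal_add xy xu by metis
  qed
qed

text \<open>By x^2 = y^2 = 0 and x y = 4 u at most one of x and y survives, to the first power. The
  zeros pad each parity to the three terms that \<open>normal_form_span\<close> expects.\<close>

lemma Q8_monomial:
  assumes n: "i + j + 2 * l = n"
  shows "\<exists>c1 c2 c3. mono3 i j l - (of_int c1 * (if odd n then mono3 1 0 (n div 2) else 0)
      + of_int c2 * (if odd n then mono3 0 1 (n div 2) else 0)
      + of_int c3 * (if even n then mono3 0 0 (n div 2) else 0)) \<in> genideal poly3_ring S_Q8"
    (is "\<exists>c1 c2 c3. mono3 i j l - (of_int c1 * ?T1 + of_int c2 * ?T2 + of_int c3 * ?T3) \<in> ?J")
proof -
  have xx: "var V1 ^ 2 \<in> ?J" and yy: "var V2 ^ 2 \<in> ?J" and xy: "var V1 * var V2 - 4 * var V3 \<in> ?J"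
    by (intro genideal_base; simp add: S_Q8_def)+
  have in_J: ?thesis if "mono3 i j l \<in> ?J"
    using that by (intro exI[of _ 0]) simp
  consider "i \<ge> 2" | "j \<ge> 2" | "i = 0 \<and> j = 0" | "i = 1 \<and> j = 0" | "i = 0 \<and> j = 1" | "i = 1 \<and> j = 1"
    by fastforce
  then show ?thesis
  proof cases
    case 1
    then obtain i' where "i = i' + 2" by (metis add.commute le_Suc_ex)
    then have "mono3 i j l = mono3 i' j l * var V1 ^ 2"
      by (simp add: mono3_def power_add power2_eq_square mult_ac)
    then show ?thesis using in_J genideal_mult[OF xx] by simp
  next
    case 2
    then obtain j' where "j = j' + 2" by (metis add.commute le_Suc_ex)
    then have "mono3 i j l = mono3 i j' l * var V2 ^ 2"
      by (simp add: mono3_def power_add power2_eq_square mult_ac)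
    then show ?thesis using in_J genideal_mult[OF yy] by simp
  next
    case 3
    then have "mono3 i j l - (of_int 0 * ?T1 + of_int 0 * ?T2 + of_int 1 * ?T3) = 0"
      using n by auto
    then show ?thesis using genideal_zero by metis
  next
    case 4
    then have "mono3 i j l - (of_int 1 * ?T1 + of_int 0 * ?T2 + of_int 0 * ?T3) = 0"
      using n by auto
    then show ?thesis using genideal_zero by metis
  next
    case 5
    then have "mono3 i j l - (of_int 0 * ?T1 + of_int 1 * ?T2 + of_int 0 * ?T3) = 0"
      using n by auto
    then show ?thesis using genideal_zero by metis
  next
    case 6
    then have "n = 2 * Suc l" using n by simp
    then have T: "?T1 = 0" "?T2 = 0" "?T3 = mono3 0 0 (Suc l)" by simp_all
    have "mono3 i j l - (of_int 0 * ?T1 + of_int 0 * ?T2 + of_int 4 * ?T3)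
        = mono3 0 0 l * (var V1 * var V2 - 4 * var V3)"
      unfolding T using 6 by (simp add: mono3_def algebra_simps)
    then show ?thesis using genideal_mult[OF xy] by metis
  qed
qed

text \<open>For D4 both characters are -1 on \<open>r\<close>, and each is trivial on one class of
  reflections. Hence x y vanishes off the class of \<open>r\<close>, where its value 4 lies in the
  third step, and x b = y b holds exactly. With the character trivial on \<open>r\<close> instead of
  y, x y would be 4 on a class of reflections, where the third step requires multiples of 8.\<close>

definition xs_D4 :: "nat \<Rightarrow> int" where "xs_D4 k = [0, 0, -2, 0, -2] ! k"
definition ys_D4 :: "nat \<Rightarrow> int" where "ys_D4 k = [0, 0, -2, -2, 0] ! k"
definition xs_Q8 :: "nat \<Rightarrow> int" where "xs_Q8 k = [0, 0, 0, -2, -2] ! k"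
definition ys_Q8 :: "nat \<Rightarrow> int" where "ys_Q8 k = [0, 0, -2, 0, -2] ! k"

lemma xs_ys_simps [simp]:
  "xs_D4 0 = 0" "xs_D4 1 = 0" "xs_D4 (Suc 0) = 0" "xs_D4 2 = -2" "xs_D4 3 = 0" "xs_D4 4 = -2"
  "ys_D4 0 = 0" "ys_D4 1 = 0" "ys_D4 (Suc 0) = 0" "ys_D4 2 = -2" "ys_D4 3 = -2" "ys_D4 4 = 0"
  "xs_Q8 0 = 0" "xs_Q8 1 = 0" "xs_Q8 (Suc 0) = 0" "xs_Q8 2 = 0" "xs_Q8 3 = -2" "xs_Q8 4 = -2"
  "ys_Q8 0 = 0" "ys_Q8 1 = 0" "ys_Q8 (Suc 0) = 0" "ys_Q8 2 = -2" "ys_Q8 3 = 0" "ys_Q8 4 = -2"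
  by (simp_all add: xs_D4_def ys_D4_def xs_Q8_def ys_Q8_def)

lemma two_power_double: "(2 :: int) ^ (2 * k) = 2 ^ k * 2 ^ k"
  by (simp add: power_mult power_mult_distrib[symmetric])

lemma four_power: "(4 :: int) ^ k = 2 ^ k * 2 ^ k"
  by (simp add: power_mult_distrib[symmetric])

section \<open>Polynomials realising the congruences\<close>

lemma level_D4_span:
  assumes "level_D4 n v0 v1 v2 v3 v4"
  shows "\<exists>p. degree_ge n p \<and>
    v0 = eval_poly3 p (xs_D4 0) (ys_D4 0) 0 \<and> v1 = eval_poly3 p (xs_D4 1) (ys_D4 1) 4 \<and>
    v2 = eval_poly3 p (xs_D4 2) (ys_D4 2) 2 \<and> v3 = eval_poly3 p (xs_D4 3) (ys_D4 3) (1 - 1) \<and>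
    v4 = eval_poly3 p (xs_D4 4) (ys_D4 4) (1 - 1)"
proof (cases n rule: nat_level_cases)
  case 1
  then obtain k l m r where v: "v1 = v0 + 4 * k" "v2 = v0 + 2 * l" "v3 = v0 + 2 * m" "v4 = v0 + 2 * (k + l + m + 2 * r)"
    using assms unfolding level_D4_def in_lattice_def by auto
  let ?p = "of_int v0 * mono3 0 0 0 + (of_int (- m) * mono3 0 1 0 + (of_int (- (k + l + m + 2 * r)) * mono3 1 0 0 +
    (of_int k * mono3 0 0 1 + of_int (- m - k - r) * mono3 1 1 0)))"
  have "degree_ge n ?p" by (intro degree_ge_add degree_ge_mono3) (use 1 in simp_all)
  then show ?thesis by (intro exI[of _ ?p]) (simp add: v)
next
  case 2
  then obtain k l m r where v: "v0 = 0" "v1 = 4 * k" "v2 = 2 * l" "v3 = 2 * m" "v4 = 2 * (l + m + k + 2 * r)"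
    using assms unfolding level_D4_def level_odd_Q8_def by auto
  let ?p = "of_int (- m) * mono3 0 1 0 + (of_int (- (k + l + m + 2 * r)) * mono3 1 0 0 +
    (of_int k * mono3 0 0 1 + of_int (- m - k - r) * mono3 1 1 0))"
  have "degree_ge n ?p" by (intro degree_ge_add degree_ge_mono3) (use 2 in simp_all)
  then show ?thesis by (intro exI[of _ ?p]) (simp add: v)
next
  case (3 i)
  let ?q = "2 ^ i :: int"
  have "level_even_D4 ?q v0 v1 v2 v3 v4" using assms level_D4_simps(3)[OF 3] by simp
  then obtain k l m r where v: "v0 = 0" "v1 = ?q * ?q * k" "v2 = ?q * k + 2 * ?q * l" "v3 = ?q * ?q * m" "v4 = ?q * ?q * r"
    unfolding level_even_D4_def by blast
  obtain j where j: "i = Suc j" using 3 by (cases i) auto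
  \<comment> \<open>x^n and y^n are fitted to the two classes of reflections and b^i to r^2. The
    monomial x y b^j vanishes off the class of \<open>r\<close> and corrects the value
    there.\<close>
  let ?p = "of_int r * mono3 (2 * i) 0 0 + (of_int m * mono3 0 (2 * i) 0 + (of_int k * mono3 0 0 i +
    of_int (l - (r + m) * 2 ^ j) * mono3 1 1 j))"
  have "degree_ge n ?p" by (intro degree_ge_add degree_ge_mono3) (use 3 j in simp_all)
  moreover have "v2 = eval_poly3 ?p (- 2) (- 2) 2" "v3 = eval_poly3 ?p 0 (- 2) 0" "v4 = eval_poly3 ?p (- 2) 0 0"
    "v1 = eval_poly3 ?p 0 0 4" "v0 = eval_poly3 ?p 0 0 0"
    unfolding v using 3 by (simp_all add: two_power_double four_power) (simp_all add: j algebra_simps)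
  ultimately show ?thesis by (intro exI[of _ ?p]) simp
next
  case (4 i)
  let ?q = "2 ^ i :: int"
  have "level_odd_D4 ?q v0 v1 v2 v3 v4" using assms level_D4_simps(4)[OF 4] by simp
  then obtain k l m r where v: "v0 = 0" "v1 = 4 * ?q * ?q * k" "v2 = 2 * ?q * l" "v3 = 2 * ?q * ?q * m" "v4 = 2 * ?q * ?q * r"
    unfolding level_odd_D4_def by blast
  let ?p = "of_int (- r) * mono3 (Suc (2 * i)) 0 0 + (of_int (- m) * mono3 0 (Suc (2 * i)) 0 +
    (of_int (k - l + ?q * (r + m)) * mono3 1 0 i + of_int k * mono3 0 0 (Suc i)))"
  have "degree_ge n ?p" by (intro degree_ge_add degree_ge_mono3) (use 4 in simp_all)
  moreover have "v2 = eval_poly3 ?p (- 2) (- 2) 2" "v3 = eval_poly3 ?p 0 (- 2) 0" "v4 = eval_poly3 ?p (- 2) 0 0"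
    "v1 = eval_poly3 ?p 0 0 4" "v0 = eval_poly3 ?p 0 0 0"
    unfolding v using 4 by (simp_all add: two_power_double four_power) (simp_all add: algebra_simps)
  ultimately show ?thesis by (intro exI[of _ ?p]) simp
qed

lemma level_Q8_span:
  assumes "level_Q8 n v0 v1 v2 v3 v4"
  shows "\<exists>p. degree_ge n p \<and>
    v0 = eval_poly3 p (xs_Q8 0) (ys_Q8 0) 0 \<and> v1 = eval_poly3 p (xs_Q8 1) (ys_Q8 1) 4 \<and>
    v2 = eval_poly3 p (xs_Q8 2) (ys_Q8 2) 2 \<and> v3 = eval_poly3 p (xs_Q8 3) (ys_Q8 3) (1 - (- 1)) \<and>
    v4 = eval_poly3 p (xs_Q8 4) (ys_Q8 4) (1 - (- 1))"
proof (cases "n = 0")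
  case True
  then obtain k l m r where v: "v1 = v0 + 4 * k" "v2 = v0 + 2 * l" "v3 = v0 + 2 * m" "v4 = v0 + 2 * (k + l + m + 2 * r)"
    using assms unfolding level_Q8_def in_lattice_def by auto
  let ?p = "of_int v0 * mono3 0 0 0 + (of_int k * mono3 0 0 1 + (of_int (k - l) * mono3 0 1 0 +
    (of_int (k - m) * mono3 1 0 0 + of_int (k + r) * mono3 1 1 0)))"
  have "degree_ge n ?p" by (intro degree_ge_add degree_ge_mono3) (use True in simp_all)
  then show ?thesis by (intro exI[of _ ?p]) (simp add: v)
next
  case False
  show ?thesis
  proof (cases "even n")
    case True
    then obtain j where n: "n = 2 * Suc j" using False by (metis evenE mult_0_right not0_implies_Suc)
    let ?q = "2 ^ Suc j :: int"
    have "level_even_Q8 ?q v0 v1 v2 v3 v4" using assms level_Q8_simps(2)[of "Suc j" n] n by simp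
    then obtain k l m r where v: "v0 = 0" "v1 = ?q * ?q * k" "v2 = ?q * k + 2 * ?q * l" "v3 = ?q * k + 2 * ?q * m"
      "v4 = ?q * k + 2 * ?q * r"
      unfolding level_even_Q8_def by blast
    \<comment> \<open>The monomials y u^(j + 1) and x u^(j + 1) have degree n + 1; they adjust the
      values at \<open>r\<close> and \<open>s\<close>. Then x y u^j, supported on the class of
      \<open>r s\<close>, adjusts the last one.\<close>
    let ?p = "of_int k * mono3 0 0 (Suc j) + (of_int (- l) * mono3 0 1 (Suc j) + (of_int (- m) * mono3 1 0 (Suc j) +
      of_int (r - m - l) * mono3 1 1 j))"
    have "degree_ge n ?p" by (intro degree_ge_add degree_ge_mono3) (use n in simp_all)
    moreover have "v2 = eval_poly3 ?p 0 (- 2) 2" "v3 = eval_poly3 ?p (- 2) 0 2" "v4 = eval_poly3 ?p (- 2) (- 2) 2"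
      "v1 = eval_poly3 ?p 0 0 4" "v0 = eval_poly3 ?p 0 0 0"
      unfolding v by (simp_all add: four_power algebra_simps)
    ultimately show ?thesis by (intro exI[of _ ?p]) simp
  next
    case False
    then obtain j where n: "n = 2 * j + 1" by (auto elim: oddE)
    let ?q = "2 ^ j :: int"
    have "level_odd_Q8 ?q v0 v1 v2 v3 v4" using assms level_Q8_simps(3)[OF n] by simp
    then obtain k l m r where v: "v0 = 0" "v1 = 4 * ?q * ?q * k" "v2 = 2 * ?q * l" "v3 = 2 * ?q * m"
      "v4 = 2 * ?q * (l + m + k + 2 * r)"
      unfolding level_odd_Q8_def by blast
    let ?p = "of_int k * mono3 0 0 (Suc j) + (of_int (k - l) * mono3 0 1 j + (of_int (k - m) * mono3 1 0 j +
      of_int (k + r) * mono3 1 1 j))"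
    have "degree_ge n ?p" by (intro degree_ge_add degree_ge_mono3) (use n in simp_all)
    moreover have "v2 = eval_poly3 ?p 0 (- 2) 2" "v3 = eval_poly3 ?p (- 2) 0 2" "v4 = eval_poly3 ?p (- 2) (- 2) 2"
      "v1 = eval_poly3 ?p 0 0 4" "v0 = eval_poly3 ?p 0 0 0"
      unfolding v by (simp_all add: four_power algebra_simps)
    ultimately show ?thesis by (intro exI[of _ ?p]) simp
  qed
qed

section \<open>Orders of the normal forms in the graded ring\<close>

lemma mult_genideal_int:
  assumes "of_int a * p \<in> genideal poly3_ring S" and "a dvd c"
  shows "of_int c * (q * p) \<in> genideal poly3_ring S"
proof -
  obtain b where "c = a * b" using assms(2) by (rule dvdE)
  then have "of_int c * (q * p) = of_int b * q * (of_int a * p)" by (simp add: algebra_simps)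
  then show ?thesis using genideal_mult[OF assms(1)] by metis
qed

text \<open>Q stands for 2^k in degrees 2 k and 2 k + 1; the equations have the shapes in which the
  congruences deliver them below.\<close>

lemma int_cancel:
  fixes Q c K L m :: int
  assumes Q: "Q \<noteq> 0"
  shows "Q * Q * c = 4 * Q * Q * m \<Longrightarrow> c = 4 * m"
    and "Q * Q * c = 2 * Q * Q * m \<Longrightarrow> c = 2 * m"
    and "- 2 * (Q * Q) * c = 2 * Q * (2 * Q) * m \<Longrightarrow> - c = 2 * m"
    and "- 2 * Q * c = 2 * Q * 0 + 2 * (2 * Q) * m \<Longrightarrow> - c = 2 * m"
    and "c * Q = 2 * Q * m \<Longrightarrow> c = 2 * m"
proof -
  have Q2: "Q * Q \<noteq> 0" using Q by simp
  show "c = 4 * m" if "Q * Q * c = 4 * Q * Q * m"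
    by (rule mult_left_cancel[OF Q2, THEN iffD1]) (use that in \<open>simp add: mult_ac\<close>)
  show "c = 2 * m" if "Q * Q * c = 2 * Q * Q * m"
    by (rule mult_left_cancel[OF Q2, THEN iffD1]) (use that in \<open>simp add: mult_ac\<close>)
  show "- c = 2 * m" if "- 2 * (Q * Q) * c = 2 * Q * (2 * Q) * m"
  proof -
    have "2 * ((Q * Q) * - c) = 2 * ((Q * Q) * (2 * m))" using that by (simp add: algebra_simps)
    then have "(Q * Q) * - c = (Q * Q) * (2 * m)" by simp
    then show ?thesis unfolding mult_left_cancel[OF Q2] .
  qed
  show "- c = 2 * m" if "- 2 * Q * c = 2 * Q * 0 + 2 * (2 * Q) * m"
  proof -
    have "2 * (Q * - c) = 2 * (Q * (2 * m))" using that by (simp add: algebra_simps)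
    then have "Q * - c = Q * (2 * m)" by simp
    then show ?thesis unfolding mult_left_cancel[OF Q] .
  qed
  show "c = 2 * m" if "c * Q = 2 * Q * m"
    by (rule mult_left_cancel[OF Q, THEN iffD1]) (use that in \<open>simp add: mult_ac\<close>)
qed

lemma homogeneous_D4_third: "homogeneous n (D4_third n)"
  unfolding D4_third_def by (auto intro!: homogeneous_mono3 elim: oddE)

lemma homogeneous_combination:
  "homogeneous n T1 \<Longrightarrow> homogeneous n T2 \<Longrightarrow> homogeneous n T3 \<Longrightarrow>
    homogeneous n (of_int c1 * T1 + of_int c2 * T2 + of_int c3 * T3)"
  by (intro homogeneous_add homogeneous_of_int_mult)

text \<open>For n > 1 the coefficients of x^n and y^n are read off on the two classes of
  reflections, where the other terms vanish, and the third coefficient at r^2 or, in odd degree, at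
  \<open>r\<close>. The next level makes them even, and the coefficient of b^(n/2) divisible by 4:
  exactly what the relations annihilate.\<close>

lemma D4_normal_form_in_ideal:
  fixes n c1 c2 c3
  defines "q \<equiv> of_int c1 * mono3 n 0 0 + of_int c2 * mono3 0 n 0 + of_int c3 * D4_third n"
  assumes lev: "level_D4 (Suc n) (eval_poly3 q (xs_D4 0) (ys_D4 0) 0) (eval_poly3 q (xs_D4 1) (ys_D4 1) 4)
      (eval_poly3 q (xs_D4 2) (ys_D4 2) 2) (eval_poly3 q (xs_D4 3) (ys_D4 3) (1 - 1))
      (eval_poly3 q (xs_D4 4) (ys_D4 4) (1 - 1))"
  shows "q \<in> genideal poly3_ring S_D4"
proof -
  let ?J = "genideal poly3_ring S_D4"
  have "2 * var V1 \<in> ?J" "2 * var V2 \<in> ?J" "4 * var V3 \<in> ?J"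
    by (intro genideal_base; simp add: S_D4_def)+
  then have gen: "of_int 2 * var V1 \<in> ?J" "of_int 2 * var V2 \<in> ?J" "of_int 4 * var V3 \<in> ?J" by simp_all
  have x: "of_int c * mono3 (Suc i) j l \<in> ?J" if "2 dvd c" for c i j l
  proof -
    have "mono3 (Suc i) j l = mono3 i j l * var V1" by (simp add: mono3_def algebra_simps)
    then show ?thesis using mult_genideal_int[OF gen(1) that] by simp
  qed
  have y: "of_int c * mono3 i (Suc j) l \<in> ?J" if "2 dvd c" for c i j l
  proof -
    have "mono3 i (Suc j) l = mono3 i j l * var V2" by (simp add: mono3_def algebra_simps)
    then show ?thesis using mult_genideal_int[OF gen(2) that] by simp
  qed
  have u: "of_int c * mono3 i j (Suc l) \<in> ?J" if "4 dvd c" for c i j l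
  proof -
    have "mono3 i j (Suc l) = mono3 i j l * var V3" by (simp add: mono3_def algebra_simps)
    then show ?thesis using mult_genideal_int[OF gen(3) that] by simp
  qed
  show ?thesis
  proof (cases n rule: nat_level_cases)
    case 1
    \<comment> \<open>In degree 0 all three monomials are 1, and level 1 forces the value at the
      identity to vanish.\<close>
    then have "c1 + c2 + c3 = 0"
      using lev by (simp add: q_def D4_third_def level_D4_def level_odd_Q8_def)
    then have "of_int c1 + of_int c2 + of_int c3 = (0 :: poly3)" by (metis of_int_0 of_int_add)
    then have "q = 0" using 1 by (simp add: q_def D4_third_def mono3_def)
    then show ?thesis using genideal_zero by simp
  next
    case 2
    have "level_D4 (Suc n) = level_even_D4 2" using 2 by (simp add: level_D4_def)
    then obtain m r where "- 2 * c2 = 4 * m" "- 2 * (c1 + c3) = 4 * r"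
      using lev 2 by (auto simp: q_def D4_third_def level_even_D4_def algebra_simps)
    then have d: "2 dvd c2" "2 dvd c1 + c3" by presburger+
    \<comment> \<open>In degree 1 the third monomial is x again, so only c1 + c3 is determined by
      the values.\<close>
    have "q = of_int (c1 + c3) * mono3 (Suc 0) 0 0 + of_int c2 * mono3 0 (Suc 0) 0"
      using 2 by (simp add: q_def D4_third_def algebra_simps)
    then show ?thesis using genideal_add[OF x[OF d(2)] y[OF d(1)]] by metis
  next
    case (3 k)
    let ?q = "2 ^ k :: int"
    have q0: "?q \<noteq> 0" by simp
    have "level_D4 (Suc n) = level_odd_D4 ?q" using 3 level_D4_simps(4)[of k "Suc n"] by simp
    then have lev': "level_odd_D4 ?q (eval_poly3 q 0 0 0) (eval_poly3 q 0 0 4) (eval_poly3 q (- 2) (- 2) 2)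
      (eval_poly3 q 0 (- 2) 0) (eval_poly3 q (- 2) 0 0)" using lev by simp
    have e: "eval_poly3 q 0 0 4 = ?q * ?q * c3" "eval_poly3 q 0 (- 2) 0 = ?q * ?q * c2"
      "eval_poly3 q (- 2) 0 0 = ?q * ?q * c1"
      using 3 by (simp_all add: q_def D4_third_def two_power_double four_power zero_power)
    obtain K m r where v: "?q * ?q * c3 = 4 * ?q * ?q * K" "?q * ?q * c2 = 2 * ?q * ?q * m"
      "?q * ?q * c1 = 2 * ?q * ?q * r"
      using lev' unfolding level_odd_D4_def e by blast
    have "c3 = 4 * K" "c2 = 2 * m" "c1 = 2 * r"
      using int_cancel(1)[OF q0 v(1)] int_cancel(2)[OF q0 v(2)] int_cancel(2)[OF q0 v(3)] by auto
    then have d: "4 dvd c3" "2 dvd c2" "2 dvd c1" by simp_all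
    obtain j where j: "k = Suc j" using 3 by (cases k) auto
    have "q = of_int c1 * mono3 (Suc (Suc (2 * j))) 0 0 + of_int c2 * mono3 0 (Suc (Suc (2 * j))) 0
        + of_int c3 * mono3 0 0 (Suc j)"
      using 3 j by (simp add: q_def D4_third_def)
    then show ?thesis using genideal_add[OF genideal_add[OF x[OF d(3)] y[OF d(2)]] u[OF d(1)]] by metis
  next
    case (4 k)
    let ?q = "2 ^ k :: int"
    have q0: "?q * ?q \<noteq> 0" "?q \<noteq> 0" by simp_all
    have "level_D4 (Suc n) = level_even_D4 (2 * ?q)" using 4 level_D4_simps(3)[of "Suc k" "Suc n"] by simp
    then have lev': "level_even_D4 (2 * ?q) (eval_poly3 q 0 0 0) (eval_poly3 q 0 0 4) (eval_poly3 q (- 2) (- 2) 2)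
      (eval_poly3 q 0 (- 2) 0) (eval_poly3 q (- 2) 0 0)" using lev by simp
    have e: "eval_poly3 q 0 0 4 = 0" "eval_poly3 q (- 2) (- 2) 2 = - 2 * ?q * (?q * (c1 + c2) + c3)"
      "eval_poly3 q 0 (- 2) 0 = - 2 * (?q * ?q) * c2" "eval_poly3 q (- 2) 0 0 = - 2 * (?q * ?q) * c1"
      using 4 by (simp_all add: q_def D4_third_def two_power_double zero_power)
        (simp_all add: algebra_simps)
    obtain K L m r where v: "0 = 2 * ?q * (2 * ?q) * K" "- 2 * ?q * (?q * (c1 + c2) + c3) = 2 * ?q * K + 2 * (2 * ?q) * L"
      "- 2 * (?q * ?q) * c2 = 2 * ?q * (2 * ?q) * m" "- 2 * (?q * ?q) * c1 = 2 * ?q * (2 * ?q) * r"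
      using lev' unfolding level_even_D4_def e by blast
    \<comment> \<open>The value at r^2 is zero, so the coupled term drops out and the condition at
      \<open>r\<close> becomes divisibility by 4 * 2^k.\<close>
    have K: "K = 0" using v(1) by simp
    have c: "- c2 = 2 * m" "- c1 = 2 * r"
      using int_cancel(3)[OF q0(2) v(3)] int_cancel(3)[OF q0(2) v(4)] by auto
    have "- (?q * (c1 + c2) + c3) = 2 * L" using int_cancel(4)[OF q0(2) v(2)[unfolded K]] .
    moreover have d: "2 dvd c1" "2 dvd c2" using c by presburger+
    ultimately have d3: "2 dvd c3" by (metis dvd_add dvd_add_right_iff dvd_minus_iff dvd_mult dvd_triv_left)
    have "q = of_int c1 * mono3 (Suc (2 * k)) 0 0 + of_int c2 * mono3 0 (Suc (2 * k)) 0
        + of_int c3 * mono3 (Suc 0) 0 k"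
      using 4 by (simp add: q_def D4_third_def)
    then show ?thesis using genideal_add[OF genideal_add[OF x[OF d(1)] y[OF d(2)]] x[OF d3]] by metis
  qed
qed

lemma Q8_normal_form_in_ideal:
  fixes n c1 c2 c3
  defines "q \<equiv> of_int c1 * (if odd n then mono3 1 0 (n div 2) else 0)
      + of_int c2 * (if odd n then mono3 0 1 (n div 2) else 0)
      + of_int c3 * (if even n then mono3 0 0 (n div 2) else 0)"
  assumes lev: "level_Q8 (Suc n) (eval_poly3 q (xs_Q8 0) (ys_Q8 0) 0) (eval_poly3 q (xs_Q8 1) (ys_Q8 1) 4)
      (eval_poly3 q (xs_Q8 2) (ys_Q8 2) 2) (eval_poly3 q (xs_Q8 3) (ys_Q8 3) (1 - (- 1)))
      (eval_poly3 q (xs_Q8 4) (ys_Q8 4) (1 - (- 1)))"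
  shows "q \<in> genideal poly3_ring S_Q8"
proof -
  let ?J = "genideal poly3_ring S_Q8"
  have "2 * var V1 \<in> ?J" "2 * var V2 \<in> ?J" "8 * var V3 \<in> ?J"
    by (intro genideal_base; simp add: S_Q8_def)+
  then have gen: "of_int 2 * var V1 \<in> ?J" "of_int 2 * var V2 \<in> ?J" "of_int 8 * var V3 \<in> ?J" by simp_all
  have lev: "level_Q8 (Suc n) (eval_poly3 q 0 0 0) (eval_poly3 q 0 0 4) (eval_poly3 q 0 (- 2) 2)
      (eval_poly3 q (- 2) 0 2) (eval_poly3 q (- 2) (- 2) 2)"
    using lev by simp
  show ?thesis
  proof (cases "even n")
    case True
    then obtain k where n: "n = 2 * k" by (rule evenE)
    then have q: "q = of_int c3 * mono3 0 0 k" by (simp add: q_def)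
    have "level_Q8 (Suc n) = level_odd_Q8 (2 ^ k)" using n by (simp add: level_Q8_simps(3))
    then have lev': "level_odd_Q8 (2 ^ k) (c3 * 0 ^ k) (c3 * 4 ^ k) (c3 * 2 ^ k) (c3 * 2 ^ k) (c3 * 2 ^ k)"
      using lev by (simp add: q)
    show ?thesis
    proof (cases k)
      case 0
      then have "c3 = 0" using lev' by (simp add: level_odd_Q8_def)
      then show ?thesis using genideal_zero by (simp add: q)
    next
      case (Suc j)
      let ?q = "2 ^ k :: int"
      have q0: "?q * ?q \<noteq> 0" "?q \<noteq> 0" by simp_all
      obtain K L m r where v: "c3 * 4 ^ k = 4 * ?q * ?q * K" "c3 * ?q = 2 * ?q * L" "c3 * ?q = 2 * ?q * m"
        "c3 * ?q = 2 * ?q * (L + m + K + 2 * r)"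
        using lev' unfolding level_odd_Q8_def by blast
      have "?q * ?q * c3 = 4 * ?q * ?q * K" using v(1) by (simp add: four_power mult_ac)
      then have "c3 = 4 * K" "c3 = 2 * L" "c3 = 2 * m" "c3 = 2 * (L + m + K + 2 * r)"
        using int_cancel(1)[OF q0(2)] int_cancel(5)[OF q0(2) v(2)] int_cancel(5)[OF q0(2) v(3)]
          int_cancel(5)[OF q0(2) v(4)] by blast+
      \<comment> \<open>Here L = m = 2 K, and the equation for the last value becomes 3 K + 2 r = 0,
        so K is even. The value at r^2 alone would give only divisibility by 4; the coupled last
        coordinate of \<open>level_odd_Q8\<close> accounts for the order 8.\<close>
      then have "8 dvd c3" by presburger
      moreover have "mono3 0 0 k = mono3 0 0 j * var V3" by (simp add: Suc mono3_def)
      ultimately show ?thesis using mult_genideal_int[OF gen(3)] by (simp add: q)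
    qed
  next
    case False
    then obtain k where n: "n = 2 * k + 1" by (rule oddE)
    let ?q = "2 ^ k :: int"
    have q0: "?q \<noteq> 0" by simp
    have q: "q = of_int c1 * mono3 1 0 k + of_int c2 * mono3 0 1 k" using n by (simp add: q_def)
    have "level_Q8 (Suc n) = level_even_Q8 (2 * ?q)" using n level_Q8_simps(2)[of "Suc k" "Suc n"] by simp
    then have lev': "level_even_Q8 (2 * ?q) 0 0 (- 2 * ?q * c2) (- 2 * ?q * c1) (- 2 * ?q * c1 - 2 * ?q * c2)"
      using lev by (simp add: q algebra_simps)
    obtain K L m where v: "0 = 2 * ?q * (2 * ?q) * K" "- 2 * ?q * c2 = 2 * ?q * K + 2 * (2 * ?q) * L"
      "- 2 * ?q * c1 = 2 * ?q * K + 2 * (2 * ?q) * m"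
      using lev' unfolding level_even_Q8_def by blast
    have K: "K = 0" using v(1) by simp
    have c: "- c2 = 2 * L" "- c1 = 2 * m"
      using int_cancel(4)[OF q0 v(2)[unfolded K]] int_cancel(4)[OF q0 v(3)[unfolded K]] by auto
    have d: "2 dvd c1" "2 dvd c2" using c by presburger+
    have "q = of_int c1 * (mono3 0 0 k * var V1) + of_int c2 * (mono3 0 0 k * var V2)"
      by (simp add: q mono3_def algebra_simps)
    then show ?thesis using genideal_add[OF mult_genideal_int[OF gen(1) d(1)] mult_genideal_int[OF gen(2) d(2)]] by metis
  qed
qed

lemma D4_normal_form:
  assumes "homogeneous n p"
  shows "\<exists>q. homogeneous n q \<and> p - q \<in> genideal poly3_ring S_D4 \<and>
    (level_D4 (Suc n) (eval_poly3 q (xs_D4 0) (ys_D4 0) 0) (eval_poly3 q (xs_D4 1) (ys_D4 1) 4)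
      (eval_poly3 q (xs_D4 2) (ys_D4 2) 2) (eval_poly3 q (xs_D4 3) (ys_D4 3) (1 - 1))
      (eval_poly3 q (xs_D4 4) (ys_D4 4) (1 - 1)) \<longrightarrow> q \<in> genideal poly3_ring S_D4)"
proof -
  obtain c1 c2 c3 where c: "p - (of_int c1 * mono3 n 0 0 + of_int c2 * mono3 0 n 0 + of_int c3 * D4_third n)
      \<in> genideal poly3_ring S_D4"
    using normal_form_span[OF D4_monomial assms] by blast
  then show ?thesis
    using D4_normal_form_in_ideal[of n c1 c2 c3]
      homogeneous_combination[OF homogeneous_mono3[of n n 0 0] homogeneous_mono3[of n 0 n 0] homogeneous_D4_third]
    by (intro exI conjI impI) (assumption | simp)+
qed

lemma Q8_normal_form:
  assumes "homogeneous n p"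
  shows "\<exists>q. homogeneous n q \<and> p - q \<in> genideal poly3_ring S_Q8 \<and>
    (level_Q8 (Suc n) (eval_poly3 q (xs_Q8 0) (ys_Q8 0) 0) (eval_poly3 q (xs_Q8 1) (ys_Q8 1) 4)
      (eval_poly3 q (xs_Q8 2) (ys_Q8 2) 2) (eval_poly3 q (xs_Q8 3) (ys_Q8 3) (1 - (- 1)))
      (eval_poly3 q (xs_Q8 4) (ys_Q8 4) (1 - (- 1))) \<longrightarrow> q \<in> genideal poly3_ring S_Q8)"
proof -
  obtain c1 c2 c3 where c: "p - (of_int c1 * (if odd n then mono3 1 0 (n div 2) else 0)
      + of_int c2 * (if odd n then mono3 0 1 (n div 2) else 0)
      + of_int c3 * (if even n then mono3 0 0 (n div 2) else 0)) \<in> genideal poly3_ring S_Q8"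
    using normal_form_span[OF Q8_monomial assms] by blast
  have "homogeneous n (if odd n then mono3 1 0 (n div 2) else 0)"
    "homogeneous n (if odd n then mono3 0 1 (n div 2) else 0)"
    "homogeneous n (if even n then mono3 0 0 (n div 2) else 0)"
    by (auto intro!: homogeneous_mono3 elim: oddE)
  from homogeneous_combination[OF this, of c1 c2 c3] show ?thesis
    using c Q8_normal_form_in_ideal[of n c1 c2 c3] by (intro exI conjI impI) assumption+
qed

lemma S_D4_relation:
  assumes "p \<in> S_D4"
  shows "\<exists>n. homogeneous n p \<and>
    level_D4 (Suc n) (eval_poly3 p (xs_D4 0) (ys_D4 0) 0) (eval_poly3 p (xs_D4 1) (ys_D4 1) 4)
      (eval_poly3 p (xs_D4 2) (ys_D4 2) 2) (eval_poly3 p (xs_D4 3) (ys_D4 3) (1 - 1))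
      (eval_poly3 p (xs_D4 4) (ys_D4 4) (1 - 1))"
proof -
  have h: "homogeneous 1 (2 * var V1)" "homogeneous 1 (2 * var V2)" "homogeneous 2 (4 * var V3)"
    "homogeneous 2 (var V1 * var V2)" "homogeneous 3 (var V1 * var V3 - var V2 * var V3)"
    using homogeneous_of_int_mult[OF homogeneous_var[of V1], of 2] homogeneous_of_int_mult[OF homogeneous_var[of V2], of 2]
      homogeneous_of_int_mult[OF homogeneous_var[of V3], of 4]
      homogeneous_mult[OF homogeneous_var[of V1] homogeneous_var[of V2]]
      homogeneous_diff[OF homogeneous_mult[OF homogeneous_var[of V1] homogeneous_var[of V3]], of "var V2 * var V3"]
      homogeneous_mult[OF homogeneous_var[of V2] homogeneous_var[of V3]]
    by (simp_all add: numeral_2_eq_2 numeral_3_eq_3)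
  have L: "level_D4 (Suc 1) = level_even_D4 2" "level_D4 (Suc 2) = level_odd_D4 2"
    by (simp_all add: level_D4_def)
  consider "p = 2 * var V1" | "p = 2 * var V2" | "p = 4 * var V3" | "p = var V1 * var V2"
    | "p = var V1 * var V3 - var V2 * var V3"
    using assms unfolding S_D4_def by blast
  then show ?thesis
  proof cases
    case 1
    show ?thesis unfolding 1 by (intro exI[of _ 1] conjI h, unfold L)
      (rule level_even_D4I[where k = 0 and l = "-1" and m = 0 and n = "-1"]; simp)
  next
    case 2
    show ?thesis unfolding 2 by (intro exI[of _ 1] conjI h, unfold L)
      (rule level_even_D4I[where k = 0 and l = "-1" and m = "-1" and n = 0]; simp)
  next
    case 3
    show ?thesis unfolding 3 by (intro exI[of _ 2] conjI h, unfold L)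
      (rule level_odd_D4I[where k = 1 and l = 2 and m = 0 and n = 0]; simp)
  next
    case 4
    show ?thesis unfolding 4 by (intro exI[of _ 2] conjI h, unfold L)
      (rule level_odd_D4I[where k = 0 and l = 1 and m = 0 and n = 0]; simp)
  next
    case 5
    \<comment> \<open>This relation holds exactly: b = 0 on the reflections and x = y on all other
      classes.\<close>
    show ?thesis unfolding 5 by (intro exI[of _ 3] conjI h) (simp add: level_D4_zero)
  qed
qed

lemma S_Q8_relation:
  assumes "p \<in> S_Q8"
  shows "\<exists>n. homogeneous n p \<and>
    level_Q8 (Suc n) (eval_poly3 p (xs_Q8 0) (ys_Q8 0) 0) (eval_poly3 p (xs_Q8 1) (ys_Q8 1) 4)
      (eval_poly3 p (xs_Q8 2) (ys_Q8 2) 2) (eval_poly3 p (xs_Q8 3) (ys_Q8 3) (1 - (- 1)))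
      (eval_poly3 p (xs_Q8 4) (ys_Q8 4) (1 - (- 1)))"
proof -
  have h: "homogeneous 1 (2 * var V1)" "homogeneous 1 (2 * var V2)" "homogeneous 2 (8 * var V3)"
    "homogeneous 2 (var V1 ^ 2)" "homogeneous 2 (var V2 ^ 2)" "homogeneous 2 (var V1 * var V2 - 4 * var V3)"
    using homogeneous_of_int_mult[OF homogeneous_var[of V1], of 2] homogeneous_of_int_mult[OF homogeneous_var[of V2], of 2]
      homogeneous_of_int_mult[OF homogeneous_var[of V3], of 8]
      homogeneous_power[OF homogeneous_var[of V1], of 2] homogeneous_power[OF homogeneous_var[of V2], of 2]
      homogeneous_diff[OF homogeneous_mult[OF homogeneous_var[of V1] homogeneous_var[of V2]], of "4 * var V3"]
      homogeneous_of_int_mult[OF homogeneous_var[of V3], of 4]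
    by (simp_all add: numeral_2_eq_2)
  have L: "level_Q8 (Suc 1) = level_even_Q8 2" "level_Q8 (Suc 2) = level_odd_Q8 2"
    by (simp_all add: level_Q8_def)
  consider "p = 2 * var V1" | "p = 2 * var V2" | "p = 8 * var V3" | "p = var V1 ^ 2" | "p = var V2 ^ 2"
    | "p = var V1 * var V2 - 4 * var V3"
    using assms unfolding S_Q8_def by blast
  then show ?thesis
  proof cases
    case 1
    show ?thesis unfolding 1 by (intro exI[of _ 1] conjI h, unfold L)
      (rule level_even_Q8I[where k = 0 and l = 0 and m = "-1" and n = "-1"]; simp)
  next
    case 2
    show ?thesis unfolding 2 by (intro exI[of _ 1] conjI h, unfold L)
      (rule level_even_Q8I[where k = 0 and l = "-1" and m = 0 and n = "-1"]; simp)
  next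
    case 3
    show ?thesis unfolding 3 by (intro exI[of _ 2] conjI h, unfold L)
      (rule level_odd_Q8I[where k = 2 and l = 4 and m = 4 and n = "-3"]; simp)
  next
    case 4
    show ?thesis unfolding 4 by (intro exI[of _ 2] conjI h, unfold L)
      (rule level_odd_Q8I[where k = 0 and l = 0 and m = 1 and n = 0]; simp)
  next
    case 5
    show ?thesis unfolding 5 by (intro exI[of _ 2] conjI h, unfold L)
      (rule level_odd_Q8I[where k = 0 and l = 1 and m = 0 and n = 0]; simp)
  next
    case 6
    \<comment> \<open>The five values of x y - 4 u are 0, -16, -8, -8, -4.\<close>
    show ?thesis unfolding 6 by (intro exI[of _ 2] conjI h, unfold L)
      (rule level_odd_Q8I[where k = "-1" and l = "-2" and m = "-2" and n = 2]; simp)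
  qed
qed

section \<open>The groups D4 and Q8\<close>

definition mat2 :: "complex \<Rightarrow> complex \<Rightarrow> complex \<Rightarrow> complex \<Rightarrow> complex mat" where
  "mat2 a b c d = mat 2 2 (\<lambda>(i, j). if i = 0 then (if j = 0 then a else b) else (if j = 0 then c else d))"

lemma mat2_carrier: "mat2 a b c d \<in> carrier_mat 2 2"
  by (simp add: mat2_def)

lemma mat2_mult:
  "mat2 a b c d * mat2 a' b' c' d' = mat2 (a * a' + b * c') (a * b' + b * d') (c * a' + d * c') (c * b' + d * d')"
  by (intro eq_matI) (auto simp: mat2_def scalar_prod_def sum_lessThan_2 less_2_cases_iff')

lemma mat2_one: "1\<^sub>m 2 = mat2 1 0 0 1"
  by (intro eq_matI) (auto simp: mat2_def less_2_cases_iff')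

lemma mat2_rows: "mat_of_rows_list 2 [[a, b], [c, d]] = mat2 a b c d"
  by (intro eq_matI) (auto simp: mat2_def mat_of_rows_list_def less_2_cases_iff')

lemma (in group) linear_is_rep:
  assumes mult: "\<And>g h. g \<in> carrier G \<Longrightarrow> h \<in> carrier G \<Longrightarrow> f (g \<otimes> h) = f g * f h"
    and one: "f \<one> = 1"
  shows "is_rep G 1 (\<lambda>g. mat 1 1 (\<lambda>_. complex_of_int (f g)))"
proof (rule is_repI)
  show "mat 1 1 (\<lambda>_. complex_of_int (f (g \<otimes> h)))
      = mat 1 1 (\<lambda>_. complex_of_int (f g)) * mat 1 1 (\<lambda>_. complex_of_int (f h))"
    if "g \<in> carrier G" "h \<in> carrier G" for g h
    by (intro eq_matI) (use that in \<open>auto simp: scalar_prod_def mult\<close>)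
  show "mat 1 1 (\<lambda>_. complex_of_int (f \<one>)) = 1\<^sub>m 1"
    by (intro eq_matI) (auto simp: one)
qed simp

section \<open>The dihedral group\<close>

lemma D4_simps:
  "carrier D4 = {0..<4} \<times> UNIV"
  "(i, e) \<otimes>\<^bsub>D4\<^esub> (j, f) = ((if e then i - j else i + j) mod 4, e \<noteq> f)"
  "\<one>\<^bsub>D4\<^esub> = (0, False)"
  by (simp_all add: D4_def dihedral_group_def)

lemma D4_cases:
  assumes "g \<in> carrier D4"
  obtains i e where "g = (i, e)" "i = 0 \<or> i = 1 \<or> i = 2 \<or> i = 3"
proof -
  obtain i e where "g = (i, e)" "0 \<le> i" "i < 4" using assms by (auto simp: D4_simps(1))
  moreover from this have "i = 0 \<or> i = 1 \<or> i = 2 \<or> i = 3" by linarith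
  ultimately show ?thesis using that by blast
qed

lemma group_D4: "group D4"
proof (rule groupI)
  fix g h k assume "g \<in> carrier D4" "h \<in> carrier D4" "k \<in> carrier D4"
  then show "g \<otimes>\<^bsub>D4\<^esub> h \<otimes>\<^bsub>D4\<^esub> k = g \<otimes>\<^bsub>D4\<^esub> (h \<otimes>\<^bsub>D4\<^esub> k)"
    by (auto simp: D4_simps mod_simps algebra_simps)
next
  fix g assume g: "g \<in> carrier D4"
  then obtain i e where ie: "g = (i, e)" by (cases g)
  show "\<exists>h\<in>carrier D4. h \<otimes>\<^bsub>D4\<^esub> g = \<one>\<^bsub>D4\<^esub>"
    by (rule bexI[of _ "if e then (i, e) else ((- i) mod 4, e)"])
      (use g in \<open>auto simp: ie D4_simps mod_simps\<close>)
qed (auto simp: D4_simps)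

definition cls_D4 :: "int \<times> bool \<Rightarrow> nat" where
  "cls_D4 = (\<lambda>(i, e). if e then (if even i then 3 else 4) else if i = 0 then 0 else if i = 2 then 1 else 2)"

text \<open>The power i^k for the residues k = 0, 1, 2, 3 to which exponents are reduced.\<close>

definition i_power :: "int \<Rightarrow> complex" where
  "i_power k = (if k = 0 then 1 else if k = 1 then \<i> else if k = 2 then -1 else - \<i>)"

definition D_D4 :: "int \<times> bool \<Rightarrow> complex mat" where
  "D_D4 = (\<lambda>(i, e). if e then mat2 0 (i_power i) (cnj (i_power i)) 0 else mat2 (i_power i) 0 0 (cnj (i_power i)))"

lemma order8_D4: "order8 D4 (1, False) (0, True) cls_D4 1 D_D4"
proof (rule order8.intro[OF group_D4], rule order8_axioms.intro)
  interpret group D4 by (rule group_D4)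
  have pow: "(1, False) [^]\<^bsub>D4\<^esub> (0::nat) = (0, False)" "(1, False) [^]\<^bsub>D4\<^esub> (1::nat) = (1, False)"
    "(1, False) [^]\<^bsub>D4\<^esub> (2::nat) = (2, False)" "(1, False) [^]\<^bsub>D4\<^esub> (3::nat) = (3, False)"
    "(1, False) [^]\<^bsub>D4\<^esub> (4::nat) = (0, False)"
    "(0, True) [^]\<^bsub>D4\<^esub> (0::nat) = (0, False)" "(0, True) [^]\<^bsub>D4\<^esub> (1::nat) = (0, True)"
    "(0, True) [^]\<^bsub>D4\<^esub> (2::nat) = (0, False)"
    by (simp_all add: numeral_eq_Suc nat_pow_Suc D4_simps)
  show "(1, False) \<in> carrier D4" "(0, True) \<in> carrier D4" by (simp_all add: D4_simps)
  show "cls_D4 \<one>\<^bsub>D4\<^esub> = 0" by (simp add: D4_simps cls_D4_def)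
  show "{0, 1, 2, 3, 4} \<subseteq> cls_D4 ` carrier D4"
  proof -
    have "cls_D4 ` {(0, False), (2, False), (1, False), (0, True), (1, True)} \<subseteq> cls_D4 ` carrier D4"
      by (intro image_mono) (auto simp: D4_simps)
    then show ?thesis by (simp add: cls_D4_def)
  qed
  show "(1, False) [^]\<^bsub>D4\<^esub> (4::nat) = \<one>\<^bsub>D4\<^esub>" by (simp add: pow D4_simps)
  show "(1, False) \<otimes>\<^bsub>D4\<^esub> (0, True) = (0, True) \<otimes>\<^bsub>D4\<^esub> (1, False) [^]\<^bsub>D4\<^esub> (3::nat)"
    by (simp add: pow D4_simps)
  show "(1::int) = 1 \<and> (0, True) [^]\<^bsub>D4\<^esub> (2::nat) = \<one>\<^bsub>D4\<^esub> \<or>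
    (1::int) = -1 \<and> (0, True) [^]\<^bsub>D4\<^esub> (2::nat) = (1, False) [^]\<^bsub>D4\<^esub> (2::nat)"
    by (simp add: pow D4_simps)
  show "\<exists>k<4. \<exists>e<2. g = (1, False) [^]\<^bsub>D4\<^esub> (k::nat) \<otimes>\<^bsub>D4\<^esub> (0, True) [^]\<^bsub>D4\<^esub> (e::nat) \<and> cls_D4 g = class_index k e"
    if g: "g \<in> carrier D4" for g
  proof -
    obtain i e where ie: "g = (i, e)" "i = 0 \<or> i = 1 \<or> i = 2 \<or> i = 3" using g by (rule D4_cases)
    have "g = (1, False) [^]\<^bsub>D4\<^esub> (nat i) \<otimes>\<^bsub>D4\<^esub> (0, True) [^]\<^bsub>D4\<^esub> (of_bool e :: nat) \<and>
      cls_D4 g = class_index (nat i) (of_bool e)"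
      unfolding ie(1) using ie(2)
      by (cases e; elim disjE) (simp_all add: pow[simplified] D4_simps cls_D4_def class_index_def)
    moreover have "nat i < 4" "of_bool e < (2::nat)" using ie(2) by auto
    ultimately show ?thesis by blast
  qed
  show "is_rep D4 1 (\<lambda>g. mat 1 1 (\<lambda>_. complex_of_int ([1, 1, \<zeta>, \<eta>, \<zeta> * \<eta>] ! cls_D4 g)))"
    if "\<zeta> \<in> {1, -1}" "\<eta> \<in> {1, -1}" for \<zeta> \<eta>
  proof (rule linear_is_rep)
    have sq: "\<zeta> * \<zeta> = 1" "\<eta> * \<eta> = 1" "\<zeta> * \<eta> * (\<zeta> * \<eta>) = 1" using that by auto
    have val: "[1, 1, \<zeta>, \<eta>, \<zeta> * \<eta>] ! cls_D4 (i, e) = (if odd i then \<zeta> else 1) * (if e then \<eta> else 1)"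
      if "(i, e) \<in> carrier D4" for i e
      using that by (rule D4_cases) (auto simp: cls_D4_def)
    fix g h assume gh: "g \<in> carrier D4" "h \<in> carrier D4"
    obtain i e j f where ie: "g = (i, e)" "h = (j, f)" by (cases g, cases h)
    \<comment> \<open>Reduction modulo 4 preserves parity, and i - j has the parity of i + j; so
      \<zeta>^i \<eta>^e is multiplicative although \<open>s\<close> inverts
      \<open>r\<close>.\<close>
    have "odd ((i - j) mod 4) \<longleftrightarrow> odd i \<noteq> odd j" "odd ((i + j) mod 4) \<longleftrightarrow> odd i \<noteq> odd j" by presburger+
    then show "[1, 1, \<zeta>, \<eta>, \<zeta> * \<eta>] ! cls_D4 (g \<otimes>\<^bsub>D4\<^esub> h)
        = [1, 1, \<zeta>, \<eta>, \<zeta> * \<eta>] ! cls_D4 g * [1, 1, \<zeta>, \<eta>, \<zeta> * \<eta>] ! cls_D4 h"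
      using m_closed[OF gh] gh sq unfolding ie D4_simps(2) by (cases e; cases f) (simp_all add: val)
  qed (simp add: D4_simps cls_D4_def)
  show "is_rep D4 2 D_D4"
  proof (rule is_repI)
    fix g h assume gh: "g \<in> carrier D4" "h \<in> carrier D4"
    obtain i e where ie: "g = (i, e)" "i = 0 \<or> i = 1 \<or> i = 2 \<or> i = 3" using gh(1) by (rule D4_cases)
    obtain j f where jf: "h = (j, f)" "j = 0 \<or> j = 1 \<or> j = 2 \<or> j = 3" using gh(2) by (rule D4_cases)
    have "i_power ((i + j) mod 4) = i_power i * i_power j"
      using ie(2) jf(2) by (elim disjE) (simp_all add: i_power_def)
    moreover have "i_power ((i - j) mod 4) = i_power i * cnj (i_power j)"
      using ie(2) jf(2) by (elim disjE) (simp_all add: i_power_def)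
    ultimately show "D_D4 (g \<otimes>\<^bsub>D4\<^esub> h) = D_D4 g * D_D4 h"
      unfolding ie(1) jf(1) D4_simps(2) by (cases e; cases f) (simp_all add: D_D4_def mat2_mult)
  qed (auto simp: D4_simps D_D4_def mat2_carrier mat2_one i_power_def split: prod.splits)
  show "D_D4 (1, False) = mat_of_rows_list 2 [[\<i>, 0], [0, - \<i>]]"
    "D_D4 (0, True) = mat_of_rows_list 2 [[0, of_int 1], [1, 0]]"
    unfolding mat2_rows by (simp_all add: D_D4_def i_power_def)
qed

section \<open>The quaternion group\<close>

lemma Q8_simps:
  "carrier Q8 = {(1, 0, 0, 0), (-1, 0, 0, 0), (0, 1, 0, 0), (0, -1, 0, 0),
                (0, 0, 1, 0), (0, 0, -1, 0), (0, 0, 0, 1), (0, 0, 0, -1)}"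
  "(a, b, c, d) \<otimes>\<^bsub>Q8\<^esub> (a', b', c', d') = (a * a' - b * b' - c * c' - d * d',
        a * b' + b * a' + c * d' - d * c', a * c' - b * d' + c * a' + d * b', a * d' + b * c' - c * b' + d * a')"
  "\<one>\<^bsub>Q8\<^esub> = (1, 0, 0, 0)"
  by (simp_all add: Q8_def)

lemma group_Q8: "group Q8"
proof (rule groupI)
  fix g h assume "g \<in> carrier Q8" "h \<in> carrier Q8"
  then show "g \<otimes>\<^bsub>Q8\<^esub> h \<in> carrier Q8"
    unfolding Q8_simps(1) by (elim insertE emptyE; simp add: Q8_simps(2))
next
  fix g h k :: "int \<times> int \<times> int \<times> int"
  show "g \<otimes>\<^bsub>Q8\<^esub> h \<otimes>\<^bsub>Q8\<^esub> k = g \<otimes>\<^bsub>Q8\<^esub> (h \<otimes>\<^bsub>Q8\<^esub> k)"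
    by (cases g; cases h; cases k) (simp add: Q8_simps(2) algebra_simps)
next
  fix g assume g: "g \<in> carrier Q8"
  obtain a b c d where ie: "g = (a, b, c, d)" by (cases g)
  show "\<exists>h\<in>carrier Q8. h \<otimes>\<^bsub>Q8\<^esub> g = \<one>\<^bsub>Q8\<^esub>"
    by (rule bexI[of _ "(a, - b, - c, - d)"]) (use g in \<open>auto simp: ie Q8_simps\<close>)
qed (auto simp: Q8_simps)

definition cls_Q8 :: "int \<times> int \<times> int \<times> int \<Rightarrow> nat" where
  "cls_Q8 = (\<lambda>(a, b, c, d). if a = 1 then 0 else if a = -1 then 1 else if b \<noteq> 0 then 2 else if c \<noteq> 0 then 3 else 4)"

text \<open>The standard embedding of the quaternions into complex 2 x 2 matrices, under which j
  becomes the matrix with rows (0, 1) and (-1, 0).\<close>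

definition D_Q8 :: "int \<times> int \<times> int \<times> int \<Rightarrow> complex mat" where
  "D_Q8 = (\<lambda>(a, b, c, d). mat2 (of_int a + of_int b * \<i>) (of_int c + of_int d * \<i>)
    (- of_int c + of_int d * \<i>) (of_int a - of_int b * \<i>))"

text \<open>The choice \<open>s = - j\<close> gives \<open>D s\<close> the sign fixed in \<^locale>\<open>order8\<close>.\<close>

lemma order8_Q8: "order8 Q8 (0, 1, 0, 0) (0, 0, -1, 0) cls_Q8 (-1) D_Q8"
proof (rule order8.intro[OF group_Q8], rule order8_axioms.intro)
  interpret group Q8 by (rule group_Q8)
  let ?r = "(0, 1, 0, 0) :: int \<times> int \<times> int \<times> int" and ?s = "(0, 0, -1, 0) :: int \<times> int \<times> int \<times> int"
  have pow: "?r [^]\<^bsub>Q8\<^esub> (0::nat) = (1, 0, 0, 0)" "?r [^]\<^bsub>Q8\<^esub> (1::nat) = (0, 1, 0, 0)"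
    "?r [^]\<^bsub>Q8\<^esub> (2::nat) = (-1, 0, 0, 0)" "?r [^]\<^bsub>Q8\<^esub> (3::nat) = (0, -1, 0, 0)"
    "?r [^]\<^bsub>Q8\<^esub> (4::nat) = (1, 0, 0, 0)"
    "?s [^]\<^bsub>Q8\<^esub> (0::nat) = (1, 0, 0, 0)" "?s [^]\<^bsub>Q8\<^esub> (1::nat) = (0, 0, -1, 0)"
    "?s [^]\<^bsub>Q8\<^esub> (2::nat) = (-1, 0, 0, 0)"
    by (simp_all add: numeral_eq_Suc nat_pow_Suc Q8_simps)
  show "?r \<in> carrier Q8" "?s \<in> carrier Q8" by (simp_all add: Q8_simps)
  show "cls_Q8 \<one>\<^bsub>Q8\<^esub> = 0" by (simp add: Q8_simps cls_Q8_def)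
  show "{0, 1, 2, 3, 4} \<subseteq> cls_Q8 ` carrier Q8" by (simp add: Q8_simps cls_Q8_def)
  show "?r [^]\<^bsub>Q8\<^esub> (4::nat) = \<one>\<^bsub>Q8\<^esub>" by (simp add: pow Q8_simps)
  show "?r \<otimes>\<^bsub>Q8\<^esub> ?s = ?s \<otimes>\<^bsub>Q8\<^esub> ?r [^]\<^bsub>Q8\<^esub> (3::nat)"
    by (simp add: pow Q8_simps)
  show "(-1::int) = 1 \<and> ?s [^]\<^bsub>Q8\<^esub> (2::nat) = \<one>\<^bsub>Q8\<^esub> \<or>
    (-1::int) = -1 \<and> ?s [^]\<^bsub>Q8\<^esub> (2::nat) = ?r [^]\<^bsub>Q8\<^esub> (2::nat)"
    by (simp add: pow Q8_simps)
  show "\<exists>k<4. \<exists>e<2. g = ?r [^]\<^bsub>Q8\<^esub> (k::nat) \<otimes>\<^bsub>Q8\<^esub> ?s [^]\<^bsub>Q8\<^esub> (e::nat) \<and> cls_Q8 g = class_index k e"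
    if g: "g \<in> carrier Q8" for g
  proof -
    have ex: ?thesis if "k < 4" "e < 2" "g = ?r [^]\<^bsub>Q8\<^esub> k \<otimes>\<^bsub>Q8\<^esub> ?s [^]\<^bsub>Q8\<^esub> e" "cls_Q8 g = class_index k e"
      for k e :: nat
      using that by blast
    show ?thesis
      using g unfolding Q8_simps(1)
    proof (elim insertE emptyE)
      show ?thesis if "g = (1, 0, 0, 0)"
        by (rule ex[of 0 0]) (simp_all only: that pow Q8_simps, simp_all add: cls_Q8_def class_index_def)
      show ?thesis if "g = (-1, 0, 0, 0)"
        by (rule ex[of 2 0]) (simp_all only: that pow Q8_simps, simp_all add: cls_Q8_def class_index_def)
      show ?thesis if "g = (0, 1, 0, 0)"
        by (rule ex[of 1 0]) (simp_all only: that pow Q8_simps, simp_all add: cls_Q8_def class_index_def)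
      show ?thesis if "g = (0, -1, 0, 0)"
        by (rule ex[of 3 0]) (simp_all only: that pow Q8_simps, simp_all add: cls_Q8_def class_index_def)
      show ?thesis if "g = (0, 0, 1, 0)"
        by (rule ex[of 2 1]) (simp_all only: that pow Q8_simps, simp_all add: cls_Q8_def class_index_def)
      show ?thesis if "g = (0, 0, -1, 0)"
        by (rule ex[of 0 1]) (simp_all only: that pow Q8_simps, simp_all add: cls_Q8_def class_index_def)
      show ?thesis if "g = (0, 0, 0, 1)"
        by (rule ex[of 3 1]) (simp_all only: that pow Q8_simps, simp_all add: cls_Q8_def class_index_def)
      show ?thesis if "g = (0, 0, 0, -1)"
        by (rule ex[of 1 1]) (simp_all only: that pow Q8_simps, simp_all add: cls_Q8_def class_index_def)
    qed
  qed
  show "is_rep Q8 1 (\<lambda>g. mat 1 1 (\<lambda>_. complex_of_int ([1, 1, \<zeta>, \<eta>, \<zeta> * \<eta>] ! cls_Q8 g)))"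
    if "\<zeta> \<in> {1, -1}" "\<eta> \<in> {1, -1}" for \<zeta> \<eta>
  proof (rule linear_is_rep)
    have sq: "\<zeta> * \<zeta> = 1" "\<eta> * \<eta> = 1" "\<And>x. \<zeta> * (\<zeta> * x) = x" "\<And>x. \<eta> * (\<eta> * x) = x" using that by auto
    fix g h assume "g \<in> carrier Q8" "h \<in> carrier Q8"
    then show "[1, 1, \<zeta>, \<eta>, \<zeta> * \<eta>] ! cls_Q8 (g \<otimes>\<^bsub>Q8\<^esub> h)
        = [1, 1, \<zeta>, \<eta>, \<zeta> * \<eta>] ! cls_Q8 g * [1, 1, \<zeta>, \<eta>, \<zeta> * \<eta>] ! cls_Q8 h"
      unfolding Q8_simps(1) by (elim insertE emptyE; simp add: Q8_simps(2) cls_Q8_def sq mult_ac)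
  qed (simp add: Q8_simps cls_Q8_def)
  show "is_rep Q8 2 D_Q8"
  proof (rule is_repI)
    \<comment> \<open>Multiplicativity holds for all integer quadruples as a polynomial identity, so
      the eight elements need not be distinguished.\<close>
    fix g h :: "int \<times> int \<times> int \<times> int"
    obtain a b c d a' b' c' d' where "g = (a, b, c, d)" "h = (a', b', c', d')" by (metis prod_cases4)
    then show "D_Q8 (g \<otimes>\<^bsub>Q8\<^esub> h) = D_Q8 g * D_Q8 h"
      by (simp add: Q8_simps(2) D_Q8_def mat2_mult, intro arg_cong4[where f = mat2])
        (simp_all add: complex_eq_iff algebra_simps)
  qed (auto simp: Q8_simps(3) D_Q8_def mat2_carrier mat2_one split: prod.splits)
  show "D_Q8 ?r = mat_of_rows_list 2 [[\<i>, 0], [0, - \<i>]]"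
    "D_Q8 ?s = mat_of_rows_list 2 [[0, of_int (-1)], [1, 0]]"
    unfolding mat2_rows by (simp_all add: D_Q8_def)
qed

lemma gamma_presentation_D4:
  "gamma_presentation D4 (1, False) (0, True) cls_D4 1 D_D4 level_D4 xs_D4 ys_D4 S_D4"
proof (rule gamma_presentation.intro[OF order8_D4], rule gamma_presentation_axioms.intro)
  have 1: "level_D4 1 = level_odd_Q8 1" by (simp add: level_D4_def)
  show "level_D4 1 0 0 0 (-2) (-2)" "level_D4 1 0 0 (-2) 0 (-2)" "level_D4 1 0 0 (-2) (-2) 0"
    "level_D4 1 0 (-4) (-2) (-2) (-2)"
    unfolding 1 by (fact augmentation_linear)+
  show "\<exists>\<zeta>\<in>{1, -1}. \<exists>\<eta>\<in>{1, -1}. xs_D4 = (\<lambda>k. [0, 0, \<zeta> - 1, \<eta> - 1, \<zeta> * \<eta> - 1] ! k)"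
    by (rule bexI[of _ "-1"], rule bexI[of _ 1]) (simp_all add: xs_D4_def fun_eq_iff)
  show "\<exists>\<zeta>\<in>{1, -1}. \<exists>\<eta>\<in>{1, -1}. ys_D4 = (\<lambda>k. [0, 0, \<zeta> - 1, \<eta> - 1, \<zeta> * \<eta> - 1] ! k)"
    by (rule bexI[of _ "-1"], rule bexI[of _ "-1"]) (simp_all add: ys_D4_def fun_eq_iff)
  show "level_D4 2 0 4 2 (1 - 1) (1 - 1)"
    unfolding level_D4_simps(3)[of 1 2, simplified]
    by (rule level_even_D4I[where k = 1 and l = 0 and m = 0 and n = 0]) simp_all
qed (rule level_D4_span S_D4_relation D4_normal_form, assumption
    | simp add: level_D4_simps(1) level_D4_zero; fail
    | rule level_D4_imp_in_lattice level_D4_add level_D4_mult level_D4_Suc, assumption+)+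

lemma gamma_presentation_Q8:
  "gamma_presentation Q8 (0, 1, 0, 0) (0, 0, -1, 0) cls_Q8 (-1) D_Q8 level_Q8 xs_Q8 ys_Q8 S_Q8"
proof (rule gamma_presentation.intro[OF order8_Q8], rule gamma_presentation_axioms.intro)
  have 1: "level_Q8 1 = level_odd_Q8 1" by (simp add: level_Q8_def)
  show "level_Q8 1 0 0 0 (-2) (-2)" "level_Q8 1 0 0 (-2) 0 (-2)" "level_Q8 1 0 0 (-2) (-2) 0"
    "level_Q8 1 0 (-4) (-2) (-2) (-2)"
    unfolding 1 by (fact augmentation_linear)+
  show "\<exists>\<zeta>\<in>{1, -1}. \<exists>\<eta>\<in>{1, -1}. xs_Q8 = (\<lambda>k. [0, 0, \<zeta> - 1, \<eta> - 1, \<zeta> * \<eta> - 1] ! k)"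
    by (rule bexI[of _ 1], rule bexI[of _ "-1"]) (simp_all add: xs_Q8_def fun_eq_iff)
  show "\<exists>\<zeta>\<in>{1, -1}. \<exists>\<eta>\<in>{1, -1}. ys_Q8 = (\<lambda>k. [0, 0, \<zeta> - 1, \<eta> - 1, \<zeta> * \<eta> - 1] ! k)"
    by (rule bexI[of _ "-1"], rule bexI[of _ 1]) (simp_all add: ys_Q8_def fun_eq_iff)
  show "level_Q8 2 0 4 2 (1 - (- 1)) (1 - (- 1))"
    unfolding level_Q8_simps(2)[of 1 2, simplified]
    by (rule level_even_Q8I[where k = 1 and l = 0 and m = 0 and n = 0]) simp_all
qed (rule level_Q8_span S_Q8_relation Q8_normal_form, assumption
    | simp add: level_Q8_simps(1) level_Q8_zero; fail
    | rule level_Q8_imp_in_lattice level_Q8_add level_Q8_mult level_Q8_Suc, assumption+)+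

theorem theorem1p5:
  shows "(let x = var V1; y = var V2; b = var V3;
              S = {2 * x, 2 * y, 4 * b, x * y, x * b - y * b}
          in graded_ring_isomorphic (graded_char_ring D4) (graded_char_component D4)
               (presented_ring S) (presented_component S)) \<and>
         (let x = var V1; y = var V2; u = var V3;
              S = {2 * x, 2 * y, 8 * u, x ^ 2, y ^ 2, x * y - 4 * u}
          in graded_ring_isomorphic (graded_char_ring Q8) (graded_char_component Q8)
               (presented_ring S) (presented_component S))"
  using gamma_presentation.graded_char_ring_presentation[OF gamma_presentation_D4]
    gamma_presentation.graded_char_ring_presentation[OF gamma_presentation_Q8]
  unfolding S_D4_def S_Q8_def Let_def by blast

end
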